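(* There is a constant $C>0$ such that for every positive integer $n$, $\tilde{\tau}_{4,n}^*\ge 1.20016-C/n$.
   Context: For a positive integer $k$, let $\Delta_k=\{x\in[0,1]^k:\sum_i x_i=1\}$, $e^i$ the $i$-th unit vector, $[k]=\{1,\dots,k\}$, $\mathrm{Support}(x)=\{i:x_i\neq 0\}$, and $\Delta_{k,n}=\Delta_k\cap((1/n)\mathbb{Z})^k$. A cut is a function $P:\Delta_k\to[k+1]$ with $P(e^i)=i$ for all $i\in[k]$; it is non-opposite if $P(x)\in\mathrm{Support}(x)\cup\{k+1\}$ for every $x\in\Delta_k$. For a probability distribution $\mathcal{P}$ over cuts, $\tau_{k,n}(\mathcal{P})=\max_{x,y\in\Delta_{k,n},x\neq y}\frac{\Pr_{P\sim\mathcal{P}}(P(x)\neq P(y))}{\frac12\|x-y\|_1}$, and $\tilde{\tau}_{k,n}^*=\min\{\tau_{k,n}(\mathcal{P}):\mathcal{P}\text{ a distribution over non-opposite cuts}\}$. *)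

theory Defs
  imports "HOL-Probability.Probability"
begin

text \<open>
  Vectors of \<open>\<real>\<^sup>k\<close> are functions \<open>nat \<Rightarrow> real\<close> with coordinates \<open>1, \<dots>, k\<close> that vanish at
  all other indices, so that \<open>x = y\<close> is equality of vectors.
\<close>

definition unit_vec :: "nat \<Rightarrow> nat \<Rightarrow> real" where
  "unit_vec i = (\<lambda>j. if j = i then 1 else 0)"

definition std_simplex :: "nat \<Rightarrow> (nat \<Rightarrow> real) set" where
  "std_simplex k = {x. (\<forall>i\<in>{1..k}. x i \<in> {0..1}) \<and> (\<forall>i. i \<notin> {1..k} \<longrightarrow> x i = 0)
                   \<and> (\<Sum>i\<in>{1..k}. x i) = 1}"

definition support :: "nat \<Rightarrow> (nat \<Rightarrow> real) \<Rightarrow> nat set" where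
  "support k x = {i \<in> {1..k}. x i \<noteq> 0}"

definition simplex_grid :: "nat \<Rightarrow> nat \<Rightarrow> (nat \<Rightarrow> real) set" where
  "simplex_grid k n = {x \<in> std_simplex k. \<forall>i\<in>{1..k}. \<exists>z::int. x i = of_int z / of_nat n}"

definition l1_dist :: "nat \<Rightarrow> (nat \<Rightarrow> real) \<Rightarrow> (nat \<Rightarrow> real) \<Rightarrow> real" where
  "l1_dist k x y = (\<Sum>i\<in>{1..k}. \<bar>x i - y i\<bar>)"

definition cuts :: "nat \<Rightarrow> ((nat \<Rightarrow> real) \<Rightarrow> nat) set" where
  "cuts k = {P \<in> std_simplex k \<rightarrow>\<^sub>E {1..k + 1}. \<forall>i\<in>{1..k}. P (unit_vec i) = i}"

definition non_opposite_cuts :: "nat \<Rightarrow> ((nat \<Rightarrow> real) \<Rightarrow> nat) set" where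
  "non_opposite_cuts k = {P \<in> cuts k. \<forall>x\<in>std_simplex k. P x \<in> support k x \<union> {k + 1}}"

text \<open>
  A probability distribution over a set \<open>\<C>\<close> of cuts: the \<open>\<sigma>\<close>-algebra is arbitrary, subject only
  to the evaluations \<open>P \<mapsto> P x\<close> being measurable, so that the events \<open>P x \<noteq> P y\<close> have a probability.
\<close>

definition cut_distribution ::
    "nat \<Rightarrow> ((nat \<Rightarrow> real) \<Rightarrow> nat) set \<Rightarrow> ((nat \<Rightarrow> real) \<Rightarrow> nat) measure \<Rightarrow> bool" where
  "cut_distribution k \<C> M \<longleftrightarrow> prob_space M \<and> space M \<subseteq> \<C> \<and>
     (\<forall>x\<in>std_simplex k. (\<lambda>P. P x) \<in> measurable M (count_space {1..k + 1}))"

definition tau :: "nat \<Rightarrow> nat \<Rightarrow> ((nat \<Rightarrow> real) \<Rightarrow> nat) measure \<Rightarrow> real" where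
  "tau k n M = Max {measure M {P \<in> space M. P x \<noteq> P y} / (1 / 2 * l1_dist k x y) | x y.
                      x \<in> simplex_grid k n \<and> y \<in> simplex_grid k n \<and> x \<noteq> y}"

text \<open>
  The infimum below is a minimum: \<open>tau k n M\<close> depends only on the law of \<open>P\<close> restricted to the finite
  grid, and it is continuous in that law, which ranges over a compact set.
\<close>

definition tau_non_opposite :: "nat \<Rightarrow> nat \<Rightarrow> real" where
  "tau_non_opposite k n = Inf {tau k n M | M. cut_distribution k (non_opposite_cuts k) M}"

end

theory Submission
  imports Defs
begin

text \<open>
  By linearity of expectation it suffices to give weights on the edges of one fine grid for which every
  non-opposite cut has large cost: rounding the partial sums of the coordinates maps a fixed grid into the
  grid of mesh \<open>1 / n\<close>, respects supports and terminals, and changes distances by \<open>O(1 / n)\<close> only.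

  The weights combine four instances: a two-dimensional instance of gap \<open>6 / 5\<close> on each face, the six sides,
  the boundaries of small corner triangles of the faces, and the uniform instance on the whole simplex.
  The Sperner-type injection of Mirzakhani and Vondrak shows that the uniform instance costs at least \<open>3 / 2\<close>,
  reduced in proportion to the area of the label \<open>5\<close> in any one face. If some side avoids the label \<open>5\<close>, then on
  the two faces containing that side the two-dimensional cost exceeds \<open>6 / 5\<close> proportionally to that area. If every
  side contains the label \<open>5\<close>, then all sides are cut twice, and each corner triangle of a face either has a cut
  boundary or essentially avoids the label \<open>5\<close>.
\<close>

subsection \<open>Cut edges on paths and triangles\<close>

text \<open>An edge of the grid with \<open>n\<close> edges per side has length 1 / n, so an
  instance certifies the gap \<open>n\<close> * (bound on its cost) / (its total weight). For the
  combination used here put x = m / n, where \<open>m\<close> is the side of the corner triangles.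
  Up to lower order terms the bound is (12 - 9/2 x^2) n^2 and the weight is (10 - 9/2 x^2 + 27/4
  x^3) n^3. Without corner triangles (x = 0) the ratio is exactly 6/5, and this is the barrier to be
  broken. The corner triangles break it because they allow the weight of the sides to be lowered:
  this hurts most the cuts with the label 5 on every side, and the corner triangles repay these cuts
  at a price that is only cubic in x. The bound then exceeds 6/5 of the weight by (9/10 x^2 - 81/10
  x^3) n^3, which is largest at x = 2/27. Hence the proportions \<open>n = 27 * K\<close>,
  \<open>q = 9 * K\<close>, \<open>m = 2 * K\<close>.\<close>

definition cut :: "nat \<Rightarrow> nat \<Rightarrow> real" where
  "cut u v = (if u = v then 0 else 1)"

lemma cut_nonneg [simp]: "0 \<le> cut u v"
  by (simp add: cut_def)

lemma cut_refl [simp]: "cut u u = 0"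
  by (simp add: cut_def)

lemma cut_commute: "cut u v = cut v u"
  by (simp add: cut_def eq_commute)

lemma cut_triangle: "cut u w \<le> cut u v + cut v w"
  by (simp add: cut_def)

definition pathcut :: "(nat \<Rightarrow> nat) \<Rightarrow> nat \<Rightarrow> real" where
  "pathcut f N = (\<Sum>t<N. cut (f t) (f (Suc t)))"

lemma pathcut_nonneg [simp]: "0 \<le> pathcut f N"
  by (simp add: pathcut_def sum_nonneg)

lemma pathcut_segment:
  assumes "i \<le> j"
  shows "cut (f i) (f j) \<le> (\<Sum>t=i..<j. cut (f t) (f (Suc t)))"
  using assms
proof (induction j rule: dec_induct)
  case (step j)
  then show ?case
    using cut_triangle[of "f i" "f (Suc j)" "f j"] by simp
qed simp

lemma pathcut_split:
  assumes "i \<le> N"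
  shows "pathcut f N = (\<Sum>t=0..<i. cut (f t) (f (Suc t))) + (\<Sum>t=i..<N. cut (f t) (f (Suc t)))"
  using assms by (simp add: pathcut_def lessThan_atLeast0 sum.atLeastLessThan_concat)

lemma pathcut_ge: "cut (f 0) (f N) \<le> pathcut f N"
  using pathcut_segment[of 0 N f] by (simp add: pathcut_def lessThan_atLeast0)

lemma pathcut_ge2:
  assumes "i \<le> N"
  shows "cut (f 0) (f i) + cut (f i) (f N) \<le> pathcut f N"
  using pathcut_split[OF assms, of f] pathcut_segment[of 0 i f] pathcut_segment[OF assms, of f]
  by simp

lemma pathcut_ge3:
  assumes "i \<le> j" "j \<le> N"
  shows "cut (f 0) (f i) + cut (f i) (f j) + cut (f j) (f N) \<le> pathcut f N"
  using pathcut_split[of j N f] pathcut_segment[OF assms(2), of f] pathcut_ge2[OF assms(1), of f] assms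
  by (simp add: pathcut_def lessThan_atLeast0)

section \<open>Triangular grids and their labellings\<close>

definition tri :: "nat \<Rightarrow> (nat \<times> nat \<times> nat) set" where
  "tri m = {(a, b, c). a + b + c = m}"

lemma mem_tri [simp]: "(a, b, c) \<in> tri m \<longleftrightarrow> a + b + c = m"
  by (simp add: tri_def)

lemma finite_tri [simp]: "finite (tri m)"
  by (rule finite_subset[of _ "{..m} \<times> {..m} \<times> {..m}"]) (auto simp: tri_def)

lemma sum_tri_rows:
  "(\<Sum>(a, b, c)\<in>tri m. f a b c) = (\<Sum>s\<le>m. \<Sum>t\<le>m - s. f (m - s - t) t s)"
proof -
  have "(\<Sum>s\<le>m. \<Sum>t\<le>m - s. f (m - s - t) t s)
      = (\<Sum>(s, t)\<in>Sigma {..m} (\<lambda>s. {..m - s}). f (m - s - t) t s)"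
    by (simp add: sum.Sigma)
  also have "\<dots> = (\<Sum>(a, b, c)\<in>tri m. f a b c)"
    by (rule sum.reindex_bij_witness[of _ "\<lambda>(a, b, c). (c, b)" "\<lambda>(s, t). (m - s - t, t, s)"]) auto
  finally show ?thesis by simp
qed

lemma sum_tri_swap12: "(\<Sum>(a, b, c)\<in>tri m. f b a c) = (\<Sum>(a, b, c)\<in>tri m. f a b c)"
  by (rule sum.reindex_bij_witness[of _ "\<lambda>(a, b, c). (b, a, c)" "\<lambda>(a, b, c). (b, a, c)"]) auto

lemma sum_tri_swap23: "(\<Sum>(a, b, c)\<in>tri m. f a c b) = (\<Sum>(a, b, c)\<in>tri m. f a b c)"
  by (rule sum.reindex_bij_witness[of _ "\<lambda>(a, b, c). (a, c, b)" "\<lambda>(a, b, c). (a, c, b)"]) auto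

lemma card_tri_Suc: "card (tri (Suc m)) = card (tri m) + m + 2"
proof -
  have "card {(a, b, c) \<in> tri (Suc m). c = 0} = card {..Suc m}"
    by (rule bij_betw_same_card[of "\<lambda>(a, b, c). b"], rule bij_betwI[of _ _ _ "\<lambda>b. (Suc m - b, b, 0)"]) auto
  moreover have "card {(a, b, c) \<in> tri (Suc m). c > 0} = card (tri m)"
    by (rule bij_betw_same_card[of "\<lambda>(a, b, c). (a, b, c - 1)"],
        rule bij_betwI[of _ _ _ "\<lambda>(a, b, c). (a, b, c + 1)"]) auto
  moreover have "card (tri (Suc m)) = card {(a, b, c) \<in> tri (Suc m). c = 0} + card {(a, b, c) \<in> tri (Suc m). c > 0}"
    by (subst card_Un_disjoint[symmetric]) (auto intro!: arg_cong[where f = card] finite_subset[OF _ finite_tri[of "Suc m"]])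
  ultimately show ?thesis by simp
qed

lemma card_tri: "2 * card (tri m) = (m + 1) * (m + 2)"
proof (induction m)
  case 0
  have "tri 0 = {(0, 0, 0)}" by (auto simp: tri_def)
  then show ?case by simp
qed (simp add: card_tri_Suc)

text \<open>The triple \<open>(a, b, c)\<close> stands for the upward triangle with vertices \<open>(a + 1, b, c)\<close>,
  \<open>(a, b + 1, c)\<close> and \<open>(a, b, c + 1)\<close>.\<close>

definition tricut :: "(nat \<Rightarrow> nat \<Rightarrow> nat \<Rightarrow> nat) \<Rightarrow> nat \<Rightarrow> nat \<Rightarrow> nat \<Rightarrow> real" where
  "tricut g a b c = cut (g (Suc a) b c) (g a (Suc b) c) + cut (g (Suc a) b c) (g a b (Suc c))
     + cut (g a (Suc b) c) (g a b (Suc c))"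

definition gridcut :: "nat \<Rightarrow> (nat \<Rightarrow> nat \<Rightarrow> nat \<Rightarrow> nat) \<Rightarrow> real" where
  "gridcut n g = (\<Sum>(a, b, c)\<in>tri (n - 1). tricut g a b c)"

definition mono3 :: "(nat \<Rightarrow> nat \<Rightarrow> nat \<Rightarrow> nat) \<Rightarrow> nat set \<Rightarrow> nat \<Rightarrow> nat \<Rightarrow> nat \<Rightarrow> bool" where
  "mono3 g A a b c \<longleftrightarrow> g (Suc a) b c \<in> A \<and> g a (Suc b) c \<in> A \<and> g a b (Suc c) \<in> A"

text \<open>A non-opposite cut on a face. The labels are parameters, with \<open>z\<close> for the
  label 5, so that a permutation of the coordinates gives another instance and symmetric cases
  follow by interpretation.\<close>

locale labelling =
  fixes n :: nat and g :: "nat \<Rightarrow> nat \<Rightarrow> nat \<Rightarrow> nat" and l1 l2 l3 z :: nat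
  assumes distinct: "distinct [l1, l2, l3, z]"
    and range: "\<And>a b c. a + b + c = n \<Longrightarrow> g a b c \<in> {l1, l2, l3, z}"
    and supp1: "\<And>a b c. a + b + c = n \<Longrightarrow> g a b c = l1 \<Longrightarrow> a > 0"
    and supp2: "\<And>a b c. a + b + c = n \<Longrightarrow> g a b c = l2 \<Longrightarrow> b > 0"
    and supp3: "\<And>a b c. a + b + c = n \<Longrightarrow> g a b c = l3 \<Longrightarrow> c > 0"
begin

lemma swap12: "labelling n (\<lambda>a b c. g b a c) l2 l1 l3 z"
proof
  show "distinct [l2, l1, l3, z]" using distinct by auto
  fix a b c assume *: "a + b + c = n"
  show "g b a c \<in> {l2, l1, l3, z}" using range[of b a c] * by auto
  show "0 < a" if "g b a c = l2" using supp2[of b a c] * that by auto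
  show "0 < b" if "g b a c = l1" using supp1[of b a c] * that by auto
  show "0 < c" if "g b a c = l3" using supp3[of b a c] * that by auto
qed

lemma swap23: "labelling n (\<lambda>a b c. g a c b) l1 l3 l2 z"
proof
  show "distinct [l1, l3, l2, z]" using distinct by auto
  fix a b c assume *: "a + b + c = n"
  show "g a c b \<in> {l1, l3, l2, z}" using range[of a c b] * by auto
  show "0 < a" if "g a c b = l1" using supp1[of a c b] * that by auto
  show "0 < b" if "g a c b = l3" using supp3[of a c b] * that by auto
  show "0 < c" if "g a c b = l2" using supp2[of a c b] * that by auto
qed

end

lemma card_preimage_tri:
  assumes "\<And>a b c. (a, b, c) \<in> tri (Suc k) \<Longrightarrow> P a b c \<Longrightarrow> a > 0"
  shows "card {(a, b, c) \<in> tri (Suc k). P a b c} = card {(a, b, c) \<in> tri k. P (Suc a) b c}"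
proof (rule bij_betw_same_card[of "\<lambda>(a, b, c). (a - 1, b, c)"],
    rule bij_betwI[of _ _ _ "\<lambda>(a, b, c). (Suc a, b, c)"])
  show "(\<lambda>(a, b, c). (a - 1, b, c)) \<in> {(a, b, c) \<in> tri (Suc k). P a b c} \<rightarrow> {(a, b, c) \<in> tri k. P (Suc a) b c}"
    using assms by (fastforce simp: gr0_conv_Suc)
qed (use assms in \<open>auto simp: Suc_diff_1\<close>)

lemma card_tri_filter_swap12:
  "card {(a, b, c) \<in> tri m. P b a c} = card {(a, b, c) \<in> tri m. P a b c}"
  by (rule bij_betw_same_card[of "\<lambda>(a, b, c). (b, a, c)"],
      rule bij_betwI[of _ _ _ "\<lambda>(a, b, c). (b, a, c)"]) auto

lemma card_tri_filter_swap13: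
  "card {(a, b, c) \<in> tri m. P c b a} = card {(a, b, c) \<in> tri m. P a b c}"
  by (rule bij_betw_same_card[of "\<lambda>(a, b, c). (c, b, a)"],
      rule bij_betwI[of _ _ _ "\<lambda>(a, b, c). (c, b, a)"]) auto

section \<open>Sperner bound with \<open>z\<close> merged into the third label\<close>

context labelling begin

text \<open>These are the cut edges that become invisible when \<open>z\<close> is merged into
  \<open>l3\<close>.\<close>

definition wedge :: "nat \<Rightarrow> nat \<Rightarrow> real" where
  "wedge u v = (if u = l3 \<and> v = z \<or> u = z \<and> v = l3 then 1 else 0)"

definition wtri :: "nat \<Rightarrow> nat \<Rightarrow> nat \<Rightarrow> real" where
  "wtri a b c = wedge (g (Suc a) b c) (g a (Suc b) c) + wedge (g (Suc a) b c) (g a b (Suc c))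
     + wedge (g a (Suc b) c) (g a b (Suc c))"

definition mono_merged :: "nat \<Rightarrow> nat \<Rightarrow> nat \<Rightarrow> bool" where
  "mono_merged a b c \<longleftrightarrow> mono3 g {l1} a b c \<or> mono3 g {l2} a b c \<or> mono3 g {l3, z} a b c"

lemma wedge_nonneg [simp]: "0 \<le> wedge u v"
  by (simp add: wedge_def)

lemma wtri_nonneg [simp]: "0 \<le> wtri a b c"
  by (simp add: wtri_def)

lemma tricut_ge:
  assumes "a + b + c + 1 = n"
  shows "tricut g a b c \<ge> (if mono_merged a b c then 0 else 2) + wtri a b c"
proof -
  have ne: "l1 \<noteq> l2" "l1 \<noteq> l3" "l1 \<noteq> z" "l2 \<noteq> l3" "l2 \<noteq> z" "l3 \<noteq> z"
    using distinct by auto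
  have "cut u v + cut u w + cut v w \<ge> (if u = l1 \<and> v = l1 \<and> w = l1 \<or> u = l2 \<and> v = l2 \<and> w = l2
      \<or> u \<in> {l3, z} \<and> v \<in> {l3, z} \<and> w \<in> {l3, z} then 0 else 2) + (wedge u v + wedge u w + wedge v w)"
    if "u \<in> {l1, l2, l3, z}" "v \<in> {l1, l2, l3, z}" "w \<in> {l1, l2, l3, z}" for u v w
    using that by (elim insertE emptyE; simp add: cut_def wedge_def ne ne[symmetric])
  then show ?thesis
    unfolding tricut_def mono_merged_def wtri_def mono3_def singleton_iff
    using range[of "Suc a" b c] range[of a "Suc b" c] range[of a b "Suc c"] assms by simp
qed

text \<open>These are the positions of \<open>z\<close> at which passing to the next row in one of the other two directions
  leaves the label \<open>z\<close>. Each of them costs two cut edges beyond the Sperner bound \<open>2 n\<close>.\<close>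

definition exits :: "nat \<Rightarrow> (nat \<times> nat \<times> nat) set" where
  "exits k = {(a, b, c) \<in> tri k. g (Suc a) (Suc b) c = z
     \<and> \<not> (g (Suc a) b (Suc c) = z \<and> g a (Suc b) (Suc c) = z)}"

lemma finite_exits [simp]: "finite (exits k)"
  by (rule finite_subset[OF _ finite_tri[of k]]) (auto simp: exits_def)

text \<open>A monochromatic triangle with label \<open>l\<^sub>i\<close> has positive \<open>i\<close>-th coordinate, so decreasing that
  coordinate maps it to \<open>tri k\<close>; two triangles with the same image share a vertex. Merging \<open>z\<close> into
  \<open>l3\<close> keeps this injective because the side opposite to the third corner avoids both labels.\<close>

lemma card_mono_merged:
  assumes n: "n = Suc (Suc k)" and bottom: "\<And>a b. a + b = n \<Longrightarrow> g a b 0 \<in> {l1, l2}"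
  shows "card {(a, b, c) \<in> tri (Suc k). mono_merged a b c}
       + card {(a, b, c) \<in> exits k. \<not> mono3 g {l3, z} a b (Suc c)} \<le> card (tri k)"
proof -
  let ?M = "\<lambda>A. {(a, b, c) \<in> tri (Suc k). mono3 g A a b c}"
  define Z1 Z2 Z3 where "Z1 = {(a, b, c) \<in> tri k. mono3 g {l1} (Suc a) b c}"
    and "Z2 = {(a, b, c) \<in> tri k. mono3 g {l2} a (Suc b) c}"
    and "Z3 = {(a, b, c) \<in> tri k. mono3 g {l3, z} a b (Suc c)}"
  define U where "U = {(a, b, c) \<in> exits k. \<not> mono3 g {l3, z} a b (Suc c)}"
  have 1: "card (?M {l1}) = card Z1"
    unfolding Z1_def
  proof (rule card_preimage_tri)
    fix a b c assume "(a, b, c) \<in> tri (Suc k)" "mono3 g {l1} a b c"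
    then show "a > 0" using supp1[of a "Suc b" c] n by (auto simp: mono3_def)
  qed
  have "card {(a, b, c) \<in> tri (Suc k). mono3 g {l2} b a c} = card {(a, b, c) \<in> tri k. mono3 g {l2} b (Suc a) c}"
  proof (rule card_preimage_tri[where P = "\<lambda>a b c. mono3 g {l2} b a c"])
    fix a b c assume "(a, b, c) \<in> tri (Suc k)" "mono3 g {l2} b a c"
    then show "a > 0" using supp2[of "Suc b" a c] n by (auto simp: mono3_def)
  qed
  then have 2: "card (?M {l2}) = card Z2"
    unfolding Z2_def card_tri_filter_swap12[of _ "\<lambda>a b c. mono3 g {l2} a b c"]
      card_tri_filter_swap12[of _ "\<lambda>a b c. mono3 g {l2} a (Suc b) c"] .
  have "card {(a, b, c) \<in> tri (Suc k). mono3 g {l3, z} c b a} = card {(a, b, c) \<in> tri k. mono3 g {l3, z} c b (Suc a)}"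
  proof (rule card_preimage_tri[where P = "\<lambda>a b c. mono3 g {l3, z} c b a"])
    fix a b c assume "(a, b, c) \<in> tri (Suc k)" "mono3 g {l3, z} c b a"
    then show "a > 0" using bottom[of "Suc c" b] n distinct by (cases a) (auto simp: mono3_def)
  qed
  then have 3: "card (?M {l3, z}) = card Z3"
    unfolding Z3_def card_tri_filter_swap13[of _ "\<lambda>a b c. mono3 g {l3, z} a b c"]
      card_tri_filter_swap13[of _ "\<lambda>a b c. mono3 g {l3, z} a b (Suc c)"] .
  have fin: "finite Z1" "finite Z2" "finite Z3" "finite U" "finite (?M A)" for A
    unfolding Z1_def Z2_def Z3_def U_def
    by (rule finite_subset[OF _ finite_tri[of k]] finite_subset[OF _ finite_tri[of "Suc k"]]; auto simp: exits_def)+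
  have "card {(a, b, c) \<in> tri (Suc k). mono_merged a b c} \<le> card (?M {l1} \<union> ?M {l2} \<union> ?M {l3, z})"
    using fin by (intro card_mono) (auto simp: mono_merged_def)
  also have "\<dots> \<le> card Z1 + card Z2 + card Z3"
    using card_Un_le[of "?M {l1} \<union> ?M {l2}" "?M {l3, z}"] card_Un_le[of "?M {l1}" "?M {l2}"] 1 2 3 by linarith
  also have "\<dots> + card U = card (Z1 \<union> Z2 \<union> Z3 \<union> U)"
  proof -
    have "Z1 \<inter> Z2 = {}" "(Z1 \<union> Z2) \<inter> Z3 = {}"
      using distinct unfolding Z1_def Z2_def Z3_def by (auto simp: mono3_def)
    moreover have "(Z1 \<union> Z2 \<union> Z3) \<inter> U = {}"
      using distinct unfolding Z1_def Z2_def Z3_def U_def exits_def by (auto simp: mono3_def)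
    ultimately show ?thesis
      using fin by (simp add: card_Un_disjoint)
  qed
  also have "\<dots> \<le> card (tri k)"
    by (intro card_mono) (auto simp: Z1_def Z2_def Z3_def U_def exits_def)
  finally show ?thesis by (simp add: U_def)
qed

text \<open>Every edge of the grid lies in exactly one upward triangle but in at most one downward
  triangle. The left-hand side runs over the downward triangles with vertices
  \<open>(a + 1, b + 1, c)\<close>, \<open>(a + 1, b, c + 1)\<close>,
  \<open>(a, b + 1, c + 1)\<close>.\<close>

lemma sum_down_wedge_le:
  "(\<Sum>(a, b, c)\<in>tri k. wedge (g (Suc a) (Suc b) c) (g (Suc a) b (Suc c))
      + wedge (g (Suc a) (Suc b) c) (g a (Suc b) (Suc c)) + wedge (g (Suc a) b (Suc c)) (g a (Suc b) (Suc c)))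
   \<le> (\<Sum>(a, b, c)\<in>tri (Suc k). wtri a b c)"
proof -
  have shift: "(\<Sum>(a, b, c)\<in>tri k. f (h (a, b, c))) \<le> (\<Sum>x\<in>tri (Suc k). f x)"
    if "inj_on h (tri k)" "h ` tri k \<subseteq> tri (Suc k)" "\<And>x. f x \<ge> 0"
    for f :: "nat \<times> nat \<times> nat \<Rightarrow> real" and h
  proof -
    have "(\<Sum>x\<in>tri k. f (h x)) = sum f (h ` tri k)"
      using that(1) by (simp add: sum.reindex)
    also have "\<dots> \<le> sum f (tri (Suc k))"
      using that by (intro sum_mono2) auto
    finally show ?thesis by (simp add: case_prod_unfold)
  qed
  have "(\<Sum>(a, b, c)\<in>tri k. wedge (g (Suc a) (Suc b) c) (g (Suc a) b (Suc c)))
      \<le> (\<Sum>(a, b, c)\<in>tri (Suc k). wedge (g a (Suc b) c) (g a b (Suc c)))"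
    using shift[of "\<lambda>(a, b, c). (Suc a, b, c)" "\<lambda>(a, b, c). wedge (g a (Suc b) c) (g a b (Suc c))"]
    by (simp add: inj_on_def image_subset_iff case_prod_unfold tri_def)
  moreover have "(\<Sum>(a, b, c)\<in>tri k. wedge (g (Suc a) (Suc b) c) (g a (Suc b) (Suc c)))
      \<le> (\<Sum>(a, b, c)\<in>tri (Suc k). wedge (g (Suc a) b c) (g a b (Suc c)))"
    using shift[of "\<lambda>(a, b, c). (a, Suc b, c)" "\<lambda>(a, b, c). wedge (g (Suc a) b c) (g a b (Suc c))"]
    by (simp add: inj_on_def image_subset_iff case_prod_unfold tri_def)
  moreover have "(\<Sum>(a, b, c)\<in>tri k. wedge (g (Suc a) b (Suc c)) (g a (Suc b) (Suc c)))
      \<le> (\<Sum>(a, b, c)\<in>tri (Suc k). wedge (g (Suc a) b c) (g a (Suc b) c))"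
    using shift[of "\<lambda>(a, b, c). (a, b, Suc c)" "\<lambda>(a, b, c). wedge (g (Suc a) b c) (g a (Suc b) c)"]
    by (simp add: inj_on_def image_subset_iff case_prod_unfold tri_def)
  ultimately show ?thesis
    by (simp add: wtri_def case_prod_unfold sum.distrib)
qed

text \<open>After merging, at least \<open>n\<close> upward triangles are not monochromatic, and
  each has two cut edges. An exit in \<open>U\<close> occupies one more place in the injection of
  \<open>card_mono_merged\<close>, which forces one more such triangle. An exit in \<open>H\<close>
  has two edges between \<open>l3\<close> and \<open>z\<close> in its downward triangle, and these
  come on top of what the merged labelling pays.\<close>

lemma gridcut_ge_exits:
  assumes n: "n = Suc (Suc k)" and bottom: "\<And>a b. a + b = n \<Longrightarrow> g a b 0 \<in> {l1, l2}"
  shows "gridcut n g \<ge> 2 * real n + 2 * real (card (exits k))"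
proof -
  define U where "U = {(a, b, c) \<in> exits k. \<not> mono3 g {l3, z} a b (Suc c)}"
  define H where "H = {(a, b, c) \<in> exits k. mono3 g {l3, z} a b (Suc c)}"
  define M where "M = {(a, b, c) \<in> tri (Suc k). mono_merged a b c}"
  have fin: "finite U" "finite H" "finite M"
    unfolding U_def H_def M_def
    by (rule finite_subset[OF _ finite_exits[of k]] finite_subset[OF _ finite_tri[of "Suc k"]]; auto)+
  have MU: "card M + card U \<le> card (tri k)"
    using card_mono_merged[OF n bottom] by (simp add: M_def U_def)
  have cardUH: "card (exits k) = card U + card H"
    by (subst card_Un_disjoint[symmetric]) (use fin in \<open>auto intro!: arg_cong[where f = card] simp: U_def H_def\<close>)
  have "2 * real (card H) = (\<Sum>(a, b, c)\<in>H. 2)"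
    by (simp add: case_prod_unfold)
  also have "\<dots> \<le> (\<Sum>(a, b, c)\<in>H. wedge (g (Suc a) (Suc b) c) (g (Suc a) b (Suc c))
      + wedge (g (Suc a) (Suc b) c) (g a (Suc b) (Suc c)) + wedge (g (Suc a) b (Suc c)) (g a (Suc b) (Suc c)))"
    using distinct by (intro sum_mono) (auto simp: H_def exits_def mono3_def wedge_def)
  also have "\<dots> \<le> (\<Sum>(a, b, c)\<in>tri k. wedge (g (Suc a) (Suc b) c) (g (Suc a) b (Suc c))
      + wedge (g (Suc a) (Suc b) c) (g a (Suc b) (Suc c)) + wedge (g (Suc a) b (Suc c)) (g a (Suc b) (Suc c)))"
    by (intro sum_mono2) (simp_all add: case_prod_unfold, auto simp: H_def exits_def)
  also have "\<dots> \<le> (\<Sum>(a, b, c)\<in>tri (Suc k). wtri a b c)"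
    by (rule sum_down_wedge_le)
  finally have W: "2 * real (card H) \<le> (\<Sum>(a, b, c)\<in>tri (Suc k). wtri a b c)" .
  have "(\<Sum>(a, b, c)\<in>tri (Suc k). if mono_merged a b c then 0 else 2 :: real)
      = 2 * real (card (tri (Suc k) - M))"
  proof -
    have "(\<Sum>(a, b, c)\<in>tri (Suc k). if mono_merged a b c then 0 else 2 :: real) = (\<Sum>x\<in>tri (Suc k) - M. 2)"
      by (rule sum.mono_neutral_cong_right) (auto simp: M_def split: if_splits)
    then show ?thesis by simp
  qed
  also have "card (tri (Suc k) - M) = card (tri (Suc k)) - card M"
    using fin by (intro card_Diff_subset) (auto simp: M_def)
  finally have "(\<Sum>(a, b, c)\<in>tri (Suc k). if mono_merged a b c then 0 else 2 :: real)
      = 2 * real (card (tri (Suc k)) - card M)" .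
  moreover have "gridcut n g \<ge> (\<Sum>(a, b, c)\<in>tri (Suc k). (if mono_merged a b c then 0 else 2) + wtri a b c)"
    unfolding gridcut_def using n by (auto intro!: sum_mono tricut_ge)
  ultimately show ?thesis
    using W MU cardUH card_tri_Suc[of k] n by (simp add: case_prod_unfold sum.distrib of_nat_diff)
qed

end

subsection \<open>Labellings with monochromatic corners\<close>

definition dircut :: "nat \<Rightarrow> (nat \<Rightarrow> nat \<Rightarrow> nat \<Rightarrow> nat) \<Rightarrow> real" where
  "dircut n g = (\<Sum>(a, b, c)\<in>tri (n - 1). cut (g (Suc a) b c) (g a (Suc b) c))"

definition row :: "nat \<Rightarrow> (nat \<Rightarrow> nat \<Rightarrow> nat \<Rightarrow> nat) \<Rightarrow> nat \<Rightarrow> nat \<Rightarrow> nat" where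
  "row n g s t = g (n - s - t) t s"

lemma gridcut_eq_dircut:
  "gridcut n g = dircut n g + dircut n (\<lambda>a b c. g a c b) + dircut n (\<lambda>a b c. g c a b)"
proof -
  have "dircut n (\<lambda>a b c. g c a b)
      = (\<Sum>(a, b, c)\<in>tri (n - 1). cut (g a (Suc b) c) (g a b (Suc c)))"
    unfolding dircut_def
    by (rule sum.reindex_bij_witness[of _ "\<lambda>(a, b, c). (b, c, a)" "\<lambda>(a, b, c). (c, a, b)"]) auto
  moreover have "dircut n (\<lambda>a b c. g a c b)
      = (\<Sum>(a, b, c)\<in>tri (n - 1). cut (g (Suc a) b c) (g a b (Suc c)))"
    unfolding dircut_def
    by (rule sum.reindex_bij_witness[of _ "\<lambda>(a, b, c). (a, c, b)" "\<lambda>(a, b, c). (a, c, b)"]) auto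
  ultimately show ?thesis
    unfolding gridcut_def dircut_def tricut_def by (simp add: case_prod_unfold sum.distrib)
qed

lemma gridcut_swap12: "gridcut n (\<lambda>a b c. g b a c) = gridcut n g"
  unfolding gridcut_def
  by (rule sum.reindex_bij_witness[of _ "\<lambda>(a, b, c). (b, a, c)" "\<lambda>(a, b, c). (b, a, c)"])
     (auto simp: tricut_def cut_def)

lemma gridcut_swap23: "gridcut n (\<lambda>a b c. g a c b) = gridcut n g"
  unfolding gridcut_def
  by (rule sum.reindex_bij_witness[of _ "\<lambda>(a, b, c). (a, c, b)" "\<lambda>(a, b, c). (a, c, b)"])
     (auto simp: tricut_def cut_def)

lemma dircut_rows:
  assumes "n > 0"
  shows "dircut n g = (\<Sum>s<n. pathcut (row n g s) (n - s))"
proof -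
  have "pathcut (row n g s) (n - s)
      = (\<Sum>t\<le>n - 1 - s. cut (g (Suc (n - 1 - s - t)) t s) (g (n - 1 - s - t) (Suc t) s))" if "s < n" for s
  proof -
    have "{..n - 1 - s} = {..<n - s}" using that by auto
    then show ?thesis
      unfolding pathcut_def row_def using that by (intro sum.cong) (auto simp: Suc_diff_Suc Suc_diff_le)
  qed
  moreover have "{..n - 1} = {..<n}" using assms by auto
  ultimately show ?thesis
    unfolding dircut_def sum_tri_rows by (auto intro!: sum.cong)
qed

lemma tricut_ge_double: "tricut g a b c \<ge> 2 * cut (g (Suc a) b c) (g a (Suc b) c)"
  using cut_triangle[of "g (Suc a) b c" "g a (Suc b) c" "g a b (Suc c)"]
  by (simp add: tricut_def cut_commute)

definition strip :: "nat \<Rightarrow> (nat \<Rightarrow> nat \<Rightarrow> nat \<Rightarrow> nat) \<Rightarrow> nat \<Rightarrow> real" where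
  "strip n g s = (\<Sum>t<n - s. tricut g (n - 1 - s - t) t s)"

lemma gridcut_strips:
  assumes "n > 0"
  shows "gridcut n g = (\<Sum>s<n. strip n g s)"
proof -
  have "{..n - 1 - s} = {..<n - s}" if "s < n" for s using that by auto
  moreover have "{..n - 1} = {..<n}" using assms by auto
  ultimately show ?thesis
    unfolding gridcut_def sum_tri_rows strip_def by (auto intro!: sum.cong)
qed

lemma strip_ge_row: "strip n g s \<ge> 2 * pathcut (row n g s) (n - s)"
proof -
  have "2 * cut (row n g s t) (row n g s (Suc t)) \<le> tricut g (n - 1 - s - t) t s" if "t < n - s" for t
    using tricut_ge_double[of g "n - 1 - s - t" t s] that
    by (simp add: row_def Suc_diff_Suc)
  then show ?thesis
    unfolding strip_def pathcut_def sum_distrib_left by (intro sum_mono) auto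
qed

text \<open>A cut edge of a row has a second cut edge in its upward triangle, so each strip removed
  at the bottom costs at least 2. This is exactly what the Sperner bound loses when \<open>n\<close>
  drops by one.\<close>

lemma gridcut_shift:
  assumes "s0 < n" and rows: "\<And>s. s < s0 \<Longrightarrow> pathcut (row n g s) (n - s) \<ge> 1"
  shows "gridcut n g \<ge> gridcut (n - s0) (\<lambda>a b c. g a b (c + s0)) + 2 * real s0"
proof -
  have "(\<Sum>s<n. strip n g s) = (\<Sum>s<s0. strip n g s) + (\<Sum>s=s0..<n. strip n g s)"
    using assms by (simp add: lessThan_atLeast0 sum.atLeastLessThan_concat)
  moreover have "(\<Sum>s=s0..<n. strip n g s) = (\<Sum>s<n - s0. strip n g (s + s0))"
    using assms(1) sum.shift_bounds_nat_ivl[of "strip n g" 0 s0 "n - s0"] by (simp add: lessThan_atLeast0)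
  moreover have "strip n g (s + s0) = strip (n - s0) (\<lambda>a b c. g a b (c + s0)) s" for s
    by (auto simp: strip_def tricut_def add.commute intro!: sum.cong)
  moreover have "(\<Sum>s<s0. strip n g s) \<ge> (\<Sum>s<s0. 2)"
  proof (intro sum_mono)
    fix s assume "s \<in> {..<s0}"
    then show "2 \<le> strip n g s" using rows[of s] strip_ge_row[of n g s] by simp
  qed
  ultimately show ?thesis
    using assms(1) by (simp add: gridcut_strips)
qed

text \<open>A face whose three corners carry the labels of their terminals. The size
  \<open>q = n / 3\<close> balances the two cases of \<open>gridcut_ge\<close>: three directions
  with \<open>q + 1\<close> rows cut twice give \<open>6 * (q + 1)\<close>, and the Sperner bound
  gives \<open>2 * n = 6 * q\<close>.\<close>

locale cornered = labelling +
  fixes q :: nat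
  assumes n_eq: "n = 3 * q" and q_ge: "q \<ge> 2"
    and corner1: "\<And>a b c. a + b + c = n \<Longrightarrow> a \<ge> 2 * q \<Longrightarrow> g a b c = l1"
    and corner2: "\<And>a b c. a + b + c = n \<Longrightarrow> b \<ge> 2 * q \<Longrightarrow> g a b c = l2"
    and corner3: "\<And>a b c. a + b + c = n \<Longrightarrow> c \<ge> 2 * q \<Longrightarrow> g a b c = l3"
begin

lemma cornered_swap12: "cornered n (\<lambda>a b c. g b a c) l2 l1 l3 z q"
proof -
  interpret s: labelling n "\<lambda>a b c. g b a c" l2 l1 l3 z by (rule swap12)
  show ?thesis
    by unfold_locales (use n_eq q_ge corner1 corner2 corner3 in auto)
qed

lemma cornered_swap23: "cornered n (\<lambda>a b c. g a c b) l1 l3 l2 z q"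
proof -
  interpret s: labelling n "\<lambda>a b c. g a c b" l1 l3 l2 z by (rule swap23)
  show ?thesis
    by unfold_locales (use n_eq q_ge corner1 corner2 corner3 in auto)
qed

lemma row_ends:
  assumes "s \<le> q"
  shows "row n g s 0 = l1" "row n g s (n - s) = l2"
  using corner1[of "n - s" 0 s] corner2[of 0 "n - s" s] assms n_eq by (auto simp: row_def)

lemma gridcut_ge_of_row:
  assumes "s \<le> q" and row: "\<And>t. t \<le> n - s \<Longrightarrow> row n g s t \<in> {l1, l2}"
  shows "gridcut n g \<ge> 2 * real n"
proof -
  let ?h = "\<lambda>a b c. g a b (c + s)"
  have "s < n" using assms n_eq q_ge by auto
  have rows: "pathcut (row n g s') (n - s') \<ge> 1" if "s' < s" for s'
    using row_ends[of s'] that assms(1) distinct pathcut_ge[of "row n g s'" "n - s'"] by (simp add: cut_def)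
  have bottom: "?h a b 0 \<in> {l1, l2}" if "a + b = n - s" for a b
  proof -
    have "a = n - s - b" using that by simp
    then show ?thesis using row[of b] that by (simp add: row_def)
  qed
  have "labelling (n - s) ?h l1 l2 l3 z"
  proof
    show "distinct [l1, l2, l3, z]" by (rule distinct)
    fix a b c assume *: "a + b + c = n - s"
    then have n: "a + b + (c + s) = n" using \<open>s < n\<close> by simp
    show "?h a b c \<in> {l1, l2, l3, z}" using range[OF n] .
    show "a > 0" if "?h a b c = l1" using supp1[OF n that] .
    show "b > 0" if "?h a b c = l2" using supp2[OF n that] .
    \<comment> \<open>The shifted third coordinate can vanish while \<open>c + s\<close> is
      positive; there it is the two-label row that excludes \<open>l3\<close>.\<close>
    show "c > 0" if "?h a b c = l3"
      using bottom[of a b] that * distinct by (cases c) auto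
  qed
  then interpret h: labelling "n - s" ?h l1 l2 l3 z .
  have "n - s = Suc (Suc (n - s - 2))" using assms n_eq q_ge by auto
  from h.gridcut_ge_exits[OF this bottom] have "gridcut (n - s) ?h \<ge> 2 * real (n - s)"
    by (rule order_trans[rotated]) auto
  then show ?thesis
    using gridcut_shift[OF \<open>s < n\<close> rows] \<open>s < n\<close> by (simp add: of_nat_diff)
qed

lemma dircut_ge:
  assumes "\<And>s. s \<le> q \<Longrightarrow> \<exists>t\<le>n - s. row n g s t \<notin> {l1, l2}"
  shows "dircut n g \<ge> 2 * real (q + 1)"
proof -
  have 2: "pathcut (row n g s) (n - s) \<ge> 2" if s: "s \<le> q" for s
  proof -
    obtain t where "t \<le> n - s" "row n g s t \<notin> {l1, l2}" using assms[OF s] by auto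
    then show ?thesis
      using pathcut_ge2[of t "n - s" "row n g s"] row_ends[OF s] by (auto simp: cut_def)
  qed
  have "2 * real (q + 1) = (\<Sum>s\<le>q. 2)" by simp
  also have "\<dots> \<le> (\<Sum>s\<le>q. pathcut (row n g s) (n - s))"
    using 2 by (intro sum_mono) auto
  also have "\<dots> \<le> (\<Sum>s<n. pathcut (row n g s) (n - s))"
    using n_eq q_ge by (intro sum_mono2) auto
  finally show ?thesis
    using n_eq q_ge by (simp add: dircut_rows)
qed

end

context cornered begin

text \<open>If every row close to a side meets a third label, each such row is cut twice. Otherwise the Sperner
  bound applies above a row with only two labels, and every row below it is cut.\<close>

theorem gridcut_ge: "gridcut n g \<ge> 2 * real n"
proof -
  interpret s23: cornered n "\<lambda>a b c. g a c b" l1 l3 l2 z q by (rule cornered_swap23)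
  interpret s12: cornered n "\<lambda>a b c. g b a c" l2 l1 l3 z q by (rule cornered_swap12)
  interpret cy: cornered n "\<lambda>a b c. g c a b" l2 l3 l1 z q by (rule s12.cornered_swap23)
  have "gridcut n (\<lambda>a b c. g c a b) = gridcut n g"
    using gridcut_swap23[of n "\<lambda>a b c. g b a c"] gridcut_swap12[of n g] by simp
  note eqs = this gridcut_swap23[of n g]
  show ?thesis
  proof (cases "\<exists>s\<le>q. (\<forall>t\<le>n - s. row n g s t \<in> {l1, l2})
      \<or> (\<forall>t\<le>n - s. row n (\<lambda>a b c. g a c b) s t \<in> {l1, l3})
      \<or> (\<forall>t\<le>n - s. row n (\<lambda>a b c. g c a b) s t \<in> {l2, l3})")
    case True
    then show ?thesis
      using gridcut_ge_of_row s23.gridcut_ge_of_row cy.gridcut_ge_of_row eqs by metis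
  next
    case False
    then have "dircut n g \<ge> 2 * real (q + 1)" "dircut n (\<lambda>a b c. g a c b) \<ge> 2 * real (q + 1)"
      "dircut n (\<lambda>a b c. g c a b) \<ge> 2 * real (q + 1)"
      by (intro dircut_ge s23.dircut_ge cy.dircut_ge; blast)+
    then show ?thesis
      unfolding gridcut_eq_dircut using n_eq by simp
  qed
qed

text \<open>Follow a line of constant second coordinate towards the third corner. It ends inside
  that corner, hence in \<open>l3\<close>, so its last \<open>z\<close> is an exit; exits found on
  different lines differ in the second coordinate.\<close>

lemma lines_le_exits:
  assumes n: "n = Suc (Suc k)"
  shows "card {j. 1 \<le> j \<and> j < q \<and> (\<exists>a c. a + j + c = n \<and> g a j c = z)} \<le> card (exits k)"
proof (rule surj_card_le[where f = "\<lambda>(a, b, c). Suc b"])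
  show "{j. 1 \<le> j \<and> j < q \<and> (\<exists>a c. a + j + c = n \<and> g a j c = z)} \<subseteq> (\<lambda>(a, b, c). Suc b) ` exits k"
  proof
    fix j assume "j \<in> {j. 1 \<le> j \<and> j < q \<and> (\<exists>a c. a + j + c = n \<and> g a j c = z)}"
    then obtain a c where j: "1 \<le> j" "j < q" and ac: "a + j + c = n" "g a j c = z" by auto
    define T where "T = {c. c \<le> n - j \<and> g (n - j - c) j c = z}"
    have a: "a = n - j - c" using ac(1) by simp
    have "c \<in> T" using ac unfolding T_def a by auto
    have "finite T" by (rule finite_subset[of _ "{..n}"]) (auto simp: T_def)
    define t where "t = Max T"
    have t: "t \<in> T" using \<open>c \<in> T\<close> \<open>finite T\<close> by (auto simp: t_def intro: Max_in)
    have "Suc t \<notin> T" using Max_ge[OF \<open>finite T\<close>, of "Suc t"] by (auto simp: t_def)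
    have "n - j \<noteq> t"
    proof
      assume "n - j = t"
      moreover have "g 0 j (n - j) = l3" using corner3[of 0 j "n - j"] j n_eq by auto
      ultimately show False using t distinct by (auto simp: T_def)
    qed
    then have tlt: "t < n - j" using t by (auto simp: T_def)
    then have "g (n - j - Suc t) j (Suc t) \<noteq> z"
      using \<open>Suc t \<notin> T\<close> by (auto simp: T_def)
    moreover have "g (n - j - t) j t = z" using t by (auto simp: T_def)
    moreover have "Suc (n - j - Suc t) = n - j - t" using tlt by simp
    ultimately have "(n - j - Suc t, j - 1, t) \<in> exits k"
      using j tlt n by (simp add: exits_def)
    then show "j \<in> (\<lambda>(a, b, c). Suc b) ` exits k"
      using j by force
  qed
qed simp

lemma lines_le_exits':
  assumes n: "n = Suc (Suc k)"
  shows "card {i. 1 \<le> i \<and> i < q \<and> (\<exists>b c. i + b + c = n \<and> g i b c = z)} \<le> card (exits k)"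
proof -
  interpret s: cornered n "\<lambda>a b c. g b a c" l2 l1 l3 z q by (rule cornered_swap12)
  have "card (s.exits k) = card (exits k)"
    unfolding exits_def s.exits_def
    by (rule bij_betw_same_card[of "\<lambda>(a, b, c). (b, a, c)"],
        rule bij_betwI[of _ _ _ "\<lambda>(a, b, c). (b, a, c)"]) auto
  moreover have "{i. 1 \<le> i \<and> i < q \<and> (\<exists>b c. i + b + c = n \<and> g i b c = z)}
      = {i. 1 \<le> i \<and> i < q \<and> (\<exists>b c. b + i + c = n \<and> g i b c = z)}"
    by (auto simp: add.commute)
  ultimately show ?thesis
    using s.lines_le_exits[OF n] by simp
qed

end

text \<open>A pair to the left of \<open>t0\<close> is charged to its right end, a pair to the right
  of \<open>t0\<close> to its left end. No pair contains \<open>t0\<close>, so the charged positions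
  are distinct and interior.\<close>

lemma card_pairs_le:
  assumes "t0 \<le> m" "\<not> f t0"
  shows "card {t. t < m \<and> f t \<and> f (Suc t)} \<le> card {b. b < m - 1 \<and> f (Suc b)}"
proof (rule card_inj_on_le[where f = "\<lambda>t. if t < t0 then t else t - 1"])
  show "inj_on (\<lambda>t. if t < t0 then t else t - 1) {t. t < m \<and> f t \<and> f (Suc t)}"
  proof (rule inj_onI)
    fix x y
    assume "x \<in> {t. t < m \<and> f t \<and> f (Suc t)}" "y \<in> {t. t < m \<and> f t \<and> f (Suc t)}"
      and eq: "(if x < t0 then x else x - 1) = (if y < t0 then y else y - 1)"
    then have "x \<noteq> t0" "y \<noteq> t0" "Suc x \<noteq> t0" "Suc y \<noteq> t0"
      using assms(2) by auto
    with eq show "x = y" by (auto split: if_splits)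
  qed
  have "Suc x < m" if "x < t0" "f (Suc x)" for x
    using that assms by (cases "Suc x = t0") auto
  moreover have "Suc (x - Suc 0) = x" if "\<not> x < t0" "f x" for x
    using that assms by (cases x) auto
  moreover have "x - Suc 0 < m - Suc 0" if "\<not> x < t0" "f x" "x < m" for x
    using that assms by (cases x) auto
  ultimately show "(\<lambda>t. if t < t0 then t else t - 1) ` {t. t < m \<and> f t \<and> f (Suc t)} \<subseteq> {b. b < m - 1 \<and> f (Suc b)}"
    by (auto simp: less_diff_conv)
qed simp

text \<open>Since \<open>f\<close> fails at both ends, every pair can be charged to its left end,
  and the last position where \<open>f\<close> holds is the left end of no pair.\<close>

lemma card_pairs_less:
  assumes "\<not> f 0" "\<not> f m" "t \<le> m" "f t"
  shows "card {t. t < m \<and> f t \<and> f (Suc t)} < card {b. b < m - 1 \<and> f (Suc b)}"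
proof -
  define T where "T = {t. t \<le> m \<and> f t}"
  have "finite T" by (rule finite_subset[of _ "{..m}"]) (auto simp: T_def)
  define x where "x = Max T"
  have x: "x \<in> T" using assms \<open>finite T\<close> unfolding x_def by (intro Max_in) (auto simp: T_def)
  have "Suc x \<notin> T" using Max_ge[OF \<open>finite T\<close>, of "Suc x"] by (auto simp: x_def)
  have "x \<noteq> 0" "x \<noteq> m" using x assms by (metis T_def mem_Collect_eq)+
  then obtain y where y: "x = Suc y" "Suc y < m" using x by (cases x) (auto simp: T_def)
  let ?S = "{b. b < m - 1 \<and> f (Suc b)}"
  have "card {t. t < m \<and> f t \<and> f (Suc t)} \<le> card (?S - {y})"
  proof (rule card_inj_on_le[where f = "\<lambda>t. t - 1"])
    have pos: "t > 0" if "f t" for t using that assms by (cases t) auto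
    then show "inj_on (\<lambda>t. t - 1) {t. t < m \<and> f t \<and> f (Suc t)}"
      by (auto intro!: inj_onI) (metis Suc_pred)
    have "t - Suc 0 < m - Suc 0 \<and> f (Suc (t - Suc 0)) \<and> t - Suc 0 \<noteq> y"
      if "t < m" "f t" "f (Suc t)" for t
      using that pos[of t] y \<open>Suc x \<notin> T\<close> by (cases t) (auto simp: T_def)
    then show "(\<lambda>t. t - 1) ` {t. t < m \<and> f t \<and> f (Suc t)} \<subseteq> ?S - {y}"
      by auto
  qed simp
  also have "\<dots> < card ?S"
    using x y by (intro card_Diff1_less) (auto simp: T_def)
  finally show ?thesis .
qed

lemma card_filter_eq_sum: "finite A \<Longrightarrow> card {x \<in> A. P x} = (\<Sum>x\<in>A. if P x then 1 else 0)"
  by (subst sum.inter_filter[symmetric]) simp_all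

lemma card_tri_rows: "card {(a, b, c) \<in> tri k. P a b c} = (\<Sum>s\<le>k. card {t. t \<le> k - s \<and> P (k - s - t) t s})"
proof -
  have "card {(a, b, c) \<in> tri k. P a b c} = card {x \<in> tri k. case x of (a, b, c) \<Rightarrow> P a b c}"
    by (rule arg_cong[where f = card]) auto
  also have "\<dots> = (\<Sum>(a, b, c)\<in>tri k. if P a b c then 1 else 0)"
    by (simp add: card_filter_eq_sum case_prod_unfold)
  also have "\<dots> = (\<Sum>s\<le>k. \<Sum>t\<le>k - s. if P (k - s - t) t s then 1 else 0)"
    by (rule sum_tri_rows)
  also have "\<dots> = (\<Sum>s\<le>k. card {t. t \<le> k - s \<and> P (k - s - t) t s})"
    by (simp add: card_filter_eq_sum[symmetric])
  finally show ?thesis .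
qed

context cornered begin

text \<open>A non-exit \<open>z\<close> in row \<open>s\<close> lies below an edge of row \<open>s + 1\<close> with both ends labelled \<open>z\<close>. A row with
  \<open>v\<close> interior occurrences of \<open>z\<close> has at most \<open>v\<close> such edges unless it is full, and fewer than \<open>v\<close> if
  \<open>z\<close> avoids its ends; summing over the rows, everything telescopes.\<close>

lemma rows_le_exits:
  assumes n: "n = Suc (Suc k)"
    and not_full: "\<And>s. s < n \<Longrightarrow> \<exists>t\<le>n - s. row n g s t \<noteq> z"
    and bottom: "\<And>a b. a + b = n \<Longrightarrow> g a b 0 \<in> {l1, l2}"
  shows "card {s. s < q \<and> (\<exists>t\<le>n - s. row n g s t = z)} \<le> card (exits k)"
proof -
  define V where "V s = card {b. b < n - s - 1 \<and> row n g s (Suc b) = z}" for s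
  define e where "e s = card {t. t < n - s \<and> row n g s t = z \<and> row n g s (Suc t) = z}" for s
  define X where "X s = card {b. b \<le> k - s \<and> row n g s (Suc b) = z
      \<and> \<not> (row n g (Suc s) b = z \<and> row n g (Suc s) (Suc b) = z)}" for s
  have exits: "card (exits k) = (\<Sum>s\<le>k. X s)"
    unfolding exits_def card_tri_rows X_def
  proof (intro sum.cong refl arg_cong[where f = card] Collect_cong conj_cong)
    fix s t assume "s \<in> {..k}" "t \<le> k - s"
    then have "n - s - Suc t = Suc (k - s - t)" "n - Suc s - t = Suc (k - s - t)" "n - Suc s - Suc t = k - s - t"
      using n by auto
    then show "(g (Suc (k - s - t)) (Suc t) s = z) = (row n g s (Suc t) = z)"
      "(\<not> (g (Suc (k - s - t)) t (Suc s) = z \<and> g (k - s - t) (Suc t) (Suc s) = z))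
        = (\<not> (row n g (Suc s) t = z \<and> row n g (Suc s) (Suc t) = z))"
      by (simp_all add: row_def)
  qed
  have step: "V s \<le> X s + e (Suc s)" if "s \<le> k" for s
  proof -
    have "{b. b < n - s - 1 \<and> row n g s (Suc b) = z}
        \<subseteq> {b. b \<le> k - s \<and> row n g s (Suc b) = z \<and> \<not> (row n g (Suc s) b = z \<and> row n g (Suc s) (Suc b) = z)}
          \<union> {t. t < n - Suc s \<and> row n g (Suc s) t = z \<and> row n g (Suc s) (Suc t) = z}"
      using that n by auto
    then have "V s \<le> card ({b. b \<le> k - s \<and> row n g s (Suc b) = z \<and> \<not> (row n g (Suc s) b = z \<and> row n g (Suc s) (Suc b) = z)}
          \<union> {t. t < n - Suc s \<and> row n g (Suc s) t = z \<and> row n g (Suc s) (Suc t) = z})"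
      unfolding V_def by (intro card_mono) auto
    also have "\<dots> \<le> X s + e (Suc s)"
      unfolding X_def e_def by (rule card_Un_le)
    finally show ?thesis .
  qed
  \<comment> \<open>The telescoping stops here: row \<open>n - 1\<close> lies inside the third
    corner.\<close>
  have e0: "e (Suc k) = 0"
    using corner3[of 1 0 "n - 1"] corner3[of 0 1 "n - 1"] n n_eq q_ge distinct
    by (auto simp: e_def row_def)
  have "(\<Sum>s\<le>k. e (Suc s)) \<le> (\<Sum>s\<le>k. e s)"
  proof -
    have "(\<Sum>s\<le>k. e (Suc s)) = (\<Sum>s<Suc k. e (Suc s))" by (simp add: lessThan_Suc_atMost)
    also have "\<dots> \<le> (\<Sum>s<Suc (Suc k). e s)" by (subst (2) sum.lessThan_Suc_shift) simp
    finally show ?thesis using e0 by (simp add: lessThan_Suc_atMost)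
  qed
  moreover have "(\<Sum>s\<le>k. V s) \<le> (\<Sum>s\<le>k. X s) + (\<Sum>s\<le>k. e (Suc s))"
    unfolding sum.distrib[symmetric] using step by (intro sum_mono) auto
  moreover have "(\<Sum>s\<le>k. e s + (if s < q \<and> (\<exists>t\<le>n - s. row n g s t = z) then 1 else 0)) \<le> (\<Sum>s\<le>k. V s)"
  proof (intro sum_mono)
    fix s assume "s \<in> {..k}"
    then have "s < n" using n by simp
    show "e s + (if s < q \<and> (\<exists>t\<le>n - s. row n g s t = z) then 1 else 0) \<le> V s"
    proof (cases "s < q \<and> (\<exists>t\<le>n - s. row n g s t = z)")
      case True
      then obtain t where "t \<le> n - s" "row n g s t = z" by auto
      then have "e s < V s"
        unfolding e_def V_def using True row_ends[of s] distinct
        by (intro card_pairs_less[of "\<lambda>t. row n g s t = z" "n - s" t]) auto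
      then show ?thesis using True by simp
    next
      case False
      then show ?thesis
        using not_full[OF \<open>s < n\<close>] card_pairs_le[of _ "n - s" "\<lambda>t. row n g s t = z"]
        unfolding e_def V_def by auto
    qed
  qed
  moreover have "(\<Sum>s\<le>k. if s < q \<and> (\<exists>t\<le>n - s. row n g s t = z) then 1 else 0)
      = card {s. s < q \<and> (\<exists>t\<le>n - s. row n g s t = z)}"
  proof -
    have "{s \<in> {..k}. s < q \<and> (\<exists>t\<le>n - s. row n g s t = z)} = {s. s < q \<and> (\<exists>t\<le>n - s. row n g s t = z)}"
      using n n_eq q_ge by auto
    then show ?thesis
      using card_filter_eq_sum[of "{..k}" "\<lambda>s. s < q \<and> (\<exists>t\<le>n - s. row n g s t = z)"] by simp
  qed
  ultimately show ?thesis
    using exits by (simp add: sum.distrib)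
qed

end

subsection \<open>The two-dimensional instance\<close>

text \<open>The path of length \<open>q + 1\<close> from a terminal (first coordinate \<open>3 q\<close>) along the side on which
  the second coordinate vanishes, then along the line where the third coordinate is \<open>s\<close>. For \<open>t \<le> s\<close>
  the truncated subtraction gives \<open>t - s = 0\<close>.\<close>

definition spoke :: "nat \<Rightarrow> (nat \<Rightarrow> nat \<Rightarrow> nat \<Rightarrow> nat) \<Rightarrow> nat \<Rightarrow> nat \<Rightarrow> nat" where
  "spoke q h s t = h (3 * q - t) (t - s) (min t s)"

definition spokecut :: "nat \<Rightarrow> (nat \<Rightarrow> nat \<Rightarrow> nat \<Rightarrow> nat) \<Rightarrow> nat \<Rightarrow> real" where
  "spokecut q h s = pathcut (spoke q h s) (Suc q)"

text \<open>The two-dimensional instance: all edges of the grid outside the corners \<open>x\<^sub>i \<ge> 2 q\<close>, where an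
  edge leaving a corner is prolonged to a spoke starting at the terminal.\<close>

definition facecut_tri :: "nat \<Rightarrow> (nat \<Rightarrow> nat \<Rightarrow> nat \<Rightarrow> nat) \<Rightarrow> nat \<Rightarrow> nat \<Rightarrow> nat \<Rightarrow> real" where
  "facecut_tri q g a b c =
    (if 2 * q \<le> a \<or> 2 * q \<le> b \<or> 2 * q \<le> c then 0
     else if Suc a = 2 * q then spokecut q (\<lambda>u v w. g u v w) c + spokecut q (\<lambda>u v w. g u w v) b
       + cut (g a (Suc b) c) (g a b (Suc c))
     else if Suc b = 2 * q then spokecut q (\<lambda>u v w. g v u w) c + spokecut q (\<lambda>u v w. g w u v) a
       + cut (g (Suc a) b c) (g a b (Suc c))
     else if Suc c = 2 * q then spokecut q (\<lambda>u v w. g v w u) b + spokecut q (\<lambda>u v w. g w v u) a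
       + cut (g (Suc a) b c) (g a (Suc b) c)
     else tricut g a b c)"

definition facecut :: "nat \<Rightarrow> (nat \<Rightarrow> nat \<Rightarrow> nat \<Rightarrow> nat) \<Rightarrow> real" where
  "facecut q g = (\<Sum>(a, b, c)\<in>tri (3 * q - 1). facecut_tri q g a b c)"

lemma facecut_swap12:
  assumes "q \<ge> 2"
  shows "facecut q (\<lambda>a b c. g b a c) = facecut q g"
  unfolding facecut_def
proof (rule sum.reindex_bij_witness[of _ "\<lambda>(a, b, c). (b, a, c)" "\<lambda>(a, b, c). (b, a, c)"])
  show "(case case x of (a, b, c) \<Rightarrow> (b, a, c) of (a, b, c) \<Rightarrow> facecut_tri q g a b c)
      = (case x of (a, b, c) \<Rightarrow> facecut_tri q (\<lambda>a b c. g b a c) a b c)" if "x \<in> tri (3 * q - 1)" for x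
  proof (cases x)
    case (fields a b c)
    have "a + b + c = 3 * q - 1" using that fields by simp
    then have "\<not> (Suc a = 2 * q \<and> Suc b = 2 * q)" using assms by auto
    then show ?thesis using fields by (auto simp: facecut_tri_def tricut_def cut_commute)
  qed
qed auto

lemma facecut_swap23:
  assumes "q \<ge> 2"
  shows "facecut q (\<lambda>a b c. g a c b) = facecut q g"
  unfolding facecut_def
proof (rule sum.reindex_bij_witness[of _ "\<lambda>(a, b, c). (a, c, b)" "\<lambda>(a, b, c). (a, c, b)"])
  show "(case case x of (a, b, c) \<Rightarrow> (a, c, b) of (a, b, c) \<Rightarrow> facecut_tri q g a b c)
      = (case x of (a, b, c) \<Rightarrow> facecut_tri q (\<lambda>a b c. g a c b) a b c)" if "x \<in> tri (3 * q - 1)" for x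
  proof (cases x)
    case (fields a b c)
    have "a + b + c = 3 * q - 1" using that fields by simp
    then have "\<not> (Suc c = 2 * q \<and> Suc b = 2 * q)" using assms by auto
    then show ?thesis using fields by (auto simp: facecut_tri_def tricut_def cut_commute)
  qed
qed auto

text \<open>What a spoke costs beyond its last edge when the whole corner is relabelled by
  \<open>l\<close>.\<close>

definition slack :: "nat \<Rightarrow> nat \<Rightarrow> (nat \<Rightarrow> nat \<Rightarrow> nat \<Rightarrow> nat) \<Rightarrow> nat \<Rightarrow> real" where
  "slack q l h s = spokecut q h s - cut l (spoke q h s (Suc q))"

lemma slack_nonneg: "h (3 * q) 0 0 = l \<Longrightarrow> slack q l h s \<ge> 0"
  using pathcut_ge[of "spoke q h s" "Suc q"] by (simp add: slack_def spokecut_def spoke_def)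

lemma slack_ge_1:
  assumes "h (3 * q) 0 0 = l" "u + v + s = 3 * q" "2 * q \<le> u" "h u v s \<noteq> l"
    and "spoke q h s (Suc q) \<noteq> h u v s"
  shows "slack q l h s \<ge> 1"
proof -
  have "spoke q h s (3 * q - u) = h u v s"
    using assms(2,3) by (auto simp: spoke_def intro!: arg_cong2[where f = "h u"])
  moreover have "3 * q - u \<le> Suc q" using assms(3) by simp
  ultimately show ?thesis
    using pathcut_ge2[of "3 * q - u" "Suc q" "spoke q h s"] assms
    by (simp add: slack_def spokecut_def spoke_def cut_def)
qed

text \<open>The spoke meets \<open>l\<close>, another label, and \<open>l\<close> again before it leaves the corner triangle.\<close>

lemma slack_ge_2:
  assumes "h (3 * q) 0 0 = l" "u + v + s = 3 * q" "3 * q - m \<le> u" "h u v s \<noteq> l"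
    and "m \<le> q" "\<And>s. s \<le> m \<Longrightarrow> h (3 * q - m) (m - s) s = l"
  shows "slack q l h s \<ge> 2"
proof -
  have "spoke q h s (3 * q - u) = h u v s"
    using assms(2,3,5) by (auto simp: spoke_def intro!: arg_cong2[where f = "h u"])
  moreover have "s \<le> m" using assms(2,3) by simp
  then have "spoke q h s m = l"
    using assms(6)[of s] by (simp add: spoke_def min_absorb2)
  moreover have "3 * q - u \<le> m" using assms(3) by simp
  ultimately show ?thesis
    using pathcut_ge3[of "3 * q - u" m "Suc q" "spoke q h s"] assms
    by (simp add: slack_def spokecut_def spoke_def cut_def)
qed

lemma card_slack_ge:
  assumes "h (3 * q) 0 0 = l" "\<And>s. s \<in> X \<Longrightarrow> s \<le> q \<and> slack q l h s \<ge> d" "d \<ge> 0"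
  shows "d * real (card X) \<le> (\<Sum>s\<le>q. slack q l h s)"
proof -
  have "finite X" using assms(2) by (meson finite_nat_set_iff_bounded_le)
  have "d * real (card X) = (\<Sum>s\<in>X. d)" by simp
  also have "\<dots> \<le> (\<Sum>s\<in>X. slack q l h s)" using assms(2) by (intro sum_mono) auto
  also have "\<dots> \<le> (\<Sum>s\<le>q. slack q l h s)"
    using assms slack_nonneg by (intro sum_mono2) auto
  finally show ?thesis .
qed

section \<open>Comparing a face with its filled corners\<close>

locale face = labelling +
  fixes q :: nat
  assumes n_eq: "n = 3 * q" and q_ge: "q \<ge> 2"
    and term1: "g n 0 0 = l1" and term2: "g 0 n 0 = l2" and term3: "g 0 0 n = l3"
begin

lemma face_swap12: "face n (\<lambda>a b c. g b a c) l2 l1 l3 z q"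
proof -
  interpret s: labelling n "\<lambda>a b c. g b a c" l2 l1 l3 z by (rule swap12)
  show ?thesis by unfold_locales (use n_eq q_ge term1 term2 term3 in auto)
qed

lemma face_swap23: "face n (\<lambda>a b c. g a c b) l1 l3 l2 z q"
proof -
  interpret s: labelling n "\<lambda>a b c. g a c b" l1 l3 l2 z by (rule swap23)
  show ?thesis by unfold_locales (use n_eq q_ge term1 term2 term3 in auto)
qed

definition fill :: "nat \<Rightarrow> nat \<Rightarrow> nat \<Rightarrow> nat" where
  "fill a b c = (if 2 * q \<le> a then l1 else if 2 * q \<le> b then l2 else if 2 * q \<le> c then l3 else g a b c)"

lemma cornered_fill: "cornered n fill l1 l2 l3 z q"
proof
  show "distinct [l1, l2, l3, z]" by (rule distinct)
  fix a b c assume *: "a + b + c = n"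
  show "fill a b c \<in> {l1, l2, l3, z}" using range[OF *] by (simp add: fill_def)
  show "a > 0" if "fill a b c = l1"
    using that supp1[OF *] distinct q_ge by (auto simp: fill_def split: if_splits)
  show "b > 0" if "fill a b c = l2"
    using that supp2[OF *] distinct q_ge by (auto simp: fill_def split: if_splits)
  show "c > 0" if "fill a b c = l3"
    using that supp3[OF *] distinct q_ge by (auto simp: fill_def split: if_splits)
  show "fill a b c = l1" if "2 * q \<le> a" using that by (simp add: fill_def)
  show "fill a b c = l2" if "2 * q \<le> b" using that * n_eq q_ge by (auto simp: fill_def)
  show "fill a b c = l3" if "2 * q \<le> c" using that * n_eq q_ge by (auto simp: fill_def)
qed (use n_eq q_ge in auto)

abbreviation "S12 \<equiv> \<Sum>s\<le>q. slack q l1 (\<lambda>u v w. g u v w) s"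
abbreviation "S13 \<equiv> \<Sum>s\<le>q. slack q l1 (\<lambda>u v w. g u w v) s"
abbreviation "S21 \<equiv> \<Sum>s\<le>q. slack q l2 (\<lambda>u v w. g v u w) s"
abbreviation "S23 \<equiv> \<Sum>s\<le>q. slack q l2 (\<lambda>u v w. g w u v) s"
abbreviation "S31 \<equiv> \<Sum>s\<le>q. slack q l3 (\<lambda>u v w. g v w u) s"
abbreviation "S32 \<equiv> \<Sum>s\<le>q. slack q l3 (\<lambda>u v w. g w v u) s"

lemma slack_sums_nonneg: "S12 \<ge> 0" "S13 \<ge> 0" "S21 \<ge> 0" "S23 \<ge> 0" "S31 \<ge> 0" "S32 \<ge> 0"
  using term1 term2 term3 n_eq by (auto intro!: sum_nonneg slack_nonneg)

lemma spoke_end: "spoke q h s (Suc q) = h (2 * q - 1) (Suc q - s) s" if "s \<le> q"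
  using that q_ge by (simp add: spoke_def min_def)

lemma facecut_tri_eq:
  assumes "a + b + c = 3 * q - 1"
  shows "facecut_tri q g a b c = tricut fill a b c
    + (if Suc a = 2 * q then slack q l1 (\<lambda>u v w. g u v w) c + slack q l1 (\<lambda>u v w. g u w v) b else 0)
    + (if Suc b = 2 * q then slack q l2 (\<lambda>u v w. g v u w) c + slack q l2 (\<lambda>u v w. g w u v) a else 0)
    + (if Suc c = 2 * q then slack q l3 (\<lambda>u v w. g v w u) b + slack q l3 (\<lambda>u v w. g w v u) a else 0)"
proof -
  consider "2 * q \<le> a" | "2 * q \<le> b" | "2 * q \<le> c" | "Suc a = 2 * q" | "Suc b = 2 * q" | "Suc c = 2 * q"
    | "Suc a < 2 * q" "Suc b < 2 * q" "Suc c < 2 * q" by linarith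
  then show ?thesis
  proof cases
    case 1
    then show ?thesis using assms q_ge by (auto simp: facecut_tri_def tricut_def fill_def)
  next
    case 2
    then show ?thesis using assms q_ge by (auto simp: facecut_tri_def tricut_def fill_def)
  next
    case 3
    then show ?thesis using assms q_ge by (auto simp: facecut_tri_def tricut_def fill_def)
  next
    case 4
    then have *: "b \<le> q" "c \<le> q" "2 * q - Suc 0 = a" "Suc q - c = Suc b" "Suc q - b = Suc c"
      using assms by auto
    have "\<not> 2 * q \<le> Suc b" "\<not> 2 * q \<le> Suc c" "\<not> 2 * q \<le> b" "\<not> 2 * q \<le> c" "\<not> 2 * q \<le> a"
      "Suc b \<noteq> 2 * q" "Suc c \<noteq> 2 * q" using * q_ge by auto
    then show ?thesis
      using 4 * by (simp add: facecut_tri_def tricut_def fill_def slack_def spoke_end cut_commute)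
  next
    case 5
    then have *: "a \<le> q" "c \<le> q" "2 * q - Suc 0 = b" "Suc q - c = Suc a" "Suc q - a = Suc c"
      using assms by auto
    have "\<not> 2 * q \<le> Suc a" "\<not> 2 * q \<le> Suc c" "\<not> 2 * q \<le> b" "\<not> 2 * q \<le> c" "\<not> 2 * q \<le> a"
      "Suc a \<noteq> 2 * q" "Suc c \<noteq> 2 * q" using * q_ge by auto
    then show ?thesis
      using 5 * by (simp add: facecut_tri_def tricut_def fill_def slack_def spoke_end cut_commute)
  next
    case 6
    then have *: "a \<le> q" "b \<le> q" "2 * q - Suc 0 = c" "Suc q - b = Suc a" "Suc q - a = Suc b"
      using assms by auto
    have "\<not> 2 * q \<le> Suc a" "\<not> 2 * q \<le> Suc b" "\<not> 2 * q \<le> b" "\<not> 2 * q \<le> c" "\<not> 2 * q \<le> a"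
      "Suc a \<noteq> 2 * q" "Suc b \<noteq> 2 * q" using * q_ge by auto
    then show ?thesis
      using 6 * by (simp add: facecut_tri_def tricut_def fill_def slack_def spoke_end cut_commute)
  next
    case 7
    then show ?thesis by (auto simp: facecut_tri_def tricut_def fill_def)
  qed
qed

lemma sum_tri_corner:
  "(\<Sum>(a, b, c)\<in>tri (3 * q - 1). if Suc a = 2 * q then F c + G b else 0) = (\<Sum>s\<le>q. F s) + (\<Sum>s\<le>q. G s)"
  for F G :: "nat \<Rightarrow> real"
proof -
  have "(\<Sum>(a, b, c)\<in>tri (3 * q - 1). if Suc a = 2 * q then F c + G b else 0)
      = (\<Sum>(a, b, c)\<in>{x \<in> tri (3 * q - 1). Suc (fst x) = 2 * q}. F c + G b)"
    by (rule sum.mono_neutral_cong_right) (auto split: if_splits)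
  also have "\<dots> = (\<Sum>s\<le>q. F s + G (q - s))"
    by (rule sum.reindex_bij_witness[of _ "\<lambda>s. (2 * q - 1, q - s, s)" "\<lambda>(a, b, c). c"])
       (use q_ge in \<open>auto intro!: arg_cong[where f = G]\<close>)
  also have "\<dots> = (\<Sum>s\<le>q. F s) + (\<Sum>s\<le>q. G (q - s))"
    by (rule sum.distrib)
  also have "(\<Sum>s\<le>q. G (q - s)) = (\<Sum>s\<le>q. G s)"
    by (rule sum.reindex_bij_witness[of _ "\<lambda>s. q - s" "\<lambda>s. q - s"]) auto
  finally show ?thesis .
qed

text \<open>Relabelling the corners removes the cut edges inside them and leaves of every spoke only
  its last edge, the one that leaves the corner. The slacks record exactly this difference.\<close>

lemma facecut_eq: "facecut q g = gridcut n fill + (S12 + S13 + S21 + S23 + S31 + S32)"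
proof -
  have 2: "(\<Sum>(a, b, c)\<in>tri (3 * q - 1). if Suc b = 2 * q then F c + G a else 0) = (\<Sum>s\<le>q. F s) + (\<Sum>s\<le>q. G s)"
    for F G :: "nat \<Rightarrow> real"
    unfolding sum_tri_corner[symmetric]
    by (rule sum.reindex_bij_witness[of _ "\<lambda>(a, b, c). (b, a, c)" "\<lambda>(a, b, c). (b, a, c)"]) auto
  have 3: "(\<Sum>(a, b, c)\<in>tri (3 * q - 1). if Suc c = 2 * q then F b + G a else 0) = (\<Sum>s\<le>q. F s) + (\<Sum>s\<le>q. G s)"
    for F G :: "nat \<Rightarrow> real"
    unfolding sum_tri_corner[symmetric]
    by (rule sum.reindex_bij_witness[of _ "\<lambda>(c, a, b). (a, b, c)" "\<lambda>(a, b, c). (c, a, b)"]) auto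
  have "facecut q g = (\<Sum>(a, b, c)\<in>tri (3 * q - 1). tricut fill a b c
    + (if Suc a = 2 * q then slack q l1 (\<lambda>u v w. g u v w) c + slack q l1 (\<lambda>u v w. g u w v) b else 0)
    + (if Suc b = 2 * q then slack q l2 (\<lambda>u v w. g v u w) c + slack q l2 (\<lambda>u v w. g w u v) a else 0)
    + (if Suc c = 2 * q then slack q l3 (\<lambda>u v w. g v w u) b + slack q l3 (\<lambda>u v w. g w v u) a else 0))"
    unfolding facecut_def by (intro sum.cong refl) (auto simp: facecut_tri_eq)
  also have "\<dots> = gridcut n fill + (S12 + S13 + S21 + S23 + S31 + S32)"
    unfolding gridcut_def n_eq using sum_tri_corner 2 3
    by (simp add: case_prod_unfold sum.distrib)
  finally show ?thesis .
qed

lemma facecut_ge: "facecut q g \<ge> 2 * real n + (S12 + S13 + S21 + S23 + S31 + S32)"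
proof -
  interpret f: cornered n fill l1 l2 l3 z q by (rule cornered_fill)
  show ?thesis using f.gridcut_ge by (simp add: facecut_eq)
qed

end

subsection \<open>Corner triangles\<close>

definition zcount :: "nat \<Rightarrow> (nat \<Rightarrow> nat \<Rightarrow> nat \<Rightarrow> nat) \<Rightarrow> nat \<Rightarrow> nat" where
  "zcount n g z = card {(a, b, c) \<in> tri (n - 1). mono3 g {z} a b c}"

lemma zcount_swap12: "zcount n (\<lambda>a b c. g b a c) z = zcount n g z"
  unfolding zcount_def
  by (rule bij_betw_same_card[of "\<lambda>(a, b, c). (b, a, c)"],
      rule bij_betwI[of _ _ _ "\<lambda>(a, b, c). (b, a, c)"]) (auto simp: mono3_def)

lemma zcount_swap23: "zcount n (\<lambda>a b c. g a c b) z = zcount n g z"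
  unfolding zcount_def
  by (rule bij_betw_same_card[of "\<lambda>(a, b, c). (a, c, b)"],
      rule bij_betwI[of _ _ _ "\<lambda>(a, b, c). (a, c, b)"]) (auto simp: mono3_def)

definition cornercut :: "nat \<Rightarrow> nat \<Rightarrow> (nat \<Rightarrow> nat \<Rightarrow> nat \<Rightarrow> nat) \<Rightarrow> real" where
  "cornercut n m h = pathcut (\<lambda>t. h (n - t) t 0) m + pathcut (\<lambda>t. h (n - t) 0 t) m
     + pathcut (\<lambda>t. h (n - m) (m - t) t) m"

lemma cornercut_nonneg: "cornercut n m h \<ge> 0"
  by (simp add: cornercut_def)

text \<open>The boundary of the corner triangle is a closed path through the terminal and through a
  point with another label, so it is cut at least twice.\<close>

lemma cornercut_ge_2:
  assumes "s \<le> m" "h (n - m) (m - s) s \<noteq> h n 0 0"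
  shows "cornercut n m h \<ge> 2"
proof -
  let ?l = "h n 0 0" and ?p = "h (n - m) (m - s) s"
  have "cut ?l ?p = 1" "cut ?p ?l = 1" using assms(2) by (simp_all add: cut_def)
  then show ?thesis
    using pathcut_ge2[OF assms(1), of "\<lambda>t. h (n - m) (m - t) t"] cut_commute[of ?l "h (n - m) 0 m"]
      pathcut_ge[of "\<lambda>t. h (n - t) t 0" m] pathcut_ge[of "\<lambda>t. h (n - t) 0 t" m]
      cut_triangle[of ?l ?p "h (n - m) m 0"] cut_triangle[of ?p ?l "h (n - m) 0 m"]
    by (simp add: cornercut_def)
qed

text \<open>If \<open>cornercut\<close> is at least 2, its term suffices alone. Otherwise the base
  carries only \<open>l\<close>, so a spoke through a triangle with all labels \<open>z\<close>
  leaves \<open>l\<close> and returns to it above the base, which gives slack 2. Such a spoke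
  accounts for at most \<open>m\<close> of the \<open>m * (m + 1) / 2\<close> upward triangles of
  the corner triangle.\<close>

lemma corner_balance:
  assumes h: "h (3 * q) 0 0 = l" and "l \<noteq> z" "1 \<le> m" "m \<le> q"
  shows "real (card {(a, b, c) \<in> tri (3 * q - 1). 3 * q - m \<le> a \<and> \<not> mono3 h {z} a b c})
      + real m / 2 * (\<Sum>s\<le>q. slack q l h s) + real (m * (m + 1)) / 4 * cornercut (3 * q) m h
      \<ge> real (m * (m + 1)) / 2"
proof (cases "cornercut (3 * q) m h \<ge> 2")
  case True
  have "real m / 2 * (\<Sum>s\<le>q. slack q l h s) \<ge> 0"
    by (intro mult_nonneg_nonneg sum_nonneg slack_nonneg h) auto
  moreover have "real (m * (m + 1)) / 4 * cornercut (3 * q) m h \<ge> real (m * (m + 1)) / 4 * 2"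
    using True by (intro mult_left_mono) auto
  ultimately show ?thesis
    using of_nat_0_le_iff[of "card {(a, b, c) \<in> tri (3 * q - 1). 3 * q - m \<le> a \<and> \<not> mono3 h {z} a b c}"]
    by linarith
next
  case False
  let ?T = "{(a, b, c) \<in> tri (3 * q - 1). 3 * q - m \<le> a}"
  let ?Z = "{(a, b, c) \<in> tri (3 * q - 1). 3 * q - m \<le> a \<and> mono3 h {z} a b c}"
  let ?N = "{(a, b, c) \<in> tri (3 * q - 1). 3 * q - m \<le> a \<and> \<not> mono3 h {z} a b c}"
  have fin: "finite ?T" "finite ?Z" "finite ?N"
    by (rule finite_subset[OF _ finite_tri[of "3 * q - 1"]]; auto)+
  define X where "X = {s. s \<le> q \<and> slack q l h s \<ge> 2}"
  have base: "h (3 * q - m) (m - s) s = l" if "s \<le> m" for s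
    using cornercut_ge_2[of s m h "3 * q"] that False h by auto
  have "card ?Z \<le> card (X \<times> {..<m})"
  proof (rule card_inj_on_le[where f = "\<lambda>(a, b, c). (c, a - (3 * q - m))"])
    show "inj_on (\<lambda>(a, b, c). (c, a - (3 * q - m))) ?Z" by (auto simp: inj_on_def)
    have "c \<in> X \<and> a - (3 * q - m) < m" if "a + b + c = 3 * q - 1" "3 * q - m \<le> a" "mono3 h {z} a b c" for a b c
    proof -
      have "slack q l h c \<ge> 2"
        using slack_ge_2[of h q l "Suc a" b c m] that assms base by (auto simp: mono3_def)
      then show ?thesis using that assms by (auto simp: X_def)
    qed
    then show "(\<lambda>(a, b, c). (c, a - (3 * q - m))) ` ?Z \<subseteq> X \<times> {..<m}" by auto
  qed (auto simp: X_def)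
  then have "card ?Z \<le> card X * m" by (simp add: card_cartesian_product)
  then have "real (card ?Z) \<le> real (card X * m)" by (simp only: of_nat_le_iff)
  moreover have "2 * real (card X) \<le> (\<Sum>s\<le>q. slack q l h s)"
    by (rule card_slack_ge) (use h in \<open>auto simp: X_def\<close>)
  ultimately have Z: "real (card ?Z) \<le> real m / 2 * (\<Sum>s\<le>q. slack q l h s)"
    using mult_right_mono[of "2 * real (card X)" "\<Sum>s\<le>q. slack q l h s" "real m"]
    by (simp add: mult.commute)
  have "card ?T = card (tri (m - 1))"
    by (rule bij_betw_same_card[of "\<lambda>(a, b, c). (a - (3 * q - m), b, c)"],
        rule bij_betwI[of _ _ _ "\<lambda>(a, b, c). (a + (3 * q - m), b, c)"]) (use assms in auto)
  then have T: "2 * card ?T = m * (m + 1)"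
    using card_tri[of "m - 1"] assms by (simp add: algebra_simps)
  have "card ?T = card ?Z + card ?N"
    by (subst card_Un_disjoint[symmetric]) (use fin in \<open>auto intro!: arg_cong[where f = card]\<close>)
  then have "real (m * (m + 1)) / 2 = real (card ?Z) + real (card ?N)"
    unfolding T[symmetric] by simp
  moreover have "real (m * (m + 1)) / 4 * cornercut (3 * q) m h \<ge> 0"
    using cornercut_nonneg by simp
  ultimately show ?thesis using Z by linarith
qed

context face begin

text \<open>The corner triangles at the three terminals are disjoint because
  \<open>m \<le> q\<close>, so \<open>corner_balance\<close> can be summed over them, with one
  family of spokes for each corner.\<close>

theorem face_balance:
  assumes m: "1 \<le> m" "m \<le> q"
  shows "real (card (tri (n - 1))) - real (zcount n g z) + real m / 2 * (facecut q g - 2 * real n)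
     + real (m * (m + 1)) / 4 * (cornercut n m (\<lambda>u v w. g u v w) + cornercut n m (\<lambda>u v w. g v u w)
        + cornercut n m (\<lambda>u v w. g v w u)) \<ge> 3 * (real (m * (m + 1)) / 2)"
proof -
  let ?A1 = "{(a, b, c) \<in> tri (n - 1). n - m \<le> a \<and> \<not> mono3 g {z} a b c}"
  let ?A2 = "{(a, b, c) \<in> tri (n - 1). n - m \<le> b \<and> \<not> mono3 g {z} a b c}"
  let ?A3 = "{(a, b, c) \<in> tri (n - 1). n - m \<le> c \<and> \<not> mono3 g {z} a b c}"
  let ?Z = "{(a, b, c) \<in> tri (n - 1). mono3 g {z} a b c}"
  have fin: "finite ?A1" "finite ?A2" "finite ?A3" "finite ?Z"
    by (rule finite_subset[OF _ finite_tri[of "n - 1"]]; auto)+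
  have ne: "l1 \<noteq> z" "l2 \<noteq> z" "l3 \<noteq> z" using distinct by auto
  have c2: "card {(a, b, c) \<in> tri (3 * q - 1). 3 * q - m \<le> a \<and> \<not> mono3 (\<lambda>u v w. g v u w) {z} a b c} = card ?A2"
    unfolding n_eq
    by (rule bij_betw_same_card[of "\<lambda>(a, b, c). (b, a, c)"],
        rule bij_betwI[of _ _ _ "\<lambda>(a, b, c). (b, a, c)"]) (auto simp: mono3_def)
  have c3: "card {(a, b, c) \<in> tri (3 * q - 1). 3 * q - m \<le> a \<and> \<not> mono3 (\<lambda>u v w. g v w u) {z} a b c} = card ?A3"
    unfolding n_eq
    by (rule bij_betw_same_card[of "\<lambda>(a, b, c). (b, c, a)"],
        rule bij_betwI[of _ _ _ "\<lambda>(a, b, c). (c, a, b)"]) (auto simp: mono3_def)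
  have "card ?A1 + card ?A2 + card ?A3 + card ?Z = card (?A1 \<union> ?A2 \<union> ?A3 \<union> ?Z)"
  proof -
    have "?A1 \<inter> ?A2 = {}" "(?A1 \<union> ?A2) \<inter> ?A3 = {}" "(?A1 \<union> ?A2 \<union> ?A3) \<inter> ?Z = {}"
      using m n_eq q_ge by auto
    then show ?thesis using fin by (simp add: card_Un_disjoint)
  qed
  also have "\<dots> \<le> card (tri (n - 1))" by (intro card_mono) auto
  finally have "real (card ?A1) + real (card ?A2) + real (card ?A3) \<le> real (card (tri (n - 1))) - real (zcount n g z)"
    unfolding zcount_def by linarith
  moreover have "real m / 2 * (S12 + S21 + S31) \<le> real m / 2 * (facecut q g - 2 * real n)"
    using facecut_ge slack_sums_nonneg by (intro mult_left_mono) auto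
  moreover note corner_balance[where h = "\<lambda>u v w. g u v w" and q = q and l = l1 and z = z and m = m,
      folded n_eq, OF term1 ne(1) m]
    corner_balance[where h = "\<lambda>u v w. g v u w" and q = q and l = l2 and z = z and m = m,
      unfolded c2, folded n_eq, OF term2 ne(2) m]
    corner_balance[where h = "\<lambda>u v w. g v w u" and q = q and l = l3 and z = z and m = m,
      unfolded c3, folded n_eq, OF term3 ne(3) m]
  moreover define K where "K = real (m * (m + 1))"
  ultimately show ?thesis
    unfolding K_def[symmetric] distrib_left by linarith
qed

end

subsection \<open>Faces with a side avoiding the fifth label\<close>

text \<open>The elements are distinct positive integers, so the \<open>i\<close>-th smallest is at
  least \<open>i\<close>.\<close>

lemma card_sq_le_double_sum:
  fixes X :: "nat set"
  assumes "finite X" "0 \<notin> X"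
  shows "real (card X) ^ 2 \<le> 2 * (\<Sum>x\<in>X. real x)"
  using assms
proof (induction X rule: finite_linorder_max_induct)
  case (insert b A)
  have "A \<subseteq> {1..<b}" using insert by (auto simp: Suc_le_eq intro: gr0I)
  then have "card A \<le> card {1..<b}" by (intro card_mono) auto
  then have "real (card A) + 1 \<le> real b" using insert by (cases b) auto
  then show ?case using insert by (auto simp: power2_eq_square algebra_simps)
qed simp

lemma sum_diff_le:
  fixes X :: "nat set"
  assumes "X \<subseteq> {1..<q}"
  shows "(\<Sum>x\<in>X. real q - real x) \<le> real (card X) * real q - real (card X) ^ 2 / 2"
proof -
  have "finite X" "0 \<notin> X" using assms finite_subset by auto
  from card_sq_le_double_sum[OF this] show ?thesis by (simp add: sum_subtractf)
qed

text \<open>Here \<open>p\<close>, \<open>r\<close>, \<open>h\<close>, \<open>\<rho>\<close> stand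
  for the sizes of \<open>J\<close>, \<open>I\<close>, \<open>R'\<close>, \<open>R - R'\<close>, and
  \<open>e\<close> for the excess of \<open>facecut\<close> over \<open>2 * n\<close>. The constant
  \<open>9 / 4\<close> is best possible: \<open>p = r = h = q\<close>, \<open>\<rho> = 0\<close>,
  \<open>e = 2 * q\<close> gives equality. This is the case of a face filled with the label 5, whose
  area is \<open>9 / 2 * q^2\<close>.\<close>

lemma area_inequality:
  fixes p r h \<rho> q e :: real
  assumes "0 \<le> p" "0 \<le> r" "0 \<le> h" "0 \<le> \<rho>" "p + r \<le> e" "2 * h + \<rho> \<le> e" "h + \<rho> \<le> q" "e \<le> 2 * q"
  shows "p * r + (p * q - p\<^sup>2 / 2) + (r * q - r\<^sup>2 / 2) + ((h + \<rho>) * q - (h + \<rho>)\<^sup>2 / 2)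
      + (p + r) * h + (p + r) / 2 * \<rho> \<le> 9 / 4 * e * q"
proof -
  define H where "H = h + \<rho>"
  have "0 \<le> e" "0 \<le> q" "0 \<le> H" "H \<le> e" "H \<le> q" using assms by (auto simp: H_def)
  have "p * r - p\<^sup>2 / 2 - r\<^sup>2 / 2 = - (p - r)\<^sup>2 / 2" by (simp add: power2_eq_square field_simps)
  then have 1: "p * r - p\<^sup>2 / 2 - r\<^sup>2 / 2 \<le> 0" by simp
  have 2: "(p + r) * q \<le> e * q" using assms(5) \<open>0 \<le> q\<close> by (rule mult_right_mono)
  have "(p + r) * (2 * h + \<rho>) \<le> e * e" using assms by (intro mult_mono) auto
  then have 3: "(p + r) * h + (p + r) / 2 * \<rho> \<le> e\<^sup>2 / 2" by (simp add: power2_eq_square field_simps)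
  \<comment> \<open>The left-hand side increases with \<open>H\<close> up to \<open>q\<close>. For
    \<open>e \<le> q\<close> the binding constraint is \<open>H \<le> e\<close>, beyond that it is
    \<open>H \<le> q\<close>, and then the claim is a quadratic in \<open>e\<close> with roots
    \<open>q / 2\<close> and \<open>2 * q\<close>.\<close>
  have 4: "H * q - H\<^sup>2 / 2 + e\<^sup>2 / 2 + e * q \<le> 9 / 4 * e * q"
  proof (cases "e \<le> q")
    case True
    have "(e - H) * (2 * q - e - H) \<ge> 0" using True \<open>H \<le> e\<close> \<open>H \<le> q\<close> by simp
    moreover have "e * q \<ge> 0" using \<open>0 \<le> e\<close> \<open>0 \<le> q\<close> by simp
    ultimately show ?thesis by (simp add: power2_eq_square field_simps)
  next
    case False
    have "(2 * q - e) * (2 * e - q) \<ge> 0" using False assms(8) \<open>0 \<le> q\<close> by simp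
    moreover have "(q - H)\<^sup>2 \<ge> 0" by simp
    ultimately show ?thesis by (simp add: power2_eq_square field_simps)
  qed
  have "(p + r) * q = p * q + r * q" by (rule distrib_right)
  then show ?thesis using 1 2 3 4 unfolding H_def[symmetric] by linarith
qed

context face begin

lemma slack_ge_1':
  assumes "h (3 * q) 0 0 = l" "u + v + s = 3 * q" "2 * q \<le> u" "h u v s = z" "l \<noteq> z" "s \<le> q"
    and "h (2 * q - 1) (Suc q - s) s \<noteq> z"
  shows "slack q l h s \<ge> 1"
  using slack_ge_1[of h q l u v s] assms by (simp add: spoke_end)

lemma card_le_slack:
  assumes "h (3 * q) 0 0 = l"
  shows "real (card {s. s \<le> q \<and> slack q l h s \<ge> 1}) \<le> (\<Sum>s\<le>q. slack q l h s)"
  using card_slack_ge[of h q l "{s. s \<le> q \<and> slack q l h s \<ge> 1}" 1] assms by simp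

text \<open>A \<open>z\<close> outside the corners survives in \<open>fill\<close>. For a
  \<open>z\<close> inside a corner, follow the spoke through it along the row: either it ends with
  \<open>z\<close> just outside the corner, where \<open>fill\<close> keeps it, or it has to leave
  \<open>z\<close> again, which gives slack 1.\<close>

lemma row_hit_cases:
  assumes "a + b + s = n" "g a b s = z" "1 \<le> s" "s < q"
  shows "(\<exists>a b. a + b + s = n \<and> fill a b s = z) \<or> slack q l1 (\<lambda>u v w. g u v w) s \<ge> 1
    \<or> slack q l2 (\<lambda>u v w. g v u w) s \<ge> 1"
proof (cases "2 * q \<le> a")
  case True
  show ?thesis
  proof (cases "g (2 * q - 1) (Suc q - s) s = z")
    case True
    then have "fill (2 * q - 1) (Suc q - s) s = z" using assms q_ge by (auto simp: fill_def)
    moreover have "(2 * q - 1) + (Suc q - s) + s = n" using assms q_ge n_eq by auto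
    ultimately show ?thesis by blast
  next
    case False
    then have "slack q l1 (\<lambda>u v w. g u v w) s \<ge> 1"
      using True assms n_eq term1 distinct by (intro slack_ge_1'[of _ _ a b]) auto
    then show ?thesis by blast
  qed
next
  case not1: False
  show ?thesis
  proof (cases "2 * q \<le> b")
    case True
    show ?thesis
    proof (cases "g (Suc q - s) (2 * q - 1) s = z")
      case True
      then have "fill (Suc q - s) (2 * q - 1) s = z" using assms q_ge by (auto simp: fill_def)
      moreover have "(Suc q - s) + (2 * q - 1) + s = n" using assms q_ge n_eq by auto
      ultimately show ?thesis by blast
    next
      case False
      then have "slack q l2 (\<lambda>u v w. g v u w) s \<ge> 1"
        using True assms n_eq term2 distinct by (intro slack_ge_1'[of _ _ b a]) auto
      then show ?thesis by blast
    qed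
  next
    case False
    then have "fill a b s = z" using not1 assms by (auto simp: fill_def)
    then show ?thesis using assms by blast
  qed
qed

section \<open>Lines near the sides that meet \<open>z\<close>, and what they cost\<close>

definition "J = {j. 1 \<le> j \<and> j < q \<and> (\<exists>a c. a + j + c = n \<and> g a j c = z)}"
definition "I = {i. 1 \<le> i \<and> i < q \<and> (\<exists>b c. i + b + c = n \<and> g i b c = z)}"
definition "R = {s. 1 \<le> s \<and> s < q \<and> (\<exists>a b. a + b + s = n \<and> g a b s = z)}"
definition "R' = {s. 1 \<le> s \<and> s < q \<and> (\<exists>a b. a + b + s = n \<and> fill a b s = z)}"

lemma fill_z: "a + b + c = n \<Longrightarrow> fill a b c = z \<Longrightarrow> g a b c = z"
  using distinct by (auto simp: fill_def split: if_splits)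

lemma JIR_subset: "J \<subseteq> {1..<q}" "I \<subseteq> {1..<q}" "R \<subseteq> {1..<q}" "R' \<subseteq> R"
proof -
  show "R' \<subseteq> R" unfolding R_def R'_def using fill_z by blast
qed (auto simp: J_def I_def R_def)

lemma finite_JIR [simp]: "finite J" "finite I" "finite R" "finite R'"
  using JIR_subset finite_subset by (meson finite_atLeastLessThan)+

lemma column_hit_cases:
  assumes "j \<in> J"
  shows "(\<exists>a c. a + j + c = n \<and> fill a j c = z) \<or> slack q l1 (\<lambda>u v w. g u w v) j \<ge> 1
    \<or> slack q l3 (\<lambda>u v w. g v w u) j \<ge> 1"
proof -
  interpret s: face n "\<lambda>a b c. g a c b" l1 l3 l2 z q by (rule face_swap23)
  obtain a c where "a + j + c = n" "g a j c = z" "1 \<le> j" "j < q" using assms by (auto simp: J_def)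
  moreover have "s.fill a b c = fill a c b" if "a + b + c = n" for a b c
    using that n_eq q_ge by (auto simp: fill_def s.fill_def)
  ultimately show ?thesis using s.row_hit_cases[of a c j] by (metis add.assoc add.commute)
qed

lemma diagonal_hit_cases:
  assumes "i \<in> I"
  shows "(\<exists>b c. i + b + c = n \<and> fill i b c = z) \<or> slack q l2 (\<lambda>u v w. g w u v) i \<ge> 1
    \<or> slack q l3 (\<lambda>u v w. g w v u) i \<ge> 1"
proof -
  interpret s1: face n "\<lambda>a b c. g b a c" l2 l1 l3 z q by (rule face_swap12)
  interpret s: face n "\<lambda>a b c. g c a b" l2 l3 l1 z q by (rule s1.face_swap23)
  obtain b c where "i + b + c = n" "g i b c = z" "1 \<le> i" "i < q" using assms by (auto simp: I_def)
  moreover have "s.fill a b c = fill c a b" if "a + b + c = n" for a b c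
    using that n_eq q_ge by (auto simp: fill_def s.fill_def)
  ultimately show ?thesis using s.row_hit_cases[of b c i] by (metis add.assoc add.commute)
qed

text \<open>In the first bound each exit is the last \<open>z\<close> of at most one line in each of two directions. In both
  bounds, a line on which \<open>z\<close> occurs only inside the corners pays with the slack of a spoke.\<close>

lemma extra_ge:
  assumes n: "n = Suc (Suc k)" and bottom: "\<And>a b. a + b = n \<Longrightarrow> g a b 0 \<in> {l1, l2}"
  shows "facecut q g - 2 * real n \<ge> real (card J) + real (card I)"
    and "(\<And>s. s < n \<Longrightarrow> \<exists>t\<le>n - s. row n fill s t \<noteq> z) \<Longrightarrow>
      facecut q g - 2 * real n \<ge> 2 * real (card R') + real (card (R - R'))"
proof -
  interpret f: cornered n fill l1 l2 l3 z q by (rule cornered_fill)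
  have bottom': "fill a b 0 \<in> {l1, l2}" if "a + b = n" for a b
    using bottom[OF that] q_ge by (auto simp: fill_def)
  have extra: "facecut q g - 2 * real n \<ge> 2 * real (card (f.exits k)) + (S12 + S13 + S21 + S23 + S31 + S32)"
    using f.gridcut_ge_exits[OF n bottom'] by (simp add: facecut_eq)
  let ?L = "\<lambda>l h. {s. s \<le> q \<and> slack q l h s \<ge> 1}"
  have fin: "finite (?L l h)" for l h by auto
  define J' where "J' = {j. 1 \<le> j \<and> j < q \<and> (\<exists>a c. a + j + c = n \<and> fill a j c = z)}"
  define I' where "I' = {i. 1 \<le> i \<and> i < q \<and> (\<exists>b c. i + b + c = n \<and> fill i b c = z)}"
  have fin': "finite J'" "finite I'" unfolding J'_def I'_def by auto
  have un: "card X \<le> card A + card B + card C" if "X \<subseteq> A \<union> B \<union> C" "finite A" "finite B" "finite C" for X A B C :: "nat set"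
  proof -
    have "card X \<le> card (A \<union> B \<union> C)" using that by (intro card_mono) auto
    then show ?thesis using card_Un_le[of "A \<union> B" C] card_Un_le[of A B] by linarith
  qed
  have "J \<subseteq> J' \<union> ?L l1 (\<lambda>u v w. g u w v) \<union> ?L l3 (\<lambda>u v w. g v w u)"
    using column_hit_cases by (fastforce simp: J'_def J_def)
  then have "real (card J) \<le> real (card J') + S13 + S31"
    using un[of J J' "?L l1 (\<lambda>u v w. g u w v)" "?L l3 (\<lambda>u v w. g v w u)"] fin fin'
      card_le_slack[of "\<lambda>u v w. g u w v" l1] card_le_slack[of "\<lambda>u v w. g v w u" l3] term1 term3 n_eq by simp
  moreover have "I \<subseteq> I' \<union> ?L l2 (\<lambda>u v w. g w u v) \<union> ?L l3 (\<lambda>u v w. g w v u)"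
    using diagonal_hit_cases by (fastforce simp: I'_def I_def)
  then have "real (card I) \<le> real (card I') + S23 + S32"
    using un[of I I' "?L l2 (\<lambda>u v w. g w u v)" "?L l3 (\<lambda>u v w. g w v u)"] fin fin'
      card_le_slack[of "\<lambda>u v w. g w u v" l2] card_le_slack[of "\<lambda>u v w. g w v u" l3] term2 term3 n_eq by simp
  moreover have "card J' \<le> card (f.exits k)" "card I' \<le> card (f.exits k)"
    unfolding J'_def I'_def by (rule f.lines_le_exits[OF n] f.lines_le_exits'[OF n])+
  ultimately show "facecut q g - 2 * real n \<ge> real (card J) + real (card I)"
    using extra slack_sums_nonneg by linarith
  assume "\<And>s. s < n \<Longrightarrow> \<exists>t\<le>n - s. row n fill s t \<noteq> z"
  from f.rows_le_exits[OF n this bottom']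
  have "card {s. s < q \<and> (\<exists>t\<le>n - s. row n fill s t = z)} \<le> card (f.exits k)" .
  moreover have "R' \<subseteq> {s. s < q \<and> (\<exists>t\<le>n - s. row n fill s t = z)}"
  proof
    fix s assume "s \<in> R'"
    then obtain a b where s: "a + b + s = n" "fill a b s = z" "s < q" by (auto simp: R'_def)
    then have "n - s - b = a" "b \<le> n - s" by auto
    then show "s \<in> {s. s < q \<and> (\<exists>t\<le>n - s. row n fill s t = z)}" using s by (auto simp: row_def)
  qed
  then have "card R' \<le> card {s. s < q \<and> (\<exists>t\<le>n - s. row n fill s t = z)}" by (intro card_mono) auto
  moreover have "R - R' \<subseteq> {} \<union> ?L l1 (\<lambda>u v w. g u v w) \<union> ?L l2 (\<lambda>u v w. g v u w)"
    using row_hit_cases by (fastforce simp: R_def R'_def)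
  then have "real (card (R - R')) \<le> S12 + S21"
    using un[of "R - R'" "{}" "?L l1 (\<lambda>u v w. g u v w)" "?L l2 (\<lambda>u v w. g v u w)"] fin
      card_le_slack[of "\<lambda>u v w. g u v w" l1] card_le_slack[of "\<lambda>u v w. g v u w" l2] term1 term2 n_eq by simp
  ultimately show "facecut q g - 2 * real n \<ge> 2 * real (card R') + real (card (R - R'))"
    using extra slack_sums_nonneg by linarith
qed

end

section \<open>Area of \<open>z\<close> in terms of the lines that meet it\<close>

context face begin

definition rowz :: "nat \<Rightarrow> nat set" where
  "rowz s = {b. 0 < b \<and> b < n - 1 - s \<and> mono3 g {z} (n - 1 - s - b) b s}"

lemma finite_rowz [simp]: "finite (rowz s)"
  by (rule finite_subset[of _ "{..<n}"]) (auto simp: rowz_def)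

lemma mem_J: "a + b + c = n \<Longrightarrow> g a b c = z \<Longrightarrow> 1 \<le> b \<Longrightarrow> b < q \<Longrightarrow> b \<in> J"
  and mem_I: "a + b + c = n \<Longrightarrow> g a b c = z \<Longrightarrow> 1 \<le> a \<Longrightarrow> a < q \<Longrightarrow> a \<in> I"
  and mem_R: "a + b + c = n \<Longrightarrow> g a b c = z \<Longrightarrow> 1 \<le> c \<Longrightarrow> c < q \<Longrightarrow> c \<in> R"
  unfolding J_def I_def R_def by blast+

text \<open>Positions near an end of the row lie on a line recorded in \<open>J\<close> or in
  \<open>I\<close>. Only the \<open>q - s\<close> middle positions, with both coordinates at least
  \<open>q\<close>, escape this.\<close>

lemma card_rowz_le:
  assumes "s \<in> R"
  shows "card (rowz s) \<le> card J + card I + (q - s)"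
proof -
  have s: "1 \<le> s" "s < q" using assms by (auto simp: R_def)
  have "rowz s \<subseteq> J \<union> (\<lambda>i. n - 1 - s - i) ` I \<union> {q..<2 * q - s}"
  proof
    fix b assume b: "b \<in> rowz s"
    define a where "a = n - 1 - s - b"
    have ab: "0 < a" "0 < b" "a + b + s = n - 1" "Suc a + b + s = n" "a + Suc b + s = n"
      "g (Suc a) b s = z" "g a (Suc b) s = z" "b = n - 1 - s - a"
      using b[unfolded rowz_def mono3_def] s n_eq by (auto simp: a_def)
    show "b \<in> J \<union> (\<lambda>i. n - 1 - s - i) ` I \<union> {q..<2 * q - s}"
    proof (cases "b < q \<or> a < q")
      case True
      then have "b \<in> J \<or> a \<in> I" using mem_J[of "Suc a" b s] mem_I[of a "Suc b" s] ab by auto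
      then show ?thesis using ab(8) by auto
    next
      case False
      then have "q \<le> b" "b < 2 * q - s" using ab(4) n_eq s by linarith+
      then show ?thesis by simp
    qed
  qed
  then have "card (rowz s) \<le> card (J \<union> (\<lambda>i. n - 1 - s - i) ` I \<union> {q..<2 * q - s})"
    by (intro card_mono) auto
  also have "\<dots> \<le> card J + card ((\<lambda>i. n - 1 - s - i) ` I) + card {q..<2 * q - s}"
    using card_Un_le[of "J \<union> (\<lambda>i. n - 1 - s - i) ` I" "{q..<2 * q - s}"]
      card_Un_le[of J "(\<lambda>i. n - 1 - s - i) ` I"] by linarith
  also have "\<dots> \<le> card J + card I + (q - s)"
    using card_image_le[of I "\<lambda>i. n - 1 - s - i"] by simp
  finally show ?thesis .
qed

text \<open>On such a row \<open>z\<close> occurs only inside the first two corners, hence within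
  \<open>q - s\<close> of an end. Each corner contributes at most the minimum, thus at most the
  mean, of \<open>q - s\<close> and the number of lines. Halving the influence of \<open>J\<close>
  and \<open>I\<close> compensates for the fact that rows in \<open>R - R'\<close> count only once,
  not twice, in \<open>extra_ge\<close>.\<close>

lemma card_rowz_le':
  assumes "s \<in> R - R'"
  shows "2 * card (rowz s) \<le> card J + card I + 2 * (q - s)"
proof -
  have s: "1 \<le> s" "s < q" using assms by (auto simp: R_def)
  define A where "A = {j \<in> J. j < q - s}"
  define B where "B = {i \<in> I. i < q - s}"
  have "rowz s \<subseteq> A \<union> (\<lambda>i. n - 1 - s - i) ` B"
  proof
    fix b assume b: "b \<in> rowz s"
    define a where "a = n - 1 - s - b"
    have ab: "0 < a" "0 < b" "a + b + s = n - 1" "Suc a + b + s = n" "a + Suc b + s = n"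
      "g (Suc a) b s = z" "g a (Suc b) s = z" "b = n - 1 - s - a"
      using b[unfolded rowz_def mono3_def] s n_eq by (auto simp: a_def)
    have "fill (Suc a) b s \<noteq> z" "fill a (Suc b) s \<noteq> z"
      using assms s ab(4,5) unfolding R'_def by blast+
    then have "2 * q \<le> Suc a \<or> 2 * q \<le> b" "2 * q \<le> a \<or> 2 * q \<le> Suc b"
      using ab s by (auto simp: fill_def split: if_splits)
    then have "2 * q \<le> a \<or> 2 * q \<le> b" using ab(3) n_eq q_ge by linarith
    then have "b < q - s \<or> a < q - s" using ab(4) n_eq s by linarith
    then have "b < q - s \<and> b < q \<or> a < q - s \<and> a < q" by auto
    then have "b \<in> A \<or> a \<in> B"
      using mem_J[OF ab(4,6)] mem_I[OF ab(5,7)] ab(1,2) unfolding A_def B_def by auto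
    then show "b \<in> A \<union> (\<lambda>i. n - 1 - s - i) ` B" using ab(8) by auto
  qed
  then have "card (rowz s) \<le> card (A \<union> (\<lambda>i. n - 1 - s - i) ` B)"
    by (intro card_mono) (auto simp: A_def B_def)
  also have "\<dots> \<le> card A + card B"
    using card_Un_le[of A "(\<lambda>i. n - 1 - s - i) ` B"] card_image_le[of B "\<lambda>i. n - 1 - s - i"]
    by (simp add: B_def)
  finally have "card (rowz s) \<le> card A + card B" .
  moreover have "card A \<le> card J" "card B \<le> card I" by (auto intro!: card_mono simp: A_def B_def)
  moreover have "card A \<le> card {..<q - s}" "card B \<le> card {..<q - s}"
    by (rule card_mono; auto simp: A_def B_def)+
  ultimately show ?thesis by simp
qed

text \<open>The coordinates of an upward triangle sum to \<open>3 * q - 1\<close>, so one of them is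
  below \<open>q\<close>. Those with \<open>c < q\<close> are counted along the rows in
  \<open>R\<close>, the others along the lines in \<open>J\<close> and \<open>I\<close>. The set
  \<open>P0\<close> collects the triangles with \<open>a = 0\<close> or \<open>b = 0\<close>, a
  lower order term.\<close>

lemma zcount_le_area:
  assumes bottom: "\<And>a b. a + b = n \<Longrightarrow> g a b 0 \<in> {l1, l2}"
  shows "real (zcount n g z) \<le> 2 * real n + real (card J) * real (card I)
    + (\<Sum>j\<in>J. real q - real j) + (\<Sum>i\<in>I. real q - real i) + (\<Sum>s\<in>R. real q - real s)
    + (real (card J) + real (card I)) * real (card R')
    + (real (card J) + real (card I)) / 2 * real (card (R - R'))"
proof -
  define P0 where "P0 = (\<lambda>(t, w). if w then (0, t, n - 1 - t) else (t, 0, n - 1 - t)) ` ({..<n} \<times> (UNIV :: bool set))"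
  define P1 where "P1 = (\<lambda>(j, i). (i, j, n - 1 - i - j)) ` (J \<times> I)"
  define P2 where "P2 = (\<lambda>(j, a). (a, j, n - 1 - a - j)) ` Sigma J (\<lambda>j. {q..<2 * q - j})"
  define P3 where "P3 = (\<lambda>(i, b). (i, b, n - 1 - i - b)) ` Sigma I (\<lambda>i. {q..<2 * q - i})"
  define P4 where "P4 = (\<lambda>(s, b). (n - 1 - s - b, b, s)) ` Sigma R rowz"
  have fin: "finite P0" "finite P1" "finite P2" "finite P3" "finite P4"
    unfolding P0_def P1_def P2_def P3_def P4_def by auto
  have "{(a, b, c) \<in> tri (n - 1). mono3 g {z} a b c} \<subseteq> P0 \<union> P1 \<union> P2 \<union> P3 \<union> P4"
  proof clarify
    fix a b c assume abc: "(a, b, c) \<in> tri (n - 1)" "mono3 g {z} a b c"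
      and not: "(a, b, c) \<notin> P4" "(a, b, c) \<notin> P3" "(a, b, c) \<notin> P2" "(a, b, c) \<notin> P1"
    have sums: "a + b + c = n - 1" "Suc a + b + c = n" "a + Suc b + c = n"
      using abc n_eq q_ge by auto
    have gz: "g (Suc a) b c = z" "g a (Suc b) c = z" using abc by (auto simp: mono3_def)
    show "(a, b, c) \<in> P0"
    proof (rule ccontr)
      assume no0: "(a, b, c) \<notin> P0"
      have a0: "a > 0"
      proof (rule ccontr)
        assume "\<not> a > 0"
        then have "(a, b, c) \<in> P0" using sums unfolding P0_def by (intro image_eqI[of _ _ "(b, True)"]) auto
        then show False using no0 by simp
      qed
      have b0: "b > 0"
      proof (rule ccontr)
        assume "\<not> b > 0"
        then have "(a, b, c) \<in> P0" using sums unfolding P0_def by (intro image_eqI[of _ _ "(a, False)"]) auto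
        then show False using no0 by simp
      qed
      have c0: "c > 0" using bottom[of "Suc a" b] gz(1) sums(2) distinct by (cases c) auto
      have J: "b \<in> J" if "b < q" using mem_J[OF sums(2) gz(1)] that b0 by simp
      have I: "a \<in> I" if "a < q" using mem_I[OF sums(3) gz(2)] that a0 by simp
      show False
      proof (cases "c < q")
        case True
        then have "c \<in> R" using mem_R[OF sums(2) gz(1)] c0 by simp
        moreover have "n - 1 - c - b = a" using sums by simp
        then have "b \<in> rowz c" using abc a0 b0 sums by (auto simp: rowz_def)
        ultimately have "(a, b, c) \<in> P4" using sums unfolding P4_def by (intro image_eqI[of _ _ "(c, b)"]) auto
        then show False using not by simp
      next
        case False
        consider "a < q" "b < q" | "q \<le> a" "b < q" | "a < q" "q \<le> b" | "q \<le> a" "q \<le> b" by linarith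
        then show False
        proof cases
          case 1
          then have "(a, b, c) \<in> P1" using J I sums unfolding P1_def by (intro image_eqI[of _ _ "(b, a)"]) auto
          then show False using not by simp
        next
          case 2
          then have "(a, b, c) \<in> P2" using J sums False n_eq unfolding P2_def
            by (intro image_eqI[of _ _ "(b, a)"]) auto
          then show False using not by simp
        next
          case 3
          then have "(a, b, c) \<in> P3" using I sums False n_eq unfolding P3_def
            by (intro image_eqI[of _ _ "(a, b)"]) auto
          then show False using not by simp
        next
          case 4
          then show False using False sums n_eq q_ge by linarith
        qed
      qed
    qed
  qed
  then have "zcount n g z \<le> card (P0 \<union> P1 \<union> P2 \<union> P3 \<union> P4)"
    unfolding zcount_def using fin by (intro card_mono) auto
  also have "\<dots> \<le> card P0 + card P1 + card P2 + card P3 + card P4"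
    using card_Un_le[of "P0 \<union> P1 \<union> P2 \<union> P3" P4] card_Un_le[of "P0 \<union> P1 \<union> P2" P3]
      card_Un_le[of "P0 \<union> P1" P2] card_Un_le[of P0 P1] by linarith
  finally have total: "zcount n g z \<le> card P0 + card P1 + card P2 + card P3 + card P4" .
  have c0: "card P0 \<le> 2 * n"
    unfolding P0_def by (rule order_trans[OF card_image_le]) (auto simp: card_cartesian_product)
  have c1: "card P1 \<le> card J * card I"
    unfolding P1_def by (rule order_trans[OF card_image_le]) (auto simp: card_cartesian_product)
  have "card P2 \<le> (\<Sum>j\<in>J. q - j)"
    unfolding P2_def by (rule order_trans[OF card_image_le]) auto
  also have "real (\<Sum>j\<in>J. q - j) = (\<Sum>j\<in>J. real q - real j)"
    using JIR_subset by (auto simp: of_nat_diff intro!: sum.cong)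
  finally have c2: "real (card P2) \<le> (\<Sum>j\<in>J. real q - real j)" by simp
  have "card P3 \<le> (\<Sum>i\<in>I. q - i)"
    unfolding P3_def by (rule order_trans[OF card_image_le]) auto
  also have "real (\<Sum>i\<in>I. q - i) = (\<Sum>i\<in>I. real q - real i)"
    using JIR_subset by (auto simp: of_nat_diff intro!: sum.cong)
  finally have c3: "real (card P3) \<le> (\<Sum>i\<in>I. real q - real i)" by simp
  let ?l = "real (card J) + real (card I)"
  have "card P4 \<le> (\<Sum>s\<in>R. card (rowz s))"
    unfolding P4_def by (rule order_trans[OF card_image_le]) auto
  then have "real (card P4) \<le> (\<Sum>s\<in>R. real (card (rowz s)))"
    by (metis of_nat_le_iff of_nat_sum)
  also have "\<dots> \<le> (\<Sum>s\<in>R. (real q - real s) + (if s \<in> R' then ?l else ?l / 2))"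
  proof (rule sum_mono)
    fix s assume s: "s \<in> R"
    then have "s < q" by (auto simp: R_def)
    show "real (card (rowz s)) \<le> (real q - real s) + (if s \<in> R' then ?l else ?l / 2)"
    proof (cases "s \<in> R'")
      case True
      then show ?thesis using card_rowz_le[OF s] \<open>s < q\<close> by auto
    next
      case False
      then have "2 * card (rowz s) \<le> card J + card I + 2 * (q - s)" using card_rowz_le'[of s] s by auto
      then have "real (2 * card (rowz s)) \<le> real (card J + card I + 2 * (q - s))" by (simp only: of_nat_le_iff)
      then have "2 * real (card (rowz s)) \<le> ?l + 2 * (real q - real s)" using \<open>s < q\<close> by (simp add: of_nat_diff)
      moreover have "(if s \<in> R' then ?l else ?l / 2) = ?l / 2" using False by simp
      ultimately show ?thesis by argo
    qed
  qed
  also have "\<dots> = (\<Sum>s\<in>R. real q - real s) + (\<Sum>s\<in>R. if s \<in> R' then ?l else ?l / 2)"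
    by (rule sum.distrib)
  also have "(\<Sum>s\<in>R. if s \<in> R' then ?l else ?l / 2) = ?l * real (card R') + ?l / 2 * real (card (R - R'))"
  proof -
    have "R \<inter> {s. s \<in> R'} = R'" "R \<inter> - {s. s \<in> R'} = R - R'" using JIR_subset by auto
    then show ?thesis by (simp add: sum.If_cases)
  qed
  finally have c4: "real (card P4) \<le> (\<Sum>s\<in>R. real q - real s) + (?l * real (card R') + ?l / 2 * real (card (R - R')))" .
  have "real (zcount n g z) \<le> real (card P0) + real (card P1) + real (card P2) + real (card P3) + real (card P4)"
    using total by linarith
  moreover have "real (card P1) \<le> real (card J) * real (card I)" using c1 by (metis of_nat_le_iff of_nat_mult)
  moreover have "real (card P0) \<le> 2 * real n" using c0 by linarith
  ultimately show ?thesis using c2 c3 c4 by linarith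
qed

lemma zcount_le_tri: "real (zcount n g z) \<le> (9 * (real q)\<^sup>2 + 3 * real q) / 2"
proof -
  have "zcount n g z \<le> card (tri (n - 1))"
    unfolding zcount_def by (intro card_mono) auto
  moreover have "2 * card (tri (n - 1)) = n * (n + 1)"
    using card_tri[of "n - 1"] n_eq q_ge by simp
  ultimately have "2 * real (zcount n g z) \<le> real (n * (n + 1))" by linarith
  then show ?thesis using n_eq by (simp add: power2_eq_square algebra_simps)
qed

theorem zcount_le_extra:
  assumes bottom: "\<And>a b. a + b = n \<Longrightarrow> g a b 0 \<in> {l1, l2}"
  shows "real (zcount n g z) \<le> 9 / 4 * real q * (facecut q g - 2 * real n) + 2 * real n"
proof -
  define e where "e = facecut q g - 2 * real n"
  have n: "n = Suc (Suc (n - 2))" using n_eq q_ge by simp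
  have e1: "real (card J) + real (card I) \<le> e"
    unfolding e_def using extra_ge(1)[OF n bottom] .
  \<comment> \<open>For such \<open>e\<close> the right-hand side already reaches the number of all
    upward triangles:
    \<open>9 / 4 * q * (2 * q - 2) + 6 * q = (9 * q^2 + 3 * q) / 2\<close>.\<close>
  have big: ?thesis if "e \<ge> 2 * real q - 2"
  proof -
    have "real q * (2 * real q - 2) \<le> real q * e" using that by (intro mult_left_mono) auto
    then have "real q * e \<ge> 2 * (real q)\<^sup>2 - 2 * real q"
      by (simp add: power2_eq_square algebra_simps)
    moreover have "real n = 3 * real q" using n_eq by simp
    moreover have "9 / 4 * real q * e = 9 / 4 * (real q * e)" by simp
    ultimately show ?thesis using zcount_le_tri unfolding e_def[symmetric] by argo
  qed
  show ?thesis
  proof (cases "\<exists>s<n. \<forall>t\<le>n - s. row n fill s t = z")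
    \<comment> \<open>A row full of \<open>z\<close> violates the hypothesis of the second bound in
      \<open>extra_ge\<close>. However, it crosses every line of index between 1 and
      \<open>q - 1\<close> in the other two directions, so the first bound makes \<open>e\<close>
      large enough.\<close>
    case True
    then obtain s where s: "s < n" "\<And>t. t \<le> n - s \<Longrightarrow> row n fill s t = z" by blast
    interpret f: cornered n fill l1 l2 l3 z q by (rule cornered_fill)
    have "s > q" using f.row_ends[of s] s(2)[of 0] distinct by force
    have "s < 2 * q"
      using s(2)[of 0] s(1) f.corner3[of "n - s" 0 s] distinct by (force simp: row_def)
    have "t \<in> J \<and> t \<in> I" if "t \<in> {1..<q}" for t
    proof
      have "fill (n - s - t) t s = z" "(n - s - t) + t + s = n"
        using s(2)[of t] that \<open>s < 2 * q\<close> n_eq s(1) by (auto simp: row_def)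
      then show "t \<in> J" using fill_z[of "n - s - t" t s] that unfolding J_def by auto
      have "fill t (n - s - t) s = z" "t + (n - s - t) + s = n"
        using s(2)[of "n - s - t"] that \<open>s < 2 * q\<close> n_eq s(1) by (auto simp: row_def)
      then show "t \<in> I" using fill_z[of t "n - s - t" s] that unfolding I_def by auto
    qed
    then have "J = {1..<q}" "I = {1..<q}" using JIR_subset by auto
    then have "e \<ge> 2 * real q - 2" using e1 q_ge by simp
    then show ?thesis by (rule big)
  next
    case False
    then have "2 * real (card R') + real (card (R - R')) \<le> e"
      unfolding e_def by (intro extra_ge(2)[OF n bottom]) auto
    moreover have "card R = card R' + card (R - R')"
      using JIR_subset by (metis card_Diff_subset card_mono finite_JIR(3,4) le_add_diff_inverse)
    moreover have "card R \<le> card {1..<q}" using JIR_subset by (intro card_mono) auto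
    ultimately have *: "2 * real (card R') + real (card (R - R')) \<le> e" "real (card R') + real (card (R - R')) \<le> real q"
      "real (card R) = real (card R') + real (card (R - R'))" by auto
    show ?thesis
    proof (cases "e \<le> 2 * real q")
      case True
      have "real (zcount n g z) \<le> 2 * real n + 9 / 4 * e * real q"
        using zcount_le_area[OF bottom] sum_diff_le[OF JIR_subset(1)] sum_diff_le[OF JIR_subset(2)]
          sum_diff_le[OF JIR_subset(3)]
          area_inequality[of "real (card J)" "real (card I)" "real (card R')" "real (card (R - R'))" e "real q"]
          e1 * True by simp
      then show ?thesis unfolding e_def[symmetric] by (simp add: mult.commute mult.left_commute)
    next
      case False
      then show ?thesis by (intro big) simp
    qed
  qed
qed

end

subsection \<open>The three-dimensional instance\<close>

type_synonym labelling4 = "nat \<Rightarrow> nat \<Rightarrow> nat \<Rightarrow> nat \<Rightarrow> nat"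

definition quad :: "nat \<Rightarrow> (nat \<times> nat \<times> nat \<times> nat) set" where
  "quad m = {(a, b, c, d). a + b + c + d = m}"

lemma mem_quad [simp]: "(a, b, c, d) \<in> quad m \<longleftrightarrow> a + b + c + d = m"
  by (simp add: quad_def)

lemma finite_quad [simp]: "finite (quad m)"
  by (rule finite_subset[of _ "{..m} \<times> {..m} \<times> {..m} \<times> {..m}"]) (auto simp: quad_def)

lemma card_quad_Suc: "card (quad (Suc m)) = card (quad m) + card (tri (Suc m))"
proof -
  let ?A = "{(a, b, c, d) \<in> quad (Suc m). d = 0}" and ?B = "{(a, b, c, d) \<in> quad (Suc m). d > 0}"
  have "card ?A = card (tri (Suc m))"
    by (rule bij_betw_same_card[of "\<lambda>(a, b, c, d). (a, b, c)"],
        rule bij_betwI[of _ _ _ "\<lambda>(a, b, c). (a, b, c, 0)"]) auto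
  moreover have "card ?B = card (quad m)"
    by (rule bij_betw_same_card[of "\<lambda>(a, b, c, d). (a, b, c, d - 1)"],
        rule bij_betwI[of _ _ _ "\<lambda>(a, b, c, d). (a, b, c, d + 1)"]) auto
  moreover have "card (quad (Suc m)) = card ?A + card ?B"
    by (subst card_Un_disjoint[symmetric])
       (auto intro!: arg_cong[where f = card] finite_subset[OF _ finite_quad[of "Suc m"]])
  ultimately show ?thesis by simp
qed

lemma card_quad: "6 * card (quad m) = (m + 1) * (m + 2) * (m + 3)"
proof (induction m)
  case 0
  have "quad 0 = {(0, 0, 0, 0)}" by (auto simp: quad_def)
  then show ?case by simp
next
  case (Suc m)
  have "2 * card (tri (Suc m)) = (m + 2) * (m + 3)" using card_tri[of "Suc m"] by (simp add: algebra_simps)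
  moreover have "6 * card (quad (Suc m)) = 6 * card (quad m) + 3 * (2 * card (tri (Suc m)))"
    by (simp add: card_quad_Suc)
  ultimately have "6 * card (quad (Suc m)) = (m + 1) * (m + 2) * (m + 3) + 3 * ((m + 2) * (m + 3))"
    by (simp only: Suc)
  then show ?case by (simp add: algebra_simps)
qed

definition cut4 :: "nat \<Rightarrow> nat \<Rightarrow> nat \<Rightarrow> nat \<Rightarrow> real" where
  "cut4 u v w x = cut u v + cut u w + cut u x + cut v w + cut v x + cut w x"

text \<open>The cheapest way to separate four vertices is to isolate one of them.\<close>

lemma cut4_ge_3: "\<not> (u = v \<and> v = w \<and> w = x) \<Longrightarrow> cut4 u v w x \<ge> 3"
  by (auto simp: cut4_def cut_def)

lemma cut4_nonneg: "cut4 u v w x \<ge> 0"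
  by (simp add: cut4_def)

definition volcut :: "nat \<Rightarrow> labelling4 \<Rightarrow> real" where
  "volcut n L = (\<Sum>(a, b, c, d)\<in>quad (n - 1).
     cut4 (L (Suc a) b c d) (L a (Suc b) c d) (L a b (Suc c) d) (L a b c (Suc d)))"

lemma volcut_perms:
  "volcut n (\<lambda>a b c d. L a b d c) = volcut n L"
  "volcut n (\<lambda>a b c d. L a d b c) = volcut n L"
  "volcut n (\<lambda>a b c d. L d a b c) = volcut n L"
proof -
  show "volcut n (\<lambda>a b c d. L a b d c) = volcut n L"
    unfolding volcut_def
    by (rule sum.reindex_bij_witness[of _ "\<lambda>(a, b, c, d). (a, b, d, c)" "\<lambda>(a, b, c, d). (a, b, d, c)"])
       (auto simp: cut4_def cut_commute)
  show "volcut n (\<lambda>a b c d. L a d b c) = volcut n L"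
    unfolding volcut_def
    by (rule sum.reindex_bij_witness[of _ "\<lambda>(a, d, b, c). (a, b, c, d)" "\<lambda>(a, b, c, d). (a, d, b, c)"])
       (auto simp: cut4_def cut_commute)
  show "volcut n (\<lambda>a b c d. L d a b c) = volcut n L"
    unfolding volcut_def
    by (rule sum.reindex_bij_witness[of _ "\<lambda>(d, a, b, c). (a, b, c, d)" "\<lambda>(a, b, c, d). (d, a, b, c)"])
       (auto simp: cut4_def cut_commute)
qed

locale labelling4 =
  fixes n :: nat and L :: labelling4 and l1 l2 l3 l4 z :: nat
  assumes distinct: "distinct [l1, l2, l3, l4, z]"
    and range: "\<And>a b c d. a + b + c + d = n \<Longrightarrow> L a b c d \<in> {l1, l2, l3, l4, z}"
    and supp1: "\<And>a b c d. a + b + c + d = n \<Longrightarrow> L a b c d = l1 \<Longrightarrow> a > 0"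
    and supp2: "\<And>a b c d. a + b + c + d = n \<Longrightarrow> L a b c d = l2 \<Longrightarrow> b > 0"
    and supp3: "\<And>a b c d. a + b + c + d = n \<Longrightarrow> L a b c d = l3 \<Longrightarrow> c > 0"
    and supp4: "\<And>a b c d. a + b + c + d = n \<Longrightarrow> L a b c d = l4 \<Longrightarrow> d > 0"
begin

lemma perm_1243: "labelling4 n (\<lambda>a b c d. L a b d c) l1 l2 l4 l3 z"
proof
  show "distinct [l1, l2, l4, l3, z]" using distinct by auto
  fix a b c d assume "a + b + c + d = n"
  then have *: "a + b + d + c = n" by simp
  show "L a b d c \<in> {l1, l2, l4, l3, z}" using range[OF *] by auto
  show "0 < a" if "L a b d c = l1" using supp1[OF * that] .
  show "0 < b" if "L a b d c = l2" using supp2[OF * that] .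
  show "0 < c" if "L a b d c = l4" using supp4[OF * that] .
  show "0 < d" if "L a b d c = l3" using supp3[OF * that] .
qed

lemma perm_1342: "labelling4 n (\<lambda>a b c d. L a d b c) l1 l3 l4 l2 z"
proof
  show "distinct [l1, l3, l4, l2, z]" using distinct by auto
  fix a b c d assume "a + b + c + d = n"
  then have *: "a + d + b + c = n" by simp
  show "L a d b c \<in> {l1, l3, l4, l2, z}" using range[OF *] by auto
  show "0 < a" if "L a d b c = l1" using supp1[OF * that] .
  show "0 < b" if "L a d b c = l3" using supp3[OF * that] .
  show "0 < c" if "L a d b c = l4" using supp4[OF * that] .
  show "0 < d" if "L a d b c = l2" using supp2[OF * that] .
qed

lemma perm_2341: "labelling4 n (\<lambda>a b c d. L d a b c) l2 l3 l4 l1 z"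
proof
  show "distinct [l2, l3, l4, l1, z]" using distinct by auto
  fix a b c d assume "a + b + c + d = n"
  then have *: "d + a + b + c = n" by simp
  show "L d a b c \<in> {l2, l3, l4, l1, z}" using range[OF *] by auto
  show "0 < a" if "L d a b c = l2" using supp2[OF * that] .
  show "0 < b" if "L d a b c = l3" using supp3[OF * that] .
  show "0 < c" if "L d a b c = l4" using supp4[OF * that] .
  show "0 < d" if "L d a b c = l1" using supp1[OF * that] .
qed

definition mono4 :: "nat set \<Rightarrow> nat \<Rightarrow> nat \<Rightarrow> nat \<Rightarrow> nat \<Rightarrow> bool" where
  "mono4 A a b c d \<longleftrightarrow> L (Suc a) b c d \<in> A \<and> L a (Suc b) c d \<in> A \<and> L a b (Suc c) d \<in> A \<and> L a b c (Suc d) \<in> A"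

text \<open>The same injection as for triangles; merging \<open>z\<close> into \<open>l4\<close> costs the \<open>z\<close>-monochromatic
  triangles of the face opposite to the fourth corner.\<close>

lemma volcut_ge_face:
  assumes n2: "n \<ge> 2"
  shows "volcut n L \<ge> 3 * (real (card (tri (n - 1))) - real (zcount n (\<lambda>a b c. L a b c 0) z))"
proof -
  obtain k where n: "n = Suc (Suc k)" using that[of "n - 2"] n2 by simp
  let ?M = "\<lambda>A. {(a, b, c, d) \<in> quad (Suc k). mono4 A a b c d}"
  let ?M4 = "{(a, b, c, d) \<in> quad (Suc k). mono4 {l4, z} a b c d \<and> d > 0}"
  let ?F = "{(a, b, c, d) \<in> quad (Suc k). mono4 {l4, z} a b c d \<and> d = 0}"
  define Z1 Z2 Z3 Z4 where "Z1 = {(a, b, c, d) \<in> quad k. mono4 {l1} (Suc a) b c d}"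
    and "Z2 = {(a, b, c, d) \<in> quad k. mono4 {l2} a (Suc b) c d}"
    and "Z3 = {(a, b, c, d) \<in> quad k. mono4 {l3} a b (Suc c) d}"
    and "Z4 = {(a, b, c, d) \<in> quad k. mono4 {l4, z} a b c (Suc d)}"
  have fin: "finite Z1" "finite Z2" "finite Z3" "finite Z4" "finite (?M A)" "finite ?M4" "finite ?F" for A
    unfolding Z1_def Z2_def Z3_def Z4_def
    by (rule finite_subset[OF _ finite_quad[of k]] finite_subset[OF _ finite_quad[of "Suc k"]]; auto)+
  have 1: "card (?M {l1}) \<le> card Z1"
  proof (rule card_inj_on_le[where f = "\<lambda>(a, b, c, d). (a - 1, b, c, d)"])
    have pos: "a > 0" if "(a, b, c, d) \<in> ?M {l1}" for a b c d
      using supp1[of a "Suc b" c d] that n by (auto simp: mono4_def)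
    show "inj_on (\<lambda>(a, b, c, d). (a - 1, b, c, d)) (?M {l1})"
      using pos by (fastforce simp: inj_on_def)
    show "(\<lambda>(a, b, c, d). (a - 1, b, c, d)) ` ?M {l1} \<subseteq> Z1"
      using pos by (fastforce simp: Z1_def)
  qed (rule fin)
  have 2: "card (?M {l2}) \<le> card Z2"
  proof (rule card_inj_on_le[where f = "\<lambda>(a, b, c, d). (a, b - 1, c, d)"])
    have pos: "b > 0" if "(a, b, c, d) \<in> ?M {l2}" for a b c d
      using supp2[of "Suc a" b c d] that n by (auto simp: mono4_def)
    show "inj_on (\<lambda>(a, b, c, d). (a, b - 1, c, d)) (?M {l2})"
      using pos by (fastforce simp: inj_on_def)
    show "(\<lambda>(a, b, c, d). (a, b - 1, c, d)) ` ?M {l2} \<subseteq> Z2"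
      using pos by (fastforce simp: Z2_def)
  qed (rule fin)
  have 3: "card (?M {l3}) \<le> card Z3"
  proof (rule card_inj_on_le[where f = "\<lambda>(a, b, c, d). (a, b, c - 1, d)"])
    have pos: "c > 0" if "(a, b, c, d) \<in> ?M {l3}" for a b c d
      using supp3[of "Suc a" b c d] that n by (auto simp: mono4_def)
    show "inj_on (\<lambda>(a, b, c, d). (a, b, c - 1, d)) (?M {l3})"
      using pos by (fastforce simp: inj_on_def)
    show "(\<lambda>(a, b, c, d). (a, b, c - 1, d)) ` ?M {l3} \<subseteq> Z3"
      using pos by (fastforce simp: Z3_def)
  qed (rule fin)
  have 4: "card ?M4 \<le> card Z4"
  proof (rule card_inj_on_le[where f = "\<lambda>(a, b, c, d). (a, b, c, d - 1)"])
    show "inj_on (\<lambda>(a, b, c, d). (a, b, c, d - 1)) ?M4" by (fastforce simp: inj_on_def)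
    show "(\<lambda>(a, b, c, d). (a, b, c, d - 1)) ` ?M4 \<subseteq> Z4" by (fastforce simp: Z4_def)
  qed (rule fin)
  \<comment> \<open>These are the simplices that the injection cannot lower. On the face
    \<open>d = 0\<close> the label \<open>l4\<close> does not occur, so three of their vertices form
    a triangle with all labels \<open>z\<close>.\<close>
  have 5: "card ?F \<le> zcount n (\<lambda>a b c. L a b c 0) z"
    unfolding zcount_def
  proof (rule card_inj_on_le[where f = "\<lambda>(a, b, c, d). (a, b, c)"])
    show "inj_on (\<lambda>(a, b, c, d). (a, b, c)) ?F" by (auto simp: inj_on_def)
    have "a + b + c = n - 1 \<and> mono3 (\<lambda>a b c. L a b c 0) {z} a b c"
      if "a + b + c = Suc k" "mono4 {l4, z} a b c 0" for a b c
      using that n supp4[of "Suc a" b c 0] supp4[of a "Suc b" c 0] supp4[of a b "Suc c" 0]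
      by (auto simp: mono4_def mono3_def)
    then show "(\<lambda>(a, b, c, d). (a, b, c)) ` ?F \<subseteq> {(a, b, c) \<in> tri (n - 1). mono3 (\<lambda>a b c. L a b c 0) {z} a b c}"
      by auto
  qed (rule finite_subset[OF _ finite_tri[of "n - 1"]], auto)
  define M where "M = ?M {l1} \<union> ?M {l2} \<union> ?M {l3} \<union> ?M4 \<union> ?F"
  have finM: "finite M" unfolding M_def using fin by simp
  have "card M \<le> card (?M {l1}) + card (?M {l2}) + card (?M {l3}) + card ?M4 + card ?F"
    unfolding M_def
    using card_Un_le[of "?M {l1} \<union> ?M {l2} \<union> ?M {l3} \<union> ?M4" ?F] card_Un_le[of "?M {l1} \<union> ?M {l2} \<union> ?M {l3}" ?M4]
      card_Un_le[of "?M {l1} \<union> ?M {l2}" "?M {l3}"] card_Un_le[of "?M {l1}" "?M {l2}"] by linarith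
  also have "\<dots> \<le> (card Z1 + card Z2 + card Z3 + card Z4) + zcount n (\<lambda>a b c. L a b c 0) z"
    using 1 2 3 4 5 by linarith
  also have "card Z1 + card Z2 + card Z3 + card Z4 = card (Z1 \<union> Z2 \<union> Z3 \<union> Z4)"
  proof -
    have no_common:
      "\<not> (mono4 A (Suc a) b c d \<and> mono4 B a (Suc b) c d)" "\<not> (mono4 A (Suc a) b c d \<and> mono4 B a b (Suc c) d)"
      "\<not> (mono4 A (Suc a) b c d \<and> mono4 B a b c (Suc d))" "\<not> (mono4 A a (Suc b) c d \<and> mono4 B a b (Suc c) d)"
      "\<not> (mono4 A a (Suc b) c d \<and> mono4 B a b c (Suc d))" "\<not> (mono4 A a b (Suc c) d \<and> mono4 B a b c (Suc d))"
      if "A \<inter> B = {}" for A B a b c d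
      using that by (auto simp: mono4_def)
    have ne: "{l1} \<inter> {l2} = {}" "{l1} \<inter> {l3} = {}" "{l2} \<inter> {l3} = {}" "{l1} \<inter> {l4, z} = {}"
      "{l2} \<inter> {l4, z} = {}" "{l3} \<inter> {l4, z} = {}" using distinct by auto
    have "Z1 \<inter> Z2 = {}" using no_common(1)[OF ne(1)] unfolding Z1_def Z2_def by auto
    moreover have "Z1 \<inter> Z3 = {}" using no_common(2)[OF ne(2)] unfolding Z1_def Z3_def by auto
    moreover have "Z2 \<inter> Z3 = {}" using no_common(4)[OF ne(3)] unfolding Z2_def Z3_def by auto
    moreover have "Z1 \<inter> Z4 = {}" using no_common(3)[OF ne(4)] unfolding Z1_def Z4_def by auto
    moreover have "Z2 \<inter> Z4 = {}" using no_common(5)[OF ne(5)] unfolding Z2_def Z4_def by auto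
    moreover have "Z3 \<inter> Z4 = {}" using no_common(6)[OF ne(6)] unfolding Z3_def Z4_def by auto
    ultimately have "Z1 \<inter> Z2 = {}" "(Z1 \<union> Z2) \<inter> Z3 = {}" "(Z1 \<union> Z2 \<union> Z3) \<inter> Z4 = {}" by blast+
    then show ?thesis using fin by (simp add: card_Un_disjoint)
  qed
  also have "\<dots> \<le> card (quad k)"
    by (intro card_mono) (auto simp: Z1_def Z2_def Z3_def Z4_def)
  finally have cM: "card M \<le> card (quad k) + zcount n (\<lambda>a b c. L a b c 0) z" by simp
  have "3 * real (card (quad (Suc k) - M)) = (\<Sum>(a, b, c, d)\<in>quad (Suc k) - M. 3)" by (simp add: case_prod_unfold)
  also have "\<dots> \<le> (\<Sum>(a, b, c, d)\<in>quad (Suc k) - M.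
     cut4 (L (Suc a) b c d) (L a (Suc b) c d) (L a b (Suc c) d) (L a b c (Suc d)))"
  proof -
    have "3 \<le> cut4 (L (Suc a) b c d) (L a (Suc b) c d) (L a b (Suc c) d) (L a b c (Suc d))"
      if *: "(a, b, c, d) \<in> quad (Suc k)" "(a, b, c, d) \<notin> M" for a b c d
    proof (rule cut4_ge_3)
      have "L (Suc a) b c d \<in> {l1, l2, l3, l4, z}" using * n range[of "Suc a" b c d] by simp
      then have "mono4 {l1} a b c d \<or> mono4 {l2} a b c d \<or> mono4 {l3} a b c d \<or> mono4 {l4, z} a b c d"
        if "mono4 {L (Suc a) b c d} a b c d"
        using that unfolding mono4_def by (elim insertE emptyE) simp_all
      then have "\<not> mono4 {L (Suc a) b c d} a b c d" using * unfolding M_def by auto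
      then show "\<not> (L (Suc a) b c d = L a (Suc b) c d \<and> L a (Suc b) c d = L a b (Suc c) d
          \<and> L a b (Suc c) d = L a b c (Suc d))"
        unfolding mono4_def singleton_iff by metis
    qed
    then show ?thesis by (intro sum_mono) auto
  qed
  also have "\<dots> \<le> volcut n L"
    unfolding volcut_def n by (rule sum_mono2) (auto simp: cut4_nonneg)
  finally have "3 * real (card (quad (Suc k) - M)) \<le> volcut n L" .
  moreover have "card (quad (Suc k)) \<le> card (quad (Suc k) - M) + card M"
    using diff_card_le_card_Diff[OF finM, of "quad (Suc k)"] by linarith
  ultimately show ?thesis
    using cM card_quad_Suc[of k] n by simp
qed

lemma volcut_ge_faces:
  assumes "n \<ge> 2"
  shows "volcut n L \<ge> 3 * (real (card (tri (n - 1))) - real (zcount n (\<lambda>a b c. L a b c 0) z))"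
    "volcut n L \<ge> 3 * (real (card (tri (n - 1))) - real (zcount n (\<lambda>a b c. L a b 0 c) z))"
    "volcut n L \<ge> 3 * (real (card (tri (n - 1))) - real (zcount n (\<lambda>a b c. L a 0 b c) z))"
    "volcut n L \<ge> 3 * (real (card (tri (n - 1))) - real (zcount n (\<lambda>a b c. L 0 a b c) z))"
  using volcut_ge_face[OF assms] labelling4.volcut_ge_face[OF perm_1243 assms]
    labelling4.volcut_ge_face[OF perm_1342 assms] labelling4.volcut_ge_face[OF perm_2341 assms]
  by (simp_all only: volcut_perms[of n L])

end

context face begin

lemma zcount_le_side12:
  assumes "\<And>a b. a + b = n \<Longrightarrow> g a b 0 \<noteq> z"
  shows "real (zcount n g z) \<le> 9 / 4 * real q * (facecut q g - 2 * real n) + 2 * real n"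
proof (rule zcount_le_extra)
  fix a b assume "a + b = n"
  then show "g a b 0 \<in> {l1, l2}"
    using range[of a b 0] supp3[of a b 0] assms[of a b] by auto
qed

lemma zcount_le_side13:
  assumes "\<And>a c. a + c = n \<Longrightarrow> g a 0 c \<noteq> z"
  shows "real (zcount n g z) \<le> 9 / 4 * real q * (facecut q g - 2 * real n) + 2 * real n"
proof -
  interpret s: face n "\<lambda>a b c. g a c b" l1 l3 l2 z q by (rule face_swap23)
  show ?thesis
    using s.zcount_le_side12 assms facecut_swap23[OF q_ge, of g] zcount_swap23[of n g z] by simp
qed

lemma zcount_le_side23:
  assumes "\<And>b c. b + c = n \<Longrightarrow> g 0 b c \<noteq> z"
  shows "real (zcount n g z) \<le> 9 / 4 * real q * (facecut q g - 2 * real n) + 2 * real n"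
proof -
  interpret s: face n "\<lambda>a b c. g b a c" l2 l1 l3 z q by (rule face_swap12)
  show ?thesis
    using s.zcount_le_side13 assms facecut_swap12[OF q_ge, of g] zcount_swap12[of n g z] by simp
qed

lemma facecut_ge_2n: "facecut q g \<ge> 2 * real n"
  using facecut_ge slack_sums_nonneg by linarith

end

section \<open>The combined instance and its lower bound\<close>

definition facesum :: "((nat \<Rightarrow> nat \<Rightarrow> nat \<Rightarrow> nat) \<Rightarrow> real) \<Rightarrow> labelling4 \<Rightarrow> real" where
  "facesum F L = F (\<lambda>a b c. L a b c 0) + F (\<lambda>a b c. L a b 0 c) + F (\<lambda>a b c. L a 0 b c) + F (\<lambda>a b c. L 0 a b c)"

definition sidecut :: "nat \<Rightarrow> labelling4 \<Rightarrow> real" where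
  "sidecut n L = pathcut (\<lambda>t. L (n - t) t 0 0) n + pathcut (\<lambda>t. L (n - t) 0 t 0) n
     + pathcut (\<lambda>t. L (n - t) 0 0 t) n + pathcut (\<lambda>t. L 0 (n - t) t 0) n
     + pathcut (\<lambda>t. L 0 (n - t) 0 t) n + pathcut (\<lambda>t. L 0 0 (n - t) t) n"

definition corners :: "nat \<Rightarrow> nat \<Rightarrow> (nat \<Rightarrow> nat \<Rightarrow> nat \<Rightarrow> nat) \<Rightarrow> real" where
  "corners n m g = cornercut n m (\<lambda>u v w. g u v w) + cornercut n m (\<lambda>u v w. g v u w)
     + cornercut n m (\<lambda>u v w. g v w u)"

text \<open>The weights are those which make the bounds for cuts in which all six sides contain the label \<open>5\<close>,
  and for cuts in which some side does not, agree up to lower order terms.\<close>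

definition totalcut :: "nat \<Rightarrow> nat \<Rightarrow> labelling4 \<Rightarrow> real" where
  "totalcut q m L = 9 / 8 * real (3 * q) * facesum (facecut q) L
     + ((real (3 * q))\<^sup>2 / 4 - 3 / 4 * (real m)\<^sup>2) * sidecut (3 * q) L
     + 3 / 16 * real (m * (m + 1)) * facesum (corners (3 * q) m) L
     + volcut (3 * q) L"

locale grid_cut = labelling4 n L 1 2 3 4 5 for n L +
  fixes q :: nat
  assumes n_eq: "n = 3 * q" and q_ge: "q \<ge> 2"
    and term1: "L n 0 0 0 = 1" and term2: "L 0 n 0 0 = 2"
    and term3: "L 0 0 n 0 = 3" and term4: "L 0 0 0 n = 4"
begin

lemma face4: "face n (\<lambda>a b c. L a b c 0) 1 2 3 5 q"
proof
  fix a b c assume "a + b + c = n"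
  then have n: "a + b + c + 0 = n" by simp
  show "L a b c 0 \<in> {1, 2, 3, 5}" using range[OF n] supp4[OF n] by auto
  show "0 < a" if "L a b c 0 = 1" using supp1[OF n that] .
  show "0 < b" if "L a b c 0 = 2" using supp2[OF n that] .
  show "0 < c" if "L a b c 0 = 3" using supp3[OF n that] .
qed (use n_eq q_ge term1 term2 term3 term4 in auto)

lemma face3: "face n (\<lambda>a b c. L a b 0 c) 1 2 4 5 q"
proof
  fix a b c assume "a + b + c = n"
  then have n: "a + b + 0 + c = n" by simp
  show "L a b 0 c \<in> {1, 2, 4, 5}" using range[OF n] supp3[OF n] by auto
  show "0 < a" if "L a b 0 c = 1" using supp1[OF n that] .
  show "0 < b" if "L a b 0 c = 2" using supp2[OF n that] .
  show "0 < c" if "L a b 0 c = 4" using supp4[OF n that] .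
qed (use n_eq q_ge term1 term2 term3 term4 in auto)

lemma face2: "face n (\<lambda>a b c. L a 0 b c) 1 3 4 5 q"
proof
  fix a b c assume "a + b + c = n"
  then have n: "a + 0 + b + c = n" by simp
  show "L a 0 b c \<in> {1, 3, 4, 5}" using range[OF n] supp2[OF n] by auto
  show "0 < a" if "L a 0 b c = 1" using supp1[OF n that] .
  show "0 < b" if "L a 0 b c = 3" using supp3[OF n that] .
  show "0 < c" if "L a 0 b c = 4" using supp4[OF n that] .
qed (use n_eq q_ge term1 term2 term3 term4 in auto)

lemma face1: "face n (\<lambda>a b c. L 0 a b c) 2 3 4 5 q"
proof
  fix a b c assume "a + b + c = n"
  then have n: "0 + a + b + c = n" by simp
  show "L 0 a b c \<in> {2, 3, 4, 5}" using range[OF n] supp1[OF n] by auto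
  show "0 < a" if "L 0 a b c = 2" using supp2[OF n that] .
  show "0 < b" if "L 0 a b c = 3" using supp3[OF n that] .
  show "0 < c" if "L 0 a b c = 4" using supp4[OF n that] .
qed (use n_eq q_ge term1 term2 term3 term4 in auto)

lemma pathcut_ends: "f 0 \<noteq> f N \<Longrightarrow> pathcut f N \<ge> 1"
  using pathcut_ge[of f N] by (simp add: cut_def)

lemma pathcut_mid: "t \<le> N \<Longrightarrow> f t = 5 \<Longrightarrow> f 0 \<noteq> 5 \<Longrightarrow> f N \<noteq> 5 \<Longrightarrow> pathcut f N \<ge> 2"
  using pathcut_ge2[of t N f] by (simp add: cut_def)

lemma sidecut_ge_6: "sidecut n L \<ge> 6"
proof -
  have "pathcut (\<lambda>t. L (n - t) t 0 0) n \<ge> 1" "pathcut (\<lambda>t. L (n - t) 0 t 0) n \<ge> 1"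
    "pathcut (\<lambda>t. L (n - t) 0 0 t) n \<ge> 1" "pathcut (\<lambda>t. L 0 (n - t) t 0) n \<ge> 1"
    "pathcut (\<lambda>t. L 0 (n - t) 0 t) n \<ge> 1" "pathcut (\<lambda>t. L 0 0 (n - t) t) n \<ge> 1"
    using term1 term2 term3 term4 by (intro pathcut_ends; simp)+
  then show ?thesis unfolding sidecut_def by linarith
qed

lemma sidecut_ge_12:
  assumes "\<exists>a b. a + b = n \<and> L a b 0 0 = 5" "\<exists>a b. a + b = n \<and> L a 0 b 0 = 5"
    "\<exists>a b. a + b = n \<and> L a 0 0 b = 5" "\<exists>a b. a + b = n \<and> L 0 a b 0 = 5"
    "\<exists>a b. a + b = n \<and> L 0 a 0 b = 5" "\<exists>a b. a + b = n \<and> L 0 0 a b = 5"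
  shows "sidecut n L \<ge> 12"
proof -
  have mid: "pathcut (\<lambda>t. h (n - t) t) n \<ge> 2"
    if "\<exists>a b. a + b = n \<and> h a b = 5" "h n 0 \<noteq> 5" "h 0 n \<noteq> 5" for h :: "nat \<Rightarrow> nat \<Rightarrow> nat"
  proof -
    from that(1) obtain a b where "a + b = n" "h a b = 5" by auto
    moreover from this have "n - b = a" by simp
    ultimately show ?thesis using that(2,3) by (intro pathcut_mid[of b]) auto
  qed
  have "pathcut (\<lambda>t. L (n - t) t 0 0) n \<ge> 2" "pathcut (\<lambda>t. L (n - t) 0 t 0) n \<ge> 2"
    "pathcut (\<lambda>t. L (n - t) 0 0 t) n \<ge> 2" "pathcut (\<lambda>t. L 0 (n - t) t 0) n \<ge> 2"
    "pathcut (\<lambda>t. L 0 (n - t) 0 t) n \<ge> 2" "pathcut (\<lambda>t. L 0 0 (n - t) t) n \<ge> 2"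
    using mid[of "\<lambda>a b. L a b 0 0"] mid[of "\<lambda>a b. L a 0 b 0"] mid[of "\<lambda>a b. L a 0 0 b"]
      mid[of "\<lambda>a b. L 0 a b 0"] mid[of "\<lambda>a b. L 0 a 0 b"] mid[of "\<lambda>a b. L 0 0 a b"]
      assms term1 term2 term3 term4 by simp_all
  then show ?thesis unfolding sidecut_def by linarith
qed

abbreviation "T \<equiv> real (card (tri (n - 1)))"
abbreviation "ok g \<equiv> real (zcount n g 5) \<le> 9 / 4 * real q * (facecut q g - 2 * real n) + 2 * real n"

lemma card_T: "T = (real n)\<^sup>2 / 2 + real n / 2"
proof -
  have "2 * card (tri (n - 1)) = n * (n + 1)" using card_tri[of "n - 1"] n_eq q_ge by simp
  then have "2 * T = real (n * (n + 1))" by (metis of_nat_mult of_nat_numeral)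
  then show ?thesis by (simp add: power2_eq_square field_simps)
qed

lemma corners_nonneg: "facesum (corners n m) L \<ge> 0"
  by (simp add: facesum_def corners_def cornercut_nonneg)

text \<open>Averaging the two bounds on \<open>volcut\<close> loses \<open>3 / 2\<close> of the
  joint area of the label 5. By \<open>ok\<close>, and because \<open>n = 3 * q\<close>, each area
  is at most \<open>3 / 4 * n\<close> times the excess of the face, up to \<open>2 * n\<close>. The
  weight \<open>9 / 8 = 3 / 2 * 3 / 4\<close> of the faces is chosen so that the excesses
  cancel.\<close>

lemma volcut_facecut_two:
  assumes "ok f" "ok g" "volcut n L \<ge> 3 * (T - real (zcount n f 5))" "volcut n L \<ge> 3 * (T - real (zcount n g 5))"
  shows "volcut n L + 9 / 8 * real n * (facecut q f + facecut q g) \<ge> 3 * T - 6 * real n + 9 / 2 * (real n)\<^sup>2"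
proof -
  have "real (zcount n f 5) + real (zcount n g 5)
      \<le> 9 / 4 * real q * (facecut q f + facecut q g) - 9 * real q * real n + 4 * real n"
  proof -
    have eq: "9 / 4 * real q * (x - 2 * real n) = 9 / 4 * (real q * x) - 9 / 2 * (real q * real n)" for x
      by (simp add: field_simps)
    have "9 / 4 * real q * (facecut q f + facecut q g) = 9 / 4 * (real q * facecut q f) + 9 / 4 * (real q * facecut q g)"
      by (simp add: field_simps)
    then show ?thesis using assms(1,2) unfolding eq by argo
  qed
  moreover have "9 / 4 * real q * (facecut q f + facecut q g) = 3 / 4 * (real n * (facecut q f + facecut q g))"
    "9 * real q * real n = 3 * (real n)\<^sup>2"
    using n_eq by (simp_all add: power2_eq_square)
  moreover have "9 / 8 * real n * (facecut q f + facecut q g) = 9 / 8 * (real n * (facecut q f + facecut q g))"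
    by simp
  ultimately show ?thesis using assms(3,4) by argo
qed

theorem totalcut_ge:
  assumes m: "1 \<le> m" "m \<le> q"
  shows "totalcut q m L \<ge> 12 * (real n)\<^sup>2 - 9 / 2 * (real m)\<^sup>2 - 9 / 2 * real n"
proof -
  interpret f4: face n "\<lambda>a b c. L a b c 0" 1 2 3 5 q by (rule face4)
  interpret f3: face n "\<lambda>a b c. L a b 0 c" 1 2 4 5 q by (rule face3)
  interpret f2: face n "\<lambda>a b c. L a 0 b c" 1 3 4 5 q by (rule face2)
  interpret f1: face n "\<lambda>a b c. L 0 a b c" 2 3 4 5 q by (rule face1)
  define J4 J3 J2 J1 where "J4 = facecut q (\<lambda>a b c. L a b c 0)" and "J3 = facecut q (\<lambda>a b c. L a b 0 c)"
    and "J2 = facecut q (\<lambda>a b c. L a 0 b c)" and "J1 = facecut q (\<lambda>a b c. L 0 a b c)"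
  define Z4 Z3 Z2 Z1 where "Z4 = real (zcount n (\<lambda>a b c. L a b c 0) 5)" and "Z3 = real (zcount n (\<lambda>a b c. L a b 0 c) 5)"
    and "Z2 = real (zcount n (\<lambda>a b c. L a 0 b c) 5)" and "Z1 = real (zcount n (\<lambda>a b c. L 0 a b c) 5)"
  note defs = J4_def J3_def J2_def J1_def Z4_def Z3_def Z2_def Z1_def
  define w where "w = (real n)\<^sup>2 / 4 - 3 / 4 * (real m)\<^sup>2"
  have total: "totalcut q m L = 9 / 8 * real n * (J4 + J3 + J2 + J1) + w * sidecut n L
     + 3 / 16 * real (m * (m + 1)) * facesum (corners n m) L + volcut n L"
    unfolding totalcut_def n_eq[symmetric] w_def by (simp add: facesum_def defs)
  have J: "J4 \<ge> 2 * real n" "J3 \<ge> 2 * real n" "J2 \<ge> 2 * real n" "J1 \<ge> 2 * real n"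
    unfolding defs using f4.facecut_ge_2n f3.facecut_ge_2n f2.facecut_ge_2n f1.facecut_ge_2n by auto
  have n2: "n \<ge> 2" using n_eq q_ge by simp
  note vol = volcut_ge_faces[OF n2, folded defs]
  have "(real m)\<^sup>2 \<le> (real q)\<^sup>2" using m by (intro power_mono) auto
  moreover have "(real n)\<^sup>2 = 9 * (real q)\<^sup>2" using n_eq by (simp add: power_mult_distrib)
  ultimately have w: "w \<ge> 0" unfolding w_def using zero_le_power2[of "real q"] by linarith
  have c0: "3 / 16 * real (m * (m + 1)) * facesum (corners n m) L \<ge> 0"
    using corners_nonneg by simp
  \<comment> \<open>This serves the cuts for which some side avoids the label 5: \<open>A\<close>
    and \<open>B\<close> are the costs of the two faces containing that side. The other two faces
    and the six sides enter only with their minimal costs.\<close>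
  have nonfrag: ?thesis
    if "volcut n L + 9 / 8 * real n * (A + B) \<ge> 3 * T - 6 * real n + 9 / 2 * (real n)\<^sup>2"
      "A + B + C + D = J4 + J3 + J2 + J1" "C \<ge> 2 * real n" "D \<ge> 2 * real n" for A B C D
  proof -
    have "9 / 8 * real n * (J4 + J3 + J2 + J1) = 9 / 8 * real n * (A + B) + 9 / 8 * (real n * (C + D))"
      unfolding that(2)[symmetric] by (simp only: distrib_left mult.assoc add.assoc)
    moreover have "real n * (C + D) \<ge> real n * (4 * real n)" using that by (intro mult_left_mono) auto
    moreover have "real n * (4 * real n) = 4 * (real n)\<^sup>2" by (simp add: power2_eq_square)
    moreover have "w * sidecut n L \<ge> w * 6" using sidecut_ge_6 w by (intro mult_left_mono) auto
    ultimately show ?thesis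
      using total c0 that(1) card_T unfolding w_def by argo
  qed
  consider "\<And>a b. a + b = n \<Longrightarrow> L a b 0 0 \<noteq> 5" | "\<And>a b. a + b = n \<Longrightarrow> L a 0 b 0 \<noteq> 5"
    | "\<And>a b. a + b = n \<Longrightarrow> L a 0 0 b \<noteq> 5" | "\<And>a b. a + b = n \<Longrightarrow> L 0 a b 0 \<noteq> 5"
    | "\<And>a b. a + b = n \<Longrightarrow> L 0 a 0 b \<noteq> 5" | "\<And>a b. a + b = n \<Longrightarrow> L 0 0 a b \<noteq> 5"
    | "sidecut n L \<ge> 12"
    using sidecut_ge_12 by blast
  then show ?thesis
  proof cases
    case 1
    have "ok (\<lambda>a b c. L a b c 0)" "ok (\<lambda>a b c. L a b 0 c)"
      by (rule f4.zcount_le_side12, fact 1, rule f3.zcount_le_side12, fact 1)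
    from volcut_facecut_two[OF this, folded defs, OF vol(1,2)]
    show ?thesis by (rule nonfrag[of J4 J3 J2 J1]) (use J in auto)
  next
    case 2
    have "ok (\<lambda>a b c. L a b c 0)" "ok (\<lambda>a b c. L a 0 b c)"
      by (rule f4.zcount_le_side13, fact 2, rule f2.zcount_le_side12, fact 2)
    from volcut_facecut_two[OF this, folded defs, OF vol(1,3)]
    show ?thesis by (rule nonfrag[of J4 J2 J3 J1]) (use J in auto)
  next
    case 3
    have "ok (\<lambda>a b c. L a b 0 c)" "ok (\<lambda>a b c. L a 0 b c)"
      by (rule f3.zcount_le_side13, fact 3, rule f2.zcount_le_side13, fact 3)
    from volcut_facecut_two[OF this, folded defs, OF vol(2,3)]
    show ?thesis by (rule nonfrag[of J3 J2 J4 J1]) (use J in auto)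
  next
    case 4
    have "ok (\<lambda>a b c. L a b c 0)" "ok (\<lambda>a b c. L 0 a b c)"
      by (rule f4.zcount_le_side23, fact 4, rule f1.zcount_le_side12, fact 4)
    from volcut_facecut_two[OF this, folded defs, OF vol(1,4)]
    show ?thesis by (rule nonfrag[of J4 J1 J3 J2]) (use J in auto)
  next
    case 5
    have "ok (\<lambda>a b c. L a b 0 c)" "ok (\<lambda>a b c. L 0 a b c)"
      by (rule f3.zcount_le_side23, fact 5, rule f1.zcount_le_side13, fact 5)
    from volcut_facecut_two[OF this, folded defs, OF vol(2,4)]
    show ?thesis by (rule nonfrag[of J3 J1 J4 J2]) (use J in auto)
  next
    case 6
    have "ok (\<lambda>a b c. L a 0 b c)" "ok (\<lambda>a b c. L 0 a b c)"
      by (rule f2.zcount_le_side23, fact 6, rule f1.zcount_le_side23, fact 6)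
    from volcut_facecut_two[OF this, folded defs, OF vol(3,4)]
    show ?thesis by (rule nonfrag[of J2 J1 J4 J3]) (use J in auto)
  next
    case 7
    let ?c = "corners n m"
    define M where "M = real (m * (m + 1))"
    define E where "E = J4 + J3 + J2 + J1 - 8 * real n"
    have bal: "T - Z + 1 / 2 * (real m * (x - 2 * real n)) + 1 / 4 * (M * c) \<ge> 3 / 2 * M"
      if "T - Z + real m / 2 * (x - 2 * real n) + real (m * (m + 1)) / 4 * c \<ge> 3 * (real (m * (m + 1)) / 2)" for Z x c
      using that unfolding M_def by simp
    note bals = bal[OF f4.face_balance[OF m, folded corners_def defs]] bal[OF f3.face_balance[OF m, folded corners_def defs]]
      bal[OF f2.face_balance[OF m, folded corners_def defs]] bal[OF f1.face_balance[OF m, folded corners_def defs]]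
    have "real m * E = real m * (J4 - 2 * real n) + real m * (J3 - 2 * real n) + real m * (J2 - 2 * real n)
        + real m * (J1 - 2 * real n)"
      unfolding E_def by (simp add: algebra_simps)
    moreover have "M * facesum ?c L = M * ?c (\<lambda>a b c. L a b c 0) + M * ?c (\<lambda>a b c. L a b 0 c)
        + M * ?c (\<lambda>a b c. L a 0 b c) + M * ?c (\<lambda>a b c. L 0 a b c)"
      unfolding facesum_def by (simp add: distrib_left)
    \<comment> \<open>The four bounds in \<open>vol\<close> are averaged and each is combined with
      the balance of its face, that is, the balances enter with the factor \<open>3 / 4\<close>.
      This is the origin of the weight \<open>3 / 16 = 3 / 4 * 1 / 4\<close> of the corner
      triangles.\<close>
    ultimately have "9 / 2 * M \<le> volcut n L + 3 / 8 * (real m * E) + 3 / 16 * (M * facesum ?c L)"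
      using bals vol unfolding right_diff_distrib[of 3] by linarith
    moreover have "real m * E \<le> real n * E"
      using m n_eq J unfolding E_def by (intro mult_right_mono) auto
    moreover have "real n * E \<ge> 0" using J unfolding E_def by (intro mult_nonneg_nonneg) auto
    ultimately have "9 / 2 * M \<le> volcut n L + 9 / 8 * (real n * E) + 3 / 16 * (M * facesum ?c L)"
      by linarith
    moreover have "9 / 8 * real n * (J4 + J3 + J2 + J1) = 9 / 8 * (real n * E) + 9 * (real n)\<^sup>2"
      unfolding E_def by (simp add: power2_eq_square algebra_simps)
    \<comment> \<open>Twelve cuts on the sides lose \<open>9 * m^2\<close> through the lowered side
      weight, and \<open>9 / 2 * M\<close> returns half of it. The result has the same leading terms
      as in the other cases.\<close>
    moreover have "w * sidecut n L \<ge> w * 12" using 7 w by (intro mult_left_mono) auto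
    moreover have "M = (real m)\<^sup>2 + real m" unfolding M_def by (simp add: power2_eq_square algebra_simps)
    moreover have "w * 12 = 3 * (real n)\<^sup>2 - 9 * (real m)\<^sup>2" unfolding w_def by simp
    moreover have "totalcut q m L = 9 / 8 * real n * (J4 + J3 + J2 + J1) + w * sidecut n L
        + 3 / 16 * (M * facesum ?c L) + volcut n L"
      using total unfolding M_def by simp
    moreover have "real n \<ge> 0" "real m \<ge> 0" by simp_all
    ultimately show ?thesis by linarith
  qed
qed

end

subsection \<open>Total weight\<close>

lemma sum_tri_bool: "(\<Sum>(a, b, c)\<in>tri m. if Q a b c then 1 else 0 :: real) = real (card {(a, b, c) \<in> tri m. Q a b c})"
proof -
  have "{(a, b, c) \<in> tri m. Q a b c} = {x \<in> tri m. case x of (a, b, c) \<Rightarrow> Q a b c}" by auto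
  then show ?thesis by (simp add: sum.inter_filter[symmetric] case_prod_unfold flip: card_eq_sum)
qed

lemma card_tri_ge:
  assumes "i \<le> m"
  shows "card {(a, b, c) \<in> tri m. i \<le> a} = card (tri (m - i))"
  by (rule bij_betw_same_card[of "\<lambda>(a, b, c). (a - i, b, c)"],
      rule bij_betwI[of _ _ _ "\<lambda>(a, b, c). (a + i, b, c)"]) (use assms in auto)

lemma card_tri_eq:
  assumes "i \<le> m"
  shows "card {(a, b, c) \<in> tri m. a = i} = m - i + 1"
proof -
  have "card {(a, b, c) \<in> tri m. a = i} = card {..m - i}"
    by (rule bij_betw_same_card[of "\<lambda>(a, b, c). b"],
        rule bij_betwI[of _ _ _ "\<lambda>b. (i, b, m - i - b)"]) (use assms in auto)
  then show ?thesis by simp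
qed

definition facelength :: "nat \<Rightarrow> nat \<Rightarrow> nat \<Rightarrow> nat \<Rightarrow> real" where
  "facelength q a b c = (if 2 * q \<le> a \<or> 2 * q \<le> b \<or> 2 * q \<le> c then 0
     else if Suc a = 2 * q \<or> Suc b = 2 * q \<or> Suc c = 2 * q then 2 * real q + 3 else 3)"

text \<open>Together with \<open>facecut_ge_2n\<close> the leading term yields the gap of the
  two-dimensional instance: \<open>n * (2 * n) / (15 * q^2) = 6 / 5\<close>.\<close>

lemma sum_facelength:
  assumes "q \<ge> 2"
  shows "(\<Sum>(a, b, c)\<in>tri (3 * q - 1). facelength q a b c) = 15 * (real q)\<^sup>2 + 6 * real q"
proof -
  define A where "A (i::nat) = (if 2 * q \<le> i then 1 else 0 :: real)" for i
  define B where "B (i::nat) = (if i = 2 * q - 1 then 1 else 0 :: real)" for i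
  have len: "facelength q a b c = 3 - 3 * (A a + A b + A c) + 2 * real q * (B a + B b + B c)"
    if "a + b + c = 3 * q - 1" for a b c
    using that assms by (auto simp: facelength_def A_def B_def)
  have A: "(\<Sum>(a, b, c)\<in>tri (3 * q - 1). A a) = real (card (tri (q - 1)))"
    unfolding A_def sum_tri_bool using card_tri_ge[of "2 * q" "3 * q - 1"] assms by simp
  have B: "(\<Sum>(a, b, c)\<in>tri (3 * q - 1). B a) = real (q + 1)"
    unfolding B_def sum_tri_bool using card_tri_eq[of "2 * q - 1" "3 * q - 1"] assms by simp
  have perm: "(\<Sum>(a, b, c)\<in>tri m. F b) = (\<Sum>(a, b, c)\<in>tri m. F a)"
    "(\<Sum>(a, b, c)\<in>tri m. F c) = (\<Sum>(a, b, c)\<in>tri m. F a)" for F :: "nat \<Rightarrow> real" and m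
    using sum_tri_swap12[of "\<lambda>a b c. F a" m] sum_tri_swap23[of "\<lambda>a b c. F b" m]
      sum_tri_swap12[of "\<lambda>a b c. F b" m] by simp_all
  have "(\<Sum>(a, b, c)\<in>tri (3 * q - 1). facelength q a b c)
      = (\<Sum>(a, b, c)\<in>tri (3 * q - 1). 3 - 3 * (A a + A b + A c) + 2 * real q * (B a + B b + B c))"
    by (intro sum.cong refl) (auto simp: len)
  also have "\<dots> = 3 * real (card (tri (3 * q - 1)))
      - 3 * ((\<Sum>(a, b, c)\<in>tri (3 * q - 1). A a) + (\<Sum>(a, b, c)\<in>tri (3 * q - 1). A b) + (\<Sum>(a, b, c)\<in>tri (3 * q - 1). A c))
      + 2 * real q * ((\<Sum>(a, b, c)\<in>tri (3 * q - 1). B a) + (\<Sum>(a, b, c)\<in>tri (3 * q - 1). B b) + (\<Sum>(a, b, c)\<in>tri (3 * q - 1). B c))"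
    by (simp add: case_prod_unfold sum.distrib sum_subtractf sum_distrib_left[symmetric])
  also have "\<dots> = 3 * real (card (tri (3 * q - 1))) - 9 * real (card (tri (q - 1))) + 6 * real q * (real q + 1)"
    unfolding perm A B by simp
  also have "\<dots> = 15 * (real q)\<^sup>2 + 6 * real q"
  proof -
    have "2 * real (card (tri (3 * q - 1))) = real (3 * q) * (real (3 * q) + 1)"
      using arg_cong[OF card_tri[of "3 * q - 1"], of real] assms by (simp add: algebra_simps)
    moreover have "2 * real (card (tri (q - 1))) = real q * (real q + 1)"
      using arg_cong[OF card_tri[of "q - 1"], of real] assms by (simp add: algebra_simps)
    ultimately show ?thesis by (simp add: power2_eq_square algebra_simps)
  qed
  finally show ?thesis .
qed

text \<open>In \<open>exp_le M t F w\<close>, the functional \<open>F\<close> is a nonnegative combination of indicators of cut grid edges of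
  total weight \<open>w\<close>, and each edge is cut with probability at most \<open>t\<close>.\<close>

definition exp_le :: "'w measure \<Rightarrow> real \<Rightarrow> ('w \<Rightarrow> real) \<Rightarrow> real \<Rightarrow> bool" where
  "exp_le M t F w \<longleftrightarrow> integrable M F \<and> (\<integral>x. F x \<partial>M) \<le> w * t"

lemma exp_le_add: "exp_le M t F v \<Longrightarrow> exp_le M t G w \<Longrightarrow> exp_le M t (\<lambda>x. F x + G x) (v + w)"
  by (auto simp: exp_le_def distrib_right intro: add_mono)

lemma exp_le_cmult: "0 \<le> c \<Longrightarrow> exp_le M t F w \<Longrightarrow> exp_le M t (\<lambda>x. c * F x) (c * w)"
  by (auto simp: exp_le_def mult.assoc intro: mult_left_mono)

lemma exp_le_zero: "exp_le M t (\<lambda>x. 0) 0"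
  by (simp add: exp_le_def)

lemma exp_le_sum:
  "finite A \<Longrightarrow> (\<And>i. i \<in> A \<Longrightarrow> exp_le M t (F i) (w i)) \<Longrightarrow> exp_le M t (\<lambda>x. \<Sum>i\<in>A. F i x) (\<Sum>i\<in>A. w i)"
proof (induction A rule: finite_induct)
  case empty
  show ?case by (simp add: exp_le_zero)
next
  case (insert j A)
  then show ?case using exp_le_add[of M t "F j" "w j"] by simp
qed

lemma exp_le_sum_tri:
  assumes "\<And>a b c. a + b + c = m \<Longrightarrow> exp_le M t (\<lambda>x. F x a b c) (w a b c)"
  shows "exp_le M t (\<lambda>x. \<Sum>(a, b, c)\<in>tri m. F x a b c) (\<Sum>(a, b, c)\<in>tri m. w a b c)"
proof -
  have "exp_le M t (\<lambda>x. \<Sum>i\<in>tri m. (case i of (a, b, c) \<Rightarrow> F x a b c)) (\<Sum>i\<in>tri m. case i of (a, b, c) \<Rightarrow> w a b c)"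
    by (rule exp_le_sum) (use assms in auto)
  then show ?thesis .
qed

lemma exp_le_sum_quad:
  assumes "\<And>a b c d. a + b + c + d = m \<Longrightarrow> exp_le M t (\<lambda>x. F x a b c d) w"
  shows "exp_le M t (\<lambda>x. \<Sum>(a, b, c, d)\<in>quad m. F x a b c d) (real (card (quad m)) * w)"
proof -
  have "exp_le M t (\<lambda>x. \<Sum>i\<in>quad m. (case i of (a, b, c, d) \<Rightarrow> F x a b c d)) (\<Sum>i\<in>quad m. w)"
    by (rule exp_le_sum) (use assms in auto)
  then show ?thesis by simp
qed

lemma exp_le_pathcut:
  assumes "\<And>i. i < N \<Longrightarrow> exp_le M t (\<lambda>x. cut (f x i) (f x (Suc i))) 1"
  shows "exp_le M t (\<lambda>x. pathcut (f x) N) (real N)"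
  using exp_le_sum[of "{..<N}" M t "\<lambda>i x. cut (f x i) (f x (Suc i))" "\<lambda>_. 1"] assms
  by (simp add: pathcut_def)

section \<open>Expected cost of each part of the instance\<close>

definition face_edges :: "'w measure \<Rightarrow> real \<Rightarrow> nat \<Rightarrow> ('w \<Rightarrow> nat \<Rightarrow> nat \<Rightarrow> nat \<Rightarrow> nat) \<Rightarrow> bool" where
  "face_edges M t n f \<longleftrightarrow> (\<forall>a b c. a + b + c + 1 = n \<longrightarrow>
     exp_le M t (\<lambda>x. cut (f x (Suc a) b c) (f x a (Suc b) c)) 1 \<and>
     exp_le M t (\<lambda>x. cut (f x (Suc a) b c) (f x a b (Suc c))) 1 \<and>
     exp_le M t (\<lambda>x. cut (f x a (Suc b) c) (f x a b (Suc c))) 1)"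

lemma face_edgesD:
  assumes "face_edges M t n f" "a + b + c + 1 = n"
  shows "exp_le M t (\<lambda>x. cut (f x (Suc a) b c) (f x a (Suc b) c)) 1"
    "exp_le M t (\<lambda>x. cut (f x (Suc a) b c) (f x a b (Suc c))) 1"
    "exp_le M t (\<lambda>x. cut (f x a (Suc b) c) (f x a b (Suc c))) 1"
  using assms unfolding face_edges_def by blast+

lemma face_edges_swap12: "face_edges M t n f \<Longrightarrow> face_edges M t n (\<lambda>x a b c. f x b a c)"
proof -
  assume f: "face_edges M t n f"
  show "face_edges M t n (\<lambda>x a b c. f x b a c)"
    unfolding face_edges_def
  proof (intro allI impI conjI)
    fix a b c assume "a + b + c + 1 = n"
    then have *: "b + a + c + 1 = n" by simp
    show "exp_le M t (\<lambda>x. cut (f x b (Suc a) c) (f x (Suc b) a c)) 1"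
      "exp_le M t (\<lambda>x. cut (f x b (Suc a) c) (f x b a (Suc c))) 1"
      "exp_le M t (\<lambda>x. cut (f x (Suc b) a c) (f x b a (Suc c))) 1"
      using face_edgesD[OF f *] by (simp_all add: cut_commute)
  qed
qed

lemma face_edges_swap23: "face_edges M t n f \<Longrightarrow> face_edges M t n (\<lambda>x a b c. f x a c b)"
proof -
  assume f: "face_edges M t n f"
  show "face_edges M t n (\<lambda>x a b c. f x a c b)"
    unfolding face_edges_def
  proof (intro allI impI conjI)
    fix a b c assume "a + b + c + 1 = n"
    then have *: "a + c + b + 1 = n" by simp
    show "exp_le M t (\<lambda>x. cut (f x (Suc a) c b) (f x a c (Suc b))) 1"
      "exp_le M t (\<lambda>x. cut (f x (Suc a) c b) (f x a (Suc c) b)) 1"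
      "exp_le M t (\<lambda>x. cut (f x a c (Suc b)) (f x a (Suc c) b)) 1"
      using face_edgesD[OF f *] by (simp_all add: cut_commute)
  qed
qed

lemma exp_le_spokecut:
  assumes f: "face_edges M t (3 * q) h" and "s \<le> q" "q \<ge> 2"
  shows "exp_le M t (\<lambda>x. spokecut q (h x) s) (real q + 1)"
proof -
  have "exp_le M t (\<lambda>x. pathcut (spoke q (h x) s) (Suc q)) (real (Suc q))"
  proof (rule exp_le_pathcut)
    fix i assume i: "i < Suc q"
    have e: "3 * q - i = Suc (3 * q - Suc i)" using i assms by simp
    show "exp_le M t (\<lambda>x. cut (spoke q (h x) s i) (spoke q (h x) s (Suc i))) 1"
    proof (cases "i < s")
      case True
      then have "spoke q (h x) s i = h x (Suc (3 * q - Suc i)) 0 i"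
        "spoke q (h x) s (Suc i) = h x (3 * q - Suc i) 0 (Suc i)" for x
        using e by (simp_all add: spoke_def min_absorb1)
      moreover have "3 * q - Suc i + 0 + i + 1 = 3 * q" using i assms by simp
      ultimately show ?thesis using face_edgesD(2)[OF f] by simp
    next
      case False
      then have "spoke q (h x) s i = h x (Suc (3 * q - Suc i)) (i - s) s"
        "spoke q (h x) s (Suc i) = h x (3 * q - Suc i) (Suc (i - s)) s" for x
        using e by (simp_all add: spoke_def min_absorb2 Suc_diff_le)
      moreover have "3 * q - Suc i + (i - s) + s + 1 = 3 * q" using False i assms by simp
      ultimately show ?thesis using face_edgesD(1)[OF f] by simp
    qed
  qed
  then show ?thesis by (simp add: spokecut_def add.commute)
qed

lemma exp_le_facecut:
  assumes f: "face_edges M t (3 * q) f" and q: "q \<ge> 2"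
  shows "exp_le M t (\<lambda>x. facecut q (f x)) (15 * (real q)\<^sup>2 + 6 * real q)"
proof -
  note f12 = face_edges_swap12[OF f] and f23 = face_edges_swap23[OF f]
  note f231 = face_edges_swap23[OF f12] and f312 = face_edges_swap12[OF f23]
  note f321 = face_edges_swap12[OF f231]
  have "exp_le M t (\<lambda>x. facecut_tri q (f x) a b c) (facelength q a b c)" if abc: "a + b + c = 3 * q - 1" for a b c
  proof -
    have n: "a + b + c + 1 = 3 * q" using abc q by simp
    note e = face_edgesD[OF f n]
    have len: "2 * real q + 3 = (real q + 1) + (real q + 1) + 1" by simp
    consider "2 * q \<le> a \<or> 2 * q \<le> b \<or> 2 * q \<le> c" | "Suc a = 2 * q" | "Suc b = 2 * q" | "Suc c = 2 * q"
      | "Suc a < 2 * q" "Suc b < 2 * q" "Suc c < 2 * q" by linarith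
    then show ?thesis
    proof cases
      case 1
      then show ?thesis by (simp add: facecut_tri_def facelength_def exp_le_zero)
    next
      case 2
      then have "b \<le> q" "c \<le> q" "\<not> (2 * q \<le> a \<or> 2 * q \<le> b \<or> 2 * q \<le> c)" "Suc b \<noteq> 2 * q" "Suc c \<noteq> 2 * q"
        using abc q by auto
      moreover from this have "exp_le M t (\<lambda>x. spokecut q (\<lambda>u v w. f x u v w) c + spokecut q (\<lambda>u v w. f x u w v) b
          + cut (f x a (Suc b) c) (f x a b (Suc c))) (2 * real q + 3)"
        unfolding len using f f23 q by (intro exp_le_add exp_le_spokecut e)
      ultimately show ?thesis using 2 by (simp add: facecut_tri_def facelength_def)
    next
      case 3
      then have "a \<le> q" "c \<le> q" "\<not> (2 * q \<le> a \<or> 2 * q \<le> b \<or> 2 * q \<le> c)" "Suc a \<noteq> 2 * q" "Suc c \<noteq> 2 * q"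
        using abc q by auto
      moreover from this have "exp_le M t (\<lambda>x. spokecut q (\<lambda>u v w. f x v u w) c + spokecut q (\<lambda>u v w. f x w u v) a
          + cut (f x (Suc a) b c) (f x a b (Suc c))) (2 * real q + 3)"
        unfolding len using f12 f231 q by (intro exp_le_add exp_le_spokecut e)
      ultimately show ?thesis using 3 by (simp add: facecut_tri_def facelength_def)
    next
      case 4
      then have "a \<le> q" "b \<le> q" "\<not> (2 * q \<le> a \<or> 2 * q \<le> b \<or> 2 * q \<le> c)" "Suc a \<noteq> 2 * q" "Suc b \<noteq> 2 * q"
        using abc q by auto
      moreover from this have "exp_le M t (\<lambda>x. spokecut q (\<lambda>u v w. f x v w u) b + spokecut q (\<lambda>u v w. f x w v u) a
          + cut (f x (Suc a) b c) (f x a (Suc b) c)) (2 * real q + 3)"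
        unfolding len using f312 f321 q by (intro exp_le_add exp_le_spokecut e)
      ultimately show ?thesis using 4 by (simp add: facecut_tri_def facelength_def)
    next
      case 5
      have "exp_le M t (\<lambda>x. tricut (f x) a b c) (1 + 1 + 1)"
        unfolding tricut_def by (intro exp_le_add e)
      then show ?thesis using 5 by (simp add: facecut_tri_def facelength_def)
    qed
  qed
  from exp_le_sum_tri[of "3 * q - 1" M t "\<lambda>x. facecut_tri q (f x)" "facelength q", OF this]
  show ?thesis unfolding facecut_def sum_facelength[OF q] .
qed

lemma exp_le_cornercut:
  assumes f: "face_edges M t n h" and m: "m \<le> n"
  shows "exp_le M t (\<lambda>x. cornercut n m (h x)) (3 * real m)"
proof -
  have "exp_le M t (\<lambda>x. pathcut (\<lambda>t. h x (n - t) t 0) m) (real m)"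
  proof (rule exp_le_pathcut)
    fix i assume "i < m"
    then have sum: "n - Suc i + i + 0 + 1 = n" and e: "n - i = Suc (n - Suc i)" using m by auto
    show "exp_le M t (\<lambda>x. cut (h x (n - i) i 0) (h x (n - Suc i) (Suc i) 0)) 1"
      unfolding e by (rule face_edgesD(1)[OF f sum])
  qed
  moreover have "exp_le M t (\<lambda>x. pathcut (\<lambda>t. h x (n - t) 0 t) m) (real m)"
  proof (rule exp_le_pathcut)
    fix i assume "i < m"
    then have sum: "n - Suc i + 0 + i + 1 = n" and e: "n - i = Suc (n - Suc i)" using m by auto
    show "exp_le M t (\<lambda>x. cut (h x (n - i) 0 i) (h x (n - Suc i) 0 (Suc i))) 1"
      unfolding e by (rule face_edgesD(2)[OF f sum])
  qed
  moreover have "exp_le M t (\<lambda>x. pathcut (\<lambda>t. h x (n - m) (m - t) t) m) (real m)"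
  proof (rule exp_le_pathcut)
    fix i assume "i < m"
    then have sum: "(n - m) + (m - Suc i) + i + 1 = n" and e: "m - i = Suc (m - Suc i)" using m by auto
    show "exp_le M t (\<lambda>x. cut (h x (n - m) (m - i) i) (h x (n - m) (m - Suc i) (Suc i))) 1"
      unfolding e by (rule face_edgesD(3)[OF f sum])
  qed
  ultimately have "exp_le M t (\<lambda>x. cornercut n m (h x)) (real m + real m + real m)"
    unfolding cornercut_def by (intro exp_le_add)
  then show ?thesis by (simp add: algebra_simps)
qed

lemma exp_le_corners:
  assumes f: "face_edges M t n f" and m: "m \<le> n"
  shows "exp_le M t (\<lambda>x. corners n m (f x)) (9 * real m)"
proof -
  have "exp_le M t (\<lambda>x. corners n m (f x)) (3 * real m + 3 * real m + 3 * real m)"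
    unfolding corners_def
    using f face_edges_swap12[OF f] face_edges_swap12[OF face_edges_swap23[OF f]] m
    by (intro exp_le_add exp_le_cornercut)
  then show ?thesis by simp
qed

definition grid_edges :: "'w measure \<Rightarrow> real \<Rightarrow> nat \<Rightarrow> ('w \<Rightarrow> labelling4) \<Rightarrow> bool" where
  "grid_edges M t n X \<longleftrightarrow> (\<forall>a b c d. a + b + c + d + 1 = n \<longrightarrow>
     exp_le M t (\<lambda>x. cut (X x (Suc a) b c d) (X x a (Suc b) c d)) 1 \<and>
     exp_le M t (\<lambda>x. cut (X x (Suc a) b c d) (X x a b (Suc c) d)) 1 \<and>
     exp_le M t (\<lambda>x. cut (X x (Suc a) b c d) (X x a b c (Suc d))) 1 \<and>
     exp_le M t (\<lambda>x. cut (X x a (Suc b) c d) (X x a b (Suc c) d)) 1 \<and>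
     exp_le M t (\<lambda>x. cut (X x a (Suc b) c d) (X x a b c (Suc d))) 1 \<and>
     exp_le M t (\<lambda>x. cut (X x a b (Suc c) d) (X x a b c (Suc d))) 1)"

lemma grid_edgesD:
  assumes "grid_edges M t n X" "a + b + c + d + 1 = n"
  shows "exp_le M t (\<lambda>x. cut (X x (Suc a) b c d) (X x a (Suc b) c d)) 1"
    "exp_le M t (\<lambda>x. cut (X x (Suc a) b c d) (X x a b (Suc c) d)) 1"
    "exp_le M t (\<lambda>x. cut (X x (Suc a) b c d) (X x a b c (Suc d))) 1"
    "exp_le M t (\<lambda>x. cut (X x a (Suc b) c d) (X x a b (Suc c) d)) 1"
    "exp_le M t (\<lambda>x. cut (X x a (Suc b) c d) (X x a b c (Suc d))) 1"
    "exp_le M t (\<lambda>x. cut (X x a b (Suc c) d) (X x a b c (Suc d))) 1"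
  using assms unfolding grid_edges_def by blast+

lemma grid_edges_faces:
  assumes "grid_edges M t n X"
  shows "face_edges M t n (\<lambda>x a b c. X x a b c 0)" "face_edges M t n (\<lambda>x a b c. X x a b 0 c)"
    "face_edges M t n (\<lambda>x a b c. X x a 0 b c)" "face_edges M t n (\<lambda>x a b c. X x 0 a b c)"
  unfolding face_edges_def
  using grid_edgesD(1,2,4)[OF assms, where d = 0] grid_edgesD(1,3,5)[OF assms, where c = 0]
    grid_edgesD(2,3,6)[OF assms, where b = 0] grid_edgesD(4,5,6)[OF assms, where a = 0]
  by simp_all

lemma exp_le_totalcut:
  assumes X: "grid_edges M t (3 * q) X" and q: "q \<ge> 2" and m: "m \<le> q"
  shows "exp_le M t (\<lambda>x. totalcut q m (X x))
    (9 / 8 * real (3 * q) * (4 * (15 * (real q)\<^sup>2 + 6 * real q))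
     + ((real (3 * q))\<^sup>2 / 4 - 3 / 4 * (real m)\<^sup>2) * (6 * real (3 * q))
     + 3 / 16 * real (m * (m + 1)) * (36 * real m)
     + real (3 * q) * (real (3 * q) + 1) * (real (3 * q) + 2))"
proof -
  let ?n = "3 * q"
  note fe = grid_edges_faces[OF X]
  have facesum: "exp_le M t (\<lambda>x. facesum F (X x)) (4 * w)"
    if "\<And>f. face_edges M t ?n f \<Longrightarrow> exp_le M t (\<lambda>x. F (f x)) w" for F w
  proof -
    have "exp_le M t (\<lambda>x. facesum F (X x)) (w + w + w + w)"
      unfolding facesum_def by (intro exp_le_add that fe)
    then show ?thesis by (simp add: algebra_simps)
  qed
  have side: "exp_le M t (\<lambda>x. pathcut (\<lambda>t. f x (?n - t) t 0) ?n) (real ?n)" if f: "face_edges M t ?n f" for f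
  proof (rule exp_le_pathcut)
    fix i assume "i < ?n"
    then have sum: "?n - Suc i + i + 0 + 1 = ?n" and e: "?n - i = Suc (?n - Suc i)" by auto
    show "exp_le M t (\<lambda>x. cut (f x (?n - i) i 0) (f x (?n - Suc i) (Suc i) 0)) 1"
      unfolding e by (rule face_edgesD(1)[OF f sum])
  qed
  have "exp_le M t (\<lambda>x. sidecut ?n (X x)) (real ?n + real ?n + real ?n + real ?n + real ?n + real ?n)"
    unfolding sidecut_def
    by (intro exp_le_add side[OF fe(1)] side[OF face_edges_swap23[OF fe(1)]] side[OF face_edges_swap23[OF fe(2)]]
        side[OF fe(4)] side[OF face_edges_swap23[OF fe(4)]]
        side[OF face_edges_swap23[OF face_edges_swap12[OF fe(4)]]]
        side[OF face_edges_swap23[OF face_edges_swap12[OF fe(3)]]])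
  then have sides: "exp_le M t (\<lambda>x. sidecut ?n (X x)) (6 * real ?n)" by (simp add: algebra_simps)
  have v: "exp_le M t (\<lambda>x. volcut ?n (X x)) (real (card (quad (?n - 1))) * (1 + 1 + 1 + 1 + 1 + 1))"
    unfolding volcut_def cut4_def
    using q by (intro exp_le_sum_quad exp_le_add grid_edgesD[OF X]) auto
  have v_eq: "real (card (quad (?n - 1))) * (1 + 1 + 1 + 1 + 1 + 1) = real ?n * (real ?n + 1) * (real ?n + 2)"
    using arg_cong[OF card_quad[of "?n - 1"], of real] q by (simp add: algebra_simps)
  have vol: "exp_le M t (\<lambda>x. volcut ?n (X x)) (real ?n * (real ?n + 1) * (real ?n + 2))"
    using v unfolding v_eq .
  have fc: "exp_le M t (\<lambda>x. facesum (facecut q) (X x)) (4 * (15 * (real q)\<^sup>2 + 6 * real q))"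
    by (rule facesum) (rule exp_le_facecut[OF _ q])
  have "exp_le M t (\<lambda>x. facesum (corners ?n m) (X x)) (4 * (9 * real m))"
    using m by (intro facesum exp_le_corners) auto
  then have co: "exp_le M t (\<lambda>x. facesum (corners ?n m) (X x)) (36 * real m)" by simp
  have "(real m)\<^sup>2 \<le> (real ?n)\<^sup>2" using m by (intro power_mono) auto
  moreover have "(3 * real m)\<^sup>2 \<le> (real ?n)\<^sup>2" using m by (intro power_mono) auto
  then have "9 * (real m)\<^sup>2 \<le> (real ?n)\<^sup>2" by (simp add: power_mult_distrib)
  ultimately have w: "0 \<le> (real ?n)\<^sup>2 / 4 - 3 / 4 * (real m)\<^sup>2" using zero_le_power2[of "real m"] by linarith
  show ?thesis
    unfolding totalcut_def using fc sides co vol w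
    by (intro exp_le_add exp_le_cmult) auto
qed

subsection \<open>Transfer to an arbitrary grid\<close>

text \<open>The cubic coefficients \<open>235710\<close> and \<open>196398\<close> have ratio
  1.200164..., just above the target. The margin \<open>235710 - 1.20016 * 196398\<close> is about
  0.976, while the quadratic terms amount to about \<open>13812 * K^2\<close>; this is why
  \<open>K\<close> must be so large.\<close>

lemma totalcut_weights:
  fixes K :: real
  assumes K: "K \<ge> 20000" and n: "n = 27 * K" and q: "q = 9 * K" and m: "m = 2 * K"
  shows "1.20016 * (9 / 8 * n * (4 * (15 * q\<^sup>2 + 6 * q)) + (n\<^sup>2 / 4 - 3 / 4 * m\<^sup>2) * (6 * n)
     + 3 / 16 * (m * (m + 1)) * (36 * m) + n * (n + 1) * (n + 2))
    \<le> n * (12 * n\<^sup>2 - 9 / 2 * m\<^sup>2 - 9 / 2 * n)"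
proof -
  have W: "9 / 8 * n * (4 * (15 * q\<^sup>2 + 6 * q)) + (n\<^sup>2 / 4 - 3 / 4 * m\<^sup>2) * (6 * n)
     + 3 / 16 * (m * (m + 1)) * (36 * m) + n * (n + 1) * (n + 2) = 196398 * K ^ 3 + 8775 * K\<^sup>2 + 54 * K"
    unfolding n q m by (simp add: power2_eq_square power3_eq_cube algebra_simps)
  have B: "n * (12 * n\<^sup>2 - 9 / 2 * m\<^sup>2 - 9 / 2 * n) = 235710 * K ^ 3 - 6561 / 2 * K\<^sup>2"
    unfolding n m by (simp add: power2_eq_square power3_eq_cube algebra_simps)
  have "K * K\<^sup>2 \<ge> 20000 * K\<^sup>2" using K by (intro mult_right_mono) auto
  moreover have "K * K \<ge> 1 * K" using K by (intro mult_right_mono) auto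
  ultimately have "K ^ 3 \<ge> 20000 * K\<^sup>2" "K\<^sup>2 \<ge> K" by (simp_all add: power2_eq_square power3_eq_cube)
  then show ?thesis unfolding W B using K by simp
qed

section \<open>Rounding a fixed grid to mesh \<open>1 / N\<close>\<close>

definition rnd :: "nat \<Rightarrow> nat \<Rightarrow> nat \<Rightarrow> real" where
  "rnd n N k = real (N * k div n) / real N"

text \<open>Rounding the partial sums of the coordinates to multiples of \<open>1 / N\<close> maps vanishing coordinates
  to vanishing coordinates.\<close>

definition rpoint :: "nat \<Rightarrow> nat \<Rightarrow> nat \<Rightarrow> nat \<Rightarrow> nat \<Rightarrow> nat \<Rightarrow> nat \<Rightarrow> real" where
  "rpoint n N a b c d = (\<lambda>i. if i = 1 then rnd n N a else if i = 2 then rnd n N (a + b) - rnd n N a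
     else if i = 3 then rnd n N (a + b + c) - rnd n N (a + b)
     else if i = 4 then rnd n N (a + b + c + d) - rnd n N (a + b + c) else 0)"

lemma atLeastAtMost_1_4: "{1..4} = {1, 2, 3, 4 :: nat}"
  by auto

lemma rnd_mono: "j \<le> k \<Longrightarrow> rnd n N j \<le> rnd n N k"
  unfolding rnd_def by (intro divide_right_mono) (auto intro: div_le_mono)

lemma rnd_0 [simp]: "rnd n N 0 = 0"
  by (simp add: rnd_def)

lemma rnd_full: "n > 0 \<Longrightarrow> N > 0 \<Longrightarrow> rnd n N n = 1"
  by (simp add: rnd_def)

lemma rnd_bounds:
  assumes "n > 0" "N > 0"
  shows "real k / real n - 1 / real N \<le> rnd n N k" "rnd n N k \<le> real k / real n"
proof -
  define e where "e = N * k div n"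
  have "e * n \<le> N * k" unfolding e_def by simp
  then have "real e * real n \<le> real N * real k" by (metis of_nat_le_iff of_nat_mult)
  then show "rnd n N k \<le> real k / real n"
    using assms unfolding rnd_def e_def[symmetric] by (simp add: field_simps)
  have "N * k \<le> (e + 1) * n"
    unfolding e_def using assms by (metis Suc_eq_plus1 dividend_less_div_times less_imp_le mult_Suc add.commute)
  then have "real N * real k \<le> (real e + 1) * real n" by (metis of_nat_le_iff of_nat_mult of_nat_add of_nat_1)
  then have "real k / real n \<le> (real e + 1) / real N"
    using assms by (simp add: field_simps)
  then show "real k / real n - 1 / real N \<le> rnd n N k"
    unfolding rnd_def e_def[symmetric] by (simp add: add_divide_distrib)
qed

lemma rpoint_in_grid:
  assumes "n > 0" "N > 0" "a + b + c + d = n"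
  shows "rpoint n N a b c d \<in> simplex_grid 4 N"
proof -
  have full: "rnd n N (a + b + c + d) = 1" using assms rnd_full by simp
  have mono: "0 \<le> rnd n N a" "rnd n N a \<le> rnd n N (a + b)" "rnd n N (a + b) \<le> rnd n N (a + b + c)"
    "rnd n N (a + b + c) \<le> 1"
    using rnd_mono[of 0 a n N] rnd_mono[of a "a + b" n N] rnd_mono[of "a + b" "a + b + c" n N]
      rnd_mono[of "a + b + c" "a + b + c + d" n N] full by simp_all
  have "\<exists>z::int. rnd n N j - rnd n N k = of_int z / of_nat N" for j k
    by (rule exI[of _ "int (N * j div n) - int (N * k div n)"]) (simp add: rnd_def diff_divide_distrib)
  from this[of a 0] this[of "a + b" a] this[of "a + b + c" "a + b"] this[of "a + b + c + d" "a + b + c"]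
  have "\<forall>i\<in>{1..4}. \<exists>z::int. rpoint n N a b c d i = of_int z / of_nat N"
    unfolding atLeastAtMost_1_4 by (simp add: rpoint_def)
  moreover have "rpoint n N a b c d \<in> std_simplex 4"
    unfolding std_simplex_def atLeastAtMost_1_4 using mono full by (auto simp: rpoint_def)
  ultimately show ?thesis by (simp add: simplex_grid_def)
qed

text \<open>Rounding lowers each partial sum by at most \<open>1 / N\<close>. The difference of two
  coordinates involves four partial sums, two with each sign, so its error is at most
  \<open>2 / N\<close>, and there are four coordinates.\<close>

lemma l1_dist_rpoint:
  assumes "n > 0" "N > 0"
    and "\<bar>real a - real a'\<bar> + \<bar>real b - real b'\<bar> + \<bar>real c - real c'\<bar> + \<bar>real d - real d'\<bar> \<le> 2"
  shows "1 / 2 * l1_dist 4 (rpoint n N a b c d) (rpoint n N a' b' c' d') \<le> 1 / real n + 4 / real N"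
proof -
  define r where "r j k = rnd n N (j + k) - rnd n N j" for j k
  have diff: "\<bar>r j k - r j' k'\<bar> \<le> \<bar>real k - real k'\<bar> / real n + 2 / real N" for j k j' k'
  proof -
    have "real (j + k) / real n - real j / real n = real k / real n"
      "real (j' + k') / real n - real j' / real n = real k' / real n" by (simp_all add: add_divide_distrib)
    then have "\<bar>r j k - r j' k'\<bar> \<le> \<bar>real k / real n - real k' / real n\<bar> + 2 / real N"
      using rnd_bounds[OF assms(1,2), of "j + k"] rnd_bounds[OF assms(1,2), of j]
        rnd_bounds[OF assms(1,2), of "j' + k'"] rnd_bounds[OF assms(1,2), of j']
      unfolding r_def by linarith
    then show ?thesis using assms(1) by (simp add: diff_divide_distrib[symmetric] abs_divide)
  qed
  have "l1_dist 4 (rpoint n N a b c d) (rpoint n N a' b' c' d')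
      = \<bar>r 0 a - r 0 a'\<bar> + \<bar>r a b - r a' b'\<bar> + \<bar>r (a + b) c - r (a' + b') c'\<bar> + \<bar>r (a + b + c) d - r (a' + b' + c') d'\<bar>"
    unfolding l1_dist_def atLeastAtMost_1_4 by (simp add: rpoint_def r_def)
  also have "\<dots> \<le> (\<bar>real a - real a'\<bar> + \<bar>real b - real b'\<bar> + \<bar>real c - real c'\<bar> + \<bar>real d - real d'\<bar>) / real n + 8 / real N"
    using diff[of 0 a 0 a'] diff[of a b a' b'] diff[of "a + b" c "a' + b'" c'] diff[of "a + b + c" d "a' + b' + c'" d']
    unfolding add_divide_distrib by linarith
  also have "\<dots> \<le> 2 / real n + 8 / real N"
    using assms by (intro add_right_mono divide_right_mono) auto
  finally show ?thesis by simp
qed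

lemma finite_simplex_grid: "finite (simplex_grid 4 N)"
proof (cases "N = 0")
  \<comment> \<open>Division by zero yields 0, so all coordinates vanish and cannot sum to
    1.\<close>
  case True
  have "x 1 = 0 \<and> x 2 = 0 \<and> x 3 = 0 \<and> x 4 = 0 \<and> x 1 + x 2 + x 3 + x 4 = 1" if "x \<in> simplex_grid 4 N" for x
    using that True unfolding simplex_grid_def std_simplex_def atLeastAtMost_1_4 by auto
  then have "simplex_grid 4 N = {}" by fastforce
  then show ?thesis by simp
next
  case False
  define V where "V = (\<lambda>z::int. of_int z / real N) ` {0..int N}"
  have "simplex_grid 4 N \<subseteq> (\<lambda>(u, v, w, y) i. if i = 1 then u else if i = 2 then v else if i = 3 then w
      else if i = 4 then y else 0) ` (V \<times> V \<times> V \<times> V)"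
  proof
    fix x assume x: "x \<in> simplex_grid 4 N"
    have "x i \<in> V" if i: "i \<in> {1..4}" for i
    proof -
      obtain z :: int where z: "x i = of_int z / of_nat N" using x i unfolding simplex_grid_def by blast
      have "0 \<le> x i" "x i \<le> 1" using x i unfolding simplex_grid_def std_simplex_def by auto
      then have "0 \<le> z" "z \<le> int N" unfolding z using False by (auto simp: field_simps)
      then show ?thesis unfolding V_def z by auto
    qed
    moreover have "x i = 0" if "i \<notin> {1..4}" for i
      using x that unfolding simplex_grid_def std_simplex_def by auto
    ultimately show "x \<in> (\<lambda>(u, v, w, y) i. if i = 1 then u else if i = 2 then v else if i = 3 then w
      else if i = 4 then y else 0) ` (V \<times> V \<times> V \<times> V)"
      by (intro image_eqI[of _ _ "(x 1, x 2, x 3, x 4)"]) (auto simp: atLeastAtMost_1_4)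
  qed
  then show ?thesis by (rule finite_subset) (auto simp: V_def)
qed

section \<open>Cut probabilities, distributions over cuts, and \<open>tau\<close>\<close>

lemma l1_dist_pos:
  assumes "x \<in> std_simplex k" "y \<in> std_simplex k" "x \<noteq> y"
  shows "l1_dist k x y > 0"
proof -
  obtain i where i: "x i \<noteq> y i" using assms(3) by auto
  then have "i \<in> {1..k}" using assms unfolding std_simplex_def by force
  then have "\<bar>x i - y i\<bar> \<le> l1_dist k x y"
    unfolding l1_dist_def by (intro member_le_sum) auto
  then show ?thesis using i by simp
qed

lemma prob_le_tau:
  assumes x: "x \<in> simplex_grid 4 N" "y \<in> simplex_grid 4 N" and "x \<noteq> y"
  shows "measure M {P \<in> space M. P x \<noteq> P y} \<le> tau 4 N M * (1 / 2 * l1_dist 4 x y)" "0 \<le> tau 4 N M"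
proof -
  let ?r = "\<lambda>x y. measure M {P \<in> space M. P x \<noteq> P y} / (1 / 2 * l1_dist 4 x y)"
  let ?S = "{?r x y | x y. x \<in> simplex_grid 4 N \<and> y \<in> simplex_grid 4 N \<and> x \<noteq> y}"
  have "?S \<subseteq> (\<lambda>(x, y). ?r x y) ` (simplex_grid 4 N \<times> simplex_grid 4 N)" by auto
  then have "finite ?S" by (rule finite_subset) (simp add: finite_simplex_grid)
  then have le: "?r x y \<le> tau 4 N M"
    unfolding tau_def using assms by (intro Max_ge) auto
  have pos: "l1_dist 4 x y > 0" using assms l1_dist_pos unfolding simplex_grid_def by auto
  then show "measure M {P \<in> space M. P x \<noteq> P y} \<le> tau 4 N M * (1 / 2 * l1_dist 4 x y)"
    using le by (simp add: field_simps)
  have "0 \<le> ?r x y" using pos by simp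
  then show "0 \<le> tau 4 N M" using le by linarith
qed

lemma exp_le_cut:
  assumes M: "prob_space M" and A: "{P \<in> space M. u P \<noteq> v P} \<in> sets M"
    and le: "measure M {P \<in> space M. u P \<noteq> v P} \<le> t"
  shows "exp_le M t (\<lambda>P. cut (u P) (v P)) 1"
proof -
  interpret prob_space M by (rule M)
  let ?A = "{P \<in> space M. u P \<noteq> v P}"
  have eq: "cut (u P) (v P) = indicator ?A P" if "P \<in> space M" for P
    using that by (simp add: cut_def indicator_def)
  have "integrable M (indicator ?A :: _ \<Rightarrow> real)" using A by (simp add: less_top[symmetric])
  then have "integrable M (\<lambda>P. cut (u P) (v P))"
    by (subst Bochner_Integration.integrable_cong[OF refl eq]) auto
  moreover have "(\<integral>P. cut (u P) (v P) \<partial>M) = (\<integral>P. indicator ?A P \<partial>M)"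
    by (rule Bochner_Integration.integral_cong[OF refl eq])
  moreover have "(\<integral>P. indicator ?A P \<partial>M) = measure M ?A"
    using A sets.sets_into_space[OF A] by (simp add: Int_absorb2)
  ultimately show ?thesis using le by (simp add: exp_le_def)
qed

lemma non_opposite_support:
  assumes "P \<in> non_opposite_cuts 4" "x \<in> std_simplex 4"
  shows "P x \<in> {1, 2, 3, 4, 5}" "P x = i \<Longrightarrow> i \<noteq> 5 \<Longrightarrow> x i \<noteq> 0"
  using assms unfolding non_opposite_cuts_def support_def atLeastAtMost_1_4 by auto

lemma rpoint_terminals:
  assumes "n > 0" "N > 0"
  shows "rpoint n N n 0 0 0 = unit_vec 1" "rpoint n N 0 n 0 0 = unit_vec 2"
    "rpoint n N 0 0 n 0 = unit_vec 3" "rpoint n N 0 0 0 n = unit_vec 4"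
  using rnd_full[OF assms] by (auto simp: rpoint_def unit_vec_def fun_eq_iff)

lemma grid_cut_of_non_opposite:
  assumes P: "P \<in> non_opposite_cuts 4" and N: "N > 0" and n: "n = 3 * q" and q: "q \<ge> 2"
  shows "grid_cut n (\<lambda>a b c d. P (rpoint n N a b c d)) q"
proof
  have n0: "n > 0" using n q by simp
  have in_s: "rpoint n N a b c d \<in> std_simplex 4" if "a + b + c + d = n" for a b c d
    using rpoint_in_grid[OF n0 N that] by (simp add: simplex_grid_def)
  show "distinct [1, 2, 3, 4, 5 :: nat]" by simp
  fix a b c d assume *: "a + b + c + d = n"
  show "P (rpoint n N a b c d) \<in> {1, 2, 3, 4, 5}" by (rule non_opposite_support(1)[OF P in_s[OF *]])
  note supp = non_opposite_support(2)[OF P in_s[OF *]]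
  show "0 < a" if "P (rpoint n N a b c d) = 1" using supp[OF that] by (cases a) (auto simp: rpoint_def)
  show "0 < b" if "P (rpoint n N a b c d) = 2" using supp[OF that] by (cases b) (auto simp: rpoint_def)
  show "0 < c" if "P (rpoint n N a b c d) = 3" using supp[OF that] by (cases c) (auto simp: rpoint_def)
  show "0 < d" if "P (rpoint n N a b c d) = 4" using supp[OF that] by (cases d) (auto simp: rpoint_def)
next
  have n0: "n > 0" using n q by simp
  have u: "P (unit_vec i) = i" if "i \<in> {1..4}" for i
    using P that unfolding non_opposite_cuts_def cuts_def by auto
  show "P (rpoint n N n 0 0 0) = 1" "P (rpoint n N 0 n 0 0) = 2" "P (rpoint n N 0 0 n 0) = 3"
    "P (rpoint n N 0 0 0 n) = 4"
    unfolding rpoint_terminals[OF n0 N] by (simp_all add: u)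
qed (use n q in auto)

text \<open>The greatest-lower-bound argument for \<open>Inf\<close> requires a nonempty set. The
  point mass lives on \<open>count_space {P0}\<close>, so its space contains only a non-opposite cut
  and all evaluations are measurable.\<close>

lemma cut_distribution_exists: "\<exists>M. cut_distribution 4 (non_opposite_cuts 4) M"
proof -
  define P0 :: "(nat \<Rightarrow> real) \<Rightarrow> nat" where
    "P0 = restrict (\<lambda>x. if x 1 = 1 then 1 else if x 2 = 1 then 2 else if x 3 = 1 then 3
      else if x 4 = 1 then 4 else 5) (std_simplex 4)"
  have unit: "unit_vec i \<in> std_simplex 4" if "i \<in> {1, 2, 3, 4}" for i
    using that unfolding std_simplex_def atLeastAtMost_1_4 unit_vec_def by auto
  have app: "P0 x = (if x 1 = 1 then 1 else if x 2 = 1 then 2 else if x 3 = 1 then 3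
      else if x 4 = 1 then 4 else 5)" if "x \<in> std_simplex 4" for x
    using that by (simp add: P0_def)
  have "P0 (unit_vec i) = i" if "i \<in> {1, 2, 3, 4}" for i
    unfolding app[OF unit[OF that]] using that by (auto simp: unit_vec_def)
  moreover have "P0 \<in> std_simplex 4 \<rightarrow>\<^sub>E {1..4 + 1}"
    by (auto simp: P0_def)
  moreover have "P0 x \<in> support 4 x \<union> {4 + 1}" if "x \<in> std_simplex 4" for x
    unfolding app[OF that] support_def by auto
  ultimately have P0: "P0 \<in> non_opposite_cuts 4"
    unfolding non_opposite_cuts_def cuts_def atLeastAtMost_1_4 by blast
  let ?M = "return (count_space {P0}) P0"
  have "prob_space ?M" by (rule prob_space_return) simp
  moreover have "(\<lambda>P. P x) \<in> measurable ?M (count_space {1..4 + 1})" if "x \<in> std_simplex 4" for x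
    using non_opposite_support(1)[OF P0 that] by (auto simp: measurable_def)
  ultimately have "cut_distribution 4 (non_opposite_cuts 4) ?M"
    using P0 unfolding cut_distribution_def by simp
  then show ?thesis ..
qed

lemma sets_neq:
  assumes f: "f \<in> measurable M (count_space A)" and g: "g \<in> measurable M (count_space A)" and "finite A"
  shows "{x \<in> space M. f x \<noteq> g x} \<in> sets M"
proof -
  have "{x \<in> space M. f x \<noteq> g x} = (\<Union>i\<in>A. (f -` {i} \<inter> space M) - (g -` {i} \<inter> space M))"
    using measurable_space[OF f] by auto
  moreover have "f -` {i} \<inter> space M \<in> sets M" "g -` {i} \<inter> space M \<in> sets M" if "i \<in> A" for i
    using that by (auto intro!: measurable_sets[OF f] measurable_sets[OF g])
  ultimately show ?thesis using \<open>finite A\<close> by (auto intro!: sets.finite_UN)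
qed

lemma tau_ge:
  assumes M: "cut_distribution 4 (non_opposite_cuts 4) M" and N: "N \<ge> 1"
  shows "tau 4 N M \<ge> 1.20016 - 2700000 / real N"
proof -
  \<comment> \<open>This is \<open>K = 20000\<close>. The grid stays the same for all
    \<open>N\<close>; if \<open>N\<close> is small, rounding may identify some of its points, which
    the case \<open>?x = ?y\<close> below takes care of.\<close>
  define n q m :: nat where "n = 540000" and "q = 180000" and "m = 40000"
  have n: "n = 3 * q" "q \<ge> 2" "1 \<le> m" "m \<le> q" "n > 0" by (simp_all add: n_def q_def m_def)
  have N0: "N > 0" using N by simp
  have prob: "prob_space M" and space: "space M \<subseteq> non_opposite_cuts 4"
    and meas: "\<And>x. x \<in> std_simplex 4 \<Longrightarrow> (\<lambda>P. P x) \<in> measurable M (count_space {1..4 + 1})"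
    using M unfolding cut_distribution_def by auto
  interpret prob_space M by (rule prob)
  define \<tau> where "\<tau> = tau 4 N M"
  define t where "t = \<tau> * (1 / real n + 4 / real N)"
  define X where "X = (\<lambda>P :: (nat \<Rightarrow> real) \<Rightarrow> nat. \<lambda>a b c d. P (rpoint n N a b c d))"
  \<comment> \<open>Nonnegativity of the maximum \<open>\<tau>\<close> is read off from one pair of
    distinct points; two terminals provide it.\<close>
  have "rpoint n N n 0 0 0 \<noteq> rpoint n N 0 n 0 0"
    unfolding rpoint_terminals[OF n(5) N0] by (auto simp: unit_vec_def fun_eq_iff)
  then have \<tau>: "0 \<le> \<tau>"
    unfolding \<tau>_def using rpoint_in_grid[OF n(5) N0] by (intro prob_le_tau(2)) auto
  then have "0 \<le> t" unfolding t_def by simp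
  have edge: "exp_le M t (\<lambda>P. cut (X P a b c d) (X P a' b' c' d')) 1"
    if s: "a + b + c + d = n" "a' + b' + c' + d' = n"
      "\<bar>real a - real a'\<bar> + \<bar>real b - real b'\<bar> + \<bar>real c - real c'\<bar> + \<bar>real d - real d'\<bar> \<le> 2"
    for a b c d a' b' c' d'
    unfolding X_def
  proof (rule exp_le_cut[OF prob])
    let ?x = "rpoint n N a b c d" and ?y = "rpoint n N a' b' c' d'"
    have xy: "?x \<in> simplex_grid 4 N" "?y \<in> simplex_grid 4 N"
      using rpoint_in_grid[OF n(5) N0] s by auto
    then have ss: "?x \<in> std_simplex 4" "?y \<in> std_simplex 4" by (simp_all add: simplex_grid_def)
    show "{P \<in> space M. P ?x \<noteq> P ?y} \<in> sets M"
      by (rule sets_neq[OF meas[OF ss(1)] meas[OF ss(2)]]) simp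
    show "measure M {P \<in> space M. P ?x \<noteq> P ?y} \<le> t"
    proof (cases "?x = ?y")
      case True
      then show ?thesis using \<open>0 \<le> t\<close> by simp
    next
      case False
      have "measure M {P \<in> space M. P ?x \<noteq> P ?y} \<le> \<tau> * (1 / 2 * l1_dist 4 ?x ?y)"
        unfolding \<tau>_def by (rule prob_le_tau(1)[OF xy False])
      also have "\<dots> \<le> t"
        unfolding t_def using l1_dist_rpoint[OF n(5) N0 s(3)] \<tau> by (intro mult_left_mono)
      finally show ?thesis .
    qed
  qed
  have "grid_edges M t (3 * q) X"
    unfolding grid_edges_def n(1)[symmetric] by (intro allI impI conjI edge) auto
  note le = exp_le_totalcut[OF this n(2,4)]
  let ?B = "12 * (real n)\<^sup>2 - 9 / 2 * (real m)\<^sup>2 - 9 / 2 * real n"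
  let ?W = "9 / 8 * real n * (4 * (15 * (real q)\<^sup>2 + 6 * real q))
     + ((real n)\<^sup>2 / 4 - 3 / 4 * (real m)\<^sup>2) * (6 * real n)
     + 3 / 16 * real (m * (m + 1)) * (36 * real m) + real n * (real n + 1) * (real n + 2)"
  have int: "integrable M (\<lambda>P. totalcut q m (X P))" and ub: "(\<integral>P. totalcut q m (X P) \<partial>M) \<le> ?W * t"
    using le unfolding exp_le_def n(1)[symmetric] by blast+
  have "?B \<le> totalcut q m (X P)" if "P \<in> space M" for P
  proof -
    interpret g: grid_cut n "X P" q
      unfolding X_def using that space N0 n by (intro grid_cut_of_non_opposite) auto
    show ?thesis by (rule g.totalcut_ge) (use n in auto)
  qed
  then have "?B \<le> (\<integral>P. totalcut q m (X P) \<partial>M)"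
    using int by (intro integral_ge_const) auto
  then have BW: "?B \<le> ?W * t" using ub by linarith
  have mm: "real (m * (m + 1)) = real m * (real m + 1)"
    by (simp only: of_nat_mult of_nat_add of_nat_1)
  have W: "1.20016 * ?W \<le> real n * ?B"
    unfolding mm by (rule totalcut_weights[of 20000]) (simp_all add: n_def q_def m_def)
  have "0 < ?W" unfolding n_def q_def m_def by simp
  note W
  also have "real n * ?B \<le> real n * (?W * t)" using BW by (rule mult_left_mono) simp
  also have "\<dots> = (real n * t) * ?W" by (simp only: mult_ac)
  finally have "1.20016 \<le> real n * t" using \<open>0 < ?W\<close> by (rule mult_right_le_imp_le)
  also have "real n * t = \<tau> + \<tau> * (2160000 / real N)"
    unfolding t_def n_def by (simp add: field_simps)
  finally have main: "1.20016 \<le> \<tau> + \<tau> * (2160000 / real N)" .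
  show ?thesis
  \<comment> \<open>If \<open>\<tau>\<close> is at most 1.20016, the rounding error is at most
    \<open>1.20016 * 2160000 / N\<close>, which is below \<open>2700000 / N\<close>; here
    \<open>2160000 = 4 * n\<close>. A larger \<open>\<tau>\<close> satisfies the claim at
    once.\<close>
  proof (cases "\<tau> \<le> 1.20016")
    case True
    then have "\<tau> * (2160000 / real N) \<le> 1.20016 * (2160000 / real N)"
      by (intro mult_right_mono) auto
    moreover have "1.20016 * (2160000 / real N) \<le> 2700000 / real N"
      using N0 by (simp add: field_simps)
    ultimately show ?thesis using main unfolding \<tau>_def by linarith
  next
    case False
    have "0 \<le> 2700000 / real N" by simp
    then show ?thesis using False unfolding \<tau>_def by linarith
  qed
qed

theorem theorem2:
  "\<exists>C::real. C > 0 \<and> (\<forall>n::nat. n \<ge> 1 \<longrightarrow> tau_non_opposite 4 n \<ge> 1.20016 - C / real n)"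
proof (intro exI[of _ 2700000] conjI allI impI)
  fix n :: nat assume "n \<ge> 1"
  show "1.20016 - 2700000 / real n \<le> tau_non_opposite 4 n"
    unfolding tau_non_opposite_def
  proof (intro cInf_greatest)
    show "{tau 4 n M | M. cut_distribution 4 (non_opposite_cuts 4) M} \<noteq> {}"
      using cut_distribution_exists by blast
    fix x assume "x \<in> {tau 4 n M | M. cut_distribution 4 (non_opposite_cuts 4) M}"
    then obtain M where "x = tau 4 n M" "cut_distribution 4 (non_opposite_cuts 4) M" by blast
    then show "1.20016 - 2700000 / real n \<le> x" using tau_ge \<open>n \<ge> 1\<close> by simp
  qed
qed simp

end
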